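(* Let $(X,d,\mu)$ be a vertex weighted graph satisfying $\mathrm{V}(d_f)$ with volume growth exponent $d_f>0$. Let $K_1$ and $K_2$ be two $\mu$-symmetric Markov operators on $(X,d,\mu)$ whose kernels with respect to $\mu$ both satisfy $\mathrm{J}(\beta)$ for some (common) $\beta\ge2$. Then $K_1$ satisfies $\mathrm{HKP}(d_f,\beta)$ if and only if $K_2$ satisfies $\mathrm{HKP}(d_f,\beta)$.
   Context: Vertex weighted graph: $(X,E)$ is an infinite, simple, connected, locally finite graph with vertex set $X$, $d$ is the graph distance (minimal number of edges in an edge path), and $\mu$ is a measure on $X$; write $\mu(x)=\mu(\{x\})$. $B(x,r)=\{y\in X: d(x,y)\le r\}$, $V(x,r)=\mu(B(x,r))$, $\mathbb{N}^*=\{1,2,3,\dots\}$. $\mathrm{V}(d_f)$: there exists $C_V>0$ such that $C_V^{-1}r^{d_f}\le V(x,r)\le C_V r^{d_f}$ for all $r\ge 1$, $x\in X$. A $\mu$-symmetric Markov operator $K:\ell^\infty(X)\to\ell^\infty(X)$ is one given by a kernel $k:X\times X\to[0,\infty)$ with $k(x,y)=k(y,x)$, $\sum_{y\in X}k(x,y)\mu(y)=1$ for all $x$, and $Kf(x)=\sum_{y\in X}k(x,y)f(y)\mu(y)$. For $n\in\mathbb{N}^*$, $k_n(x,y)$ denotes the kernel of $K^n$ with respect to $\mu$ (so $k_1=k$). $\mathrm{J}(\beta)$: there exists $C>0$ such that $C^{-1}(1+d(x,y))^{-(d_f+\beta)}\le k(x,y)=k(y,x)\le C(1+d(x,y))^{-(d_f+\beta)}$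 for all $x,y\in X$. $\mathrm{HKP}(d_f,\beta)$: there exists $C>0$ such that for all $x,y\in X$ and $n\in\mathbb{N}^*$, $$C^{-1}\min\left(\frac{1}{n^{d_f/\beta}},\frac{n}{d(x,y)^{d_f+\beta}}\right)\le k_n(x,y)\le C\min\left(\frac{1}{n^{d_f/\beta}},\frac{n}{d(x,y)^{d_f+\beta}}\right)$$ (for $x=y$ the second entry of the minimum is $+\infty$). *)

theory Defs
  imports "HOL-Analysis.Analysis"
begin

text \<open>The vertex set is the whole type \<^typ>\<open>'a\<close>; a simple graph is its adjacency relation.\<close>

definition infinite_graph :: "('a \<Rightarrow> 'a \<Rightarrow> bool) \<Rightarrow> bool" where
  "infinite_graph E \<longleftrightarrow>
     infinite (UNIV :: 'a set) \<and>
     (\<forall>x. \<not> E x x) \<and>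
     (\<forall>x y. E x y \<longrightarrow> E y x) \<and>
     (\<forall>x y. \<exists>n. (E ^^ n) x y) \<and>
     (\<forall>x. finite {y. E x y})"

definition graph_dist :: "('a \<Rightarrow> 'a \<Rightarrow> bool) \<Rightarrow> 'a \<Rightarrow> 'a \<Rightarrow> nat" where
  "graph_dist E x y = (LEAST n. (E ^^ n) x y)"

text \<open>The measure is defined on all subsets. Neither finiteness nor positivity of the point masses
  is part of the definition; the volume condition below makes all balls of finite measure.\<close>

definition vertex_weighted_graph :: "('a \<Rightarrow> 'a \<Rightarrow> bool) \<Rightarrow> 'a measure \<Rightarrow> bool" where
  "vertex_weighted_graph E M \<longleftrightarrow> infinite_graph E \<and> space M = UNIV \<and> sets M = Pow UNIV"

definition graph_ball :: "('a \<Rightarrow> 'a \<Rightarrow> bool) \<Rightarrow> 'a \<Rightarrow> real \<Rightarrow> 'a set" where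
  "graph_ball E x r = {y. real (graph_dist E x y) \<le> r}"

definition volume_growth :: "('a \<Rightarrow> 'a \<Rightarrow> bool) \<Rightarrow> 'a measure \<Rightarrow> real \<Rightarrow> bool" where
  "volume_growth E M d_f \<longleftrightarrow>
     (\<exists>C>0. \<forall>x. \<forall>r\<ge>1.
        ennreal (inverse C * r powr d_f) \<le> emeasure M (graph_ball E x r) \<and>
        emeasure M (graph_ball E x r) \<le> ennreal (C * r powr d_f))"

text \<open>An operator on bounded functions is a map on all functions of which only the values
  at bounded functions matter.\<close>

definition has_kernel ::
  "'a measure \<Rightarrow> (('a \<Rightarrow> real) \<Rightarrow> ('a \<Rightarrow> real)) \<Rightarrow> ('a \<Rightarrow> 'a \<Rightarrow> real) \<Rightarrow> bool" where
  "has_kernel M T q \<longleftrightarrow>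
     (\<forall>f. bounded (range f) \<longrightarrow>
        (\<forall>x. ((\<lambda>y. q x y * f y * measure M {y}) has_sum T f x) UNIV))"

definition symmetric_markov_operator ::
  "'a measure \<Rightarrow> (('a \<Rightarrow> real) \<Rightarrow> ('a \<Rightarrow> real)) \<Rightarrow> ('a \<Rightarrow> 'a \<Rightarrow> real) \<Rightarrow> bool" where
  "symmetric_markov_operator M K k \<longleftrightarrow>
     (\<forall>x y. 0 \<le> k x y) \<and>
     (\<forall>x y. k x y = k y x) \<and>
     (\<forall>x. ((\<lambda>y. k x y * measure M {y}) has_sum 1) UNIV) \<and>
     has_kernel M K k"

text \<open>The kernel of the power \<open>K\<^sup>n\<close>, \<open>n \<ge> 1\<close>, where \<open>k\<close> is the kernel of \<open>K\<close>: applying \<open>K\<close> in the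
  first variable of a kernel \<open>k\<^sub>n\<close> gives \<open>k\<^sub>n\<^sub>+\<^sub>1(x,y) = \<Sum>z. k(x,z) k\<^sub>n(z,y) \<mu>(z)\<close>. That this is a kernel
  of \<open>K\<^sup>n\<close>, and the only one at points of positive mass, is shown below
  (\<open>has_kernel_iterated_kernel\<close>, \<open>has_kernel_unique\<close>). The value at \<open>n = 0\<close> is irrelevant.\<close>

definition iterated_kernel ::
  "(('a \<Rightarrow> real) \<Rightarrow> ('a \<Rightarrow> real)) \<Rightarrow> ('a \<Rightarrow> 'a \<Rightarrow> real) \<Rightarrow> nat \<Rightarrow> 'a \<Rightarrow> 'a \<Rightarrow> real" where
  "iterated_kernel K k n x y = (K ^^ (n - 1)) (\<lambda>z. k z y) x"

definition jump_kernel_bounds ::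
  "('a \<Rightarrow> 'a \<Rightarrow> bool) \<Rightarrow> real \<Rightarrow> real \<Rightarrow> ('a \<Rightarrow> 'a \<Rightarrow> real) \<Rightarrow> bool" where
  "jump_kernel_bounds E d_f \<beta> k \<longleftrightarrow>
     (\<exists>C>0. \<forall>x y.
        inverse C * (1 + real (graph_dist E x y)) powr (- (d_f + \<beta>)) \<le> k x y \<and>
        k x y = k y x \<and>
        k x y \<le> C * (1 + real (graph_dist E x y)) powr (- (d_f + \<beta>)))"

text \<open>On the diagonal the second entry of the minimum is \<open>+\<infinity>\<close>, so it is dropped there.\<close>

definition heat_kernel_profile ::
  "('a \<Rightarrow> 'a \<Rightarrow> bool) \<Rightarrow> real \<Rightarrow> real \<Rightarrow> nat \<Rightarrow> 'a \<Rightarrow> 'a \<Rightarrow> real" where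
  "heat_kernel_profile E d_f \<beta> n x y =
     (if x = y then 1 / real n powr (d_f / \<beta>)
      else min (1 / real n powr (d_f / \<beta>))
               (real n / real (graph_dist E x y) powr (d_f + \<beta>)))"

definition heat_kernel_bounds ::
  "('a \<Rightarrow> 'a \<Rightarrow> bool) \<Rightarrow> real \<Rightarrow> real \<Rightarrow>
   (('a \<Rightarrow> real) \<Rightarrow> ('a \<Rightarrow> real)) \<Rightarrow> ('a \<Rightarrow> 'a \<Rightarrow> real) \<Rightarrow> bool" where
  "heat_kernel_bounds E d_f \<beta> K k \<longleftrightarrow>
     (\<exists>C>0. \<forall>x y. \<forall>n\<ge>1.
        inverse C * heat_kernel_profile E d_f \<beta> n x y \<le> iterated_kernel K k n x y \<and>
        iterated_kernel K k n x y \<le> C * heat_kernel_profile E d_f \<beta> n x y)"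

lemma has_kernel_unique:
  assumes p: "has_kernel M T p" and q: "has_kernel M T q" and y: "measure M {y} > 0"
  shows "p x y = q x y"
proof -
  have b: "bounded (range (indicator {y} :: 'a \<Rightarrow> real))"
    by (rule boundedI[of _ 1]) (auto simp: indicator_def)
  have *: "T (indicator {y}) x = r x y * measure M {y}" if "has_kernel M T r" for r
  proof -
    have "((\<lambda>z. r x z * indicator {y} z * measure M {z}) has_sum T (indicator {y}) x) UNIV"
      using that b unfolding has_kernel_def by blast
    moreover have "((\<lambda>z. r x z * indicator {y} z * measure M {z}) has_sum r x y * measure M {y}) UNIV"
      by (rule has_sum_finiteI[of "{y}", THEN has_sum_cong_neutral[THEN iffD1, rotated -1]]) auto
    ultimately show ?thesis by (rule has_sum_unique)
  qed
  show ?thesis using *[OF p] *[OF q] y by simp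
qed

lemma symmetric_markov_operator_mono:
  assumes K: "symmetric_markov_operator M K k" and f: "\<And>y. 0 \<le> f y" "\<And>y. f y \<le> B"
  shows "0 \<le> K f x" "K f x \<le> B"
proof -
  have "bounded (range f)"
    using f by (intro boundedI[of _ B]) auto
  then have s: "((\<lambda>y. k x y * f y * measure M {y}) has_sum K f x) UNIV"
    using K unfolding symmetric_markov_operator_def has_kernel_def by blast
  have k0: "\<And>y. 0 \<le> k x y" and k1: "((\<lambda>y. k x y * measure M {y}) has_sum 1) UNIV"
    using K unfolding symmetric_markov_operator_def by blast+
  show "0 \<le> K f x" by (rule has_sum_nonneg[OF s]) (simp add: k0 f)
  have "((\<lambda>y. B * (k x y * measure M {y})) has_sum B * 1) UNIV"
    by (rule has_sum_cmult_right[OF k1])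
  moreover have "k x y * f y * measure M {y} \<le> B * (k x y * measure M {y})" for y
    using mult_right_mono[OF f(2)[of y], of "k x y * measure M {y}"] k0[of y]
    by (simp add: mult_ac)
  ultimately show "K f x \<le> B" using has_sum_mono[OF s] by fastforce
qed

lemma has_kernel_iterated_kernel:
  assumes K: "symmetric_markov_operator M K k" and B: "\<And>x y. k x y \<le> B" and n: "1 \<le> n"
  shows "has_kernel M (K ^^ n) (iterated_kernel K k n)"
  using n
proof (induction n rule: nat_induct_at_least)
  case base
  then show ?case using K by (simp add: iterated_kernel_def symmetric_markov_operator_def)
next
  case (Suc n)
  let ?\<mu> = "\<lambda>y. measure M {y}"
  let ?p = "iterated_kernel K k n"
  have k0: "\<And>x y. 0 \<le> k x y" and k1: "\<And>x. ((\<lambda>y. k x y * ?\<mu> y) has_sum 1) UNIV"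
    and hk: "has_kernel M K k"
    using K unfolding symmetric_markov_operator_def by blast+
  have "0 \<le> (K ^^ m) (\<lambda>z. k z y) x \<and> (K ^^ m) (\<lambda>z. k z y) x \<le> B" for m x y
    by (induction m arbitrary: x) (auto simp: k0 B symmetric_markov_operator_mono[OF K, of _ B])
  then have p: "0 \<le> ?p x y" "?p x y \<le> B" for x y
    by (auto simp: iterated_kernel_def)
  have K1: "K (\<lambda>_. 1) = (\<lambda>_. 1)"
  proof
    fix x
    have "((\<lambda>y. k x y * 1 * ?\<mu> y) has_sum K (\<lambda>_. 1) x) UNIV"
      using hk unfolding has_kernel_def by (auto simp del: mult_1_right)
    then show "K (\<lambda>_. 1) x = 1" using k1[of x] by (simp add: has_sum_unique)
  qed
  have "(K ^^ m) (\<lambda>_. 1) = (\<lambda>_. 1)" for m by (induction m) (auto simp: K1)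
  then have p1: "((\<lambda>y. ?p x y * ?\<mu> y) has_sum 1) UNIV" for x
    using Suc.IH[unfolded has_kernel_def, rule_format, of "\<lambda>_. 1" x] by simp
  show ?case unfolding has_kernel_def
  proof (intro allI impI)
    fix f :: "'a \<Rightarrow> real" and x
    assume f: "bounded (range f)"
    then obtain A where A: "\<And>y. \<bar>f y\<bar> \<le> A" by (auto simp: bounded_iff)
    have A0: "0 \<le> A" using A[of x] by linarith
    let ?h = "\<lambda>(z, y). k x z * ?\<mu> z * (?p z y * ?\<mu> y)"
    let ?g = "\<lambda>(z, y). k x z * ?\<mu> z * (?p z y * f y * ?\<mu> y)"
    have h: "?h summable_on (UNIV \<times> UNIV)"
    proof (rule summable_on_SigmaI[where g = "\<lambda>z. k x z * ?\<mu> z"])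
      show "((\<lambda>y. ?h (z, y)) has_sum k x z * ?\<mu> z) UNIV" for z
        using has_sum_cmult_right[OF p1, of "k x z * ?\<mu> z" z] by simp
      show "(\<lambda>z. k x z * ?\<mu> z) summable_on UNIV" using k1 by (rule has_sum_imp_summable)
    qed (auto simp: k0 p)
    have "(\<lambda>q. A * ?h q) summable_on (UNIV \<times> UNIV)" by (rule summable_on_cmult_right[OF h])
    then have "(\<lambda>q. norm (?g q)) summable_on (UNIV \<times> UNIV)"
    proof (rule summable_on_comparison_test)
      show "norm (?g q) \<le> A * ?h q" for q
      proof (cases q)
        case (Pair z y)
        have "\<bar>f y\<bar> * (k x z * ?\<mu> z * (?p z y * ?\<mu> y)) \<le> A * (k x z * ?\<mu> z * (?p z y * ?\<mu> y))"
          by (intro mult_right_mono A) (simp add: k0 p)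
        then show ?thesis using Pair k0[of x z] p[of z y] by (simp add: abs_mult mult_ac)
      qed
    qed auto
    then have "?g summable_on (UNIV \<times> UNIV)" by (rule abs_summable_summable)
    then obtain S where S: "(?g has_sum S) (UNIV \<times> UNIV)"
      by (auto simp: summable_on_def)
    have i: "((\<lambda>y. ?g (z, y)) has_sum k x z * (K ^^ n) f z * ?\<mu> z) UNIV" for z
      using has_sum_cmult_right[OF Suc.IH[unfolded has_kernel_def, rule_format, OF f, of z], of "k x z * ?\<mu> z"]
      by (simp add: mult_ac)
    have S1: "((\<lambda>z. k x z * (K ^^ n) f z * ?\<mu> z) has_sum S) UNIV"
      by (rule has_sum_SigmaD[OF S]) (use i in auto)
    have bn: "\<bar>(K ^^ n) f z\<bar> \<le> A" for z
    proof -
      have s: "((\<lambda>y. ?p z y * f y * ?\<mu> y) has_sum (K ^^ n) f z) UNIV"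
        using Suc.IH[unfolded has_kernel_def, rule_format, OF f] .
      have t: "((\<lambda>y. c * (?p z y * ?\<mu> y)) has_sum c) UNIV" for c
        using has_sum_cmult_right[OF p1, of c z] by simp
      have le: "- A * (?p z y * ?\<mu> y) \<le> ?p z y * f y * ?\<mu> y"
           "?p z y * f y * ?\<mu> y \<le> A * (?p z y * ?\<mu> y)" for y
      proof -
        have "0 \<le> ?p z y * ?\<mu> y" "- A \<le> f y" "f y \<le> A" using p A[of y] by auto
        then show "- A * (?p z y * ?\<mu> y) \<le> ?p z y * f y * ?\<mu> y"
           "?p z y * f y * ?\<mu> y \<le> A * (?p z y * ?\<mu> y)"
          using mult_right_mono[of "- A" "f y" "?p z y * ?\<mu> y"]
            mult_right_mono[of "f y" A "?p z y * ?\<mu> y"] by (simp_all add: mult_ac)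
      qed
      show ?thesis
        using has_sum_mono[OF t s le(1)] has_sum_mono[OF s t le(2)] by (simp add: abs_le_iff)
    qed
    have "((\<lambda>z. k x z * (K ^^ n) f z * ?\<mu> z) has_sum (K ^^ Suc n) f x) UNIV"
    proof -
      have "bounded (range ((K ^^ n) f))" using bn by (intro boundedI[of _ A]) auto
      then show ?thesis using hk unfolding has_kernel_def by simp
    qed
    with S1 have S_eq: "S = (K ^^ Suc n) f x" by (rule has_sum_unique)
    have it: "iterated_kernel K k (Suc n) x y = K (\<lambda>z. ?p z y) x" for y
    proof -
      have "n = Suc (n - 1)" using Suc.hyps by simp
      then show ?thesis unfolding iterated_kernel_def
        by (metis (no_types) diff_Suc_1 funpow.simps(2) o_apply)
    qed
    have j: "((\<lambda>z. ?g (z, y)) has_sum iterated_kernel K k (Suc n) x y * f y * ?\<mu> y) UNIV" for y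
    proof -
      have "bounded (range (\<lambda>z. ?p z y))" using p by (intro boundedI[of _ B]) auto
      then have "((\<lambda>z. k x z * ?p z y * ?\<mu> z) has_sum K (\<lambda>z. ?p z y) x) UNIV"
        using hk unfolding has_kernel_def by blast
      from has_sum_cmult_right[OF this, of "f y * ?\<mu> y"] show ?thesis
        by (simp add: it mult_ac)
    qed
    have "((\<lambda>(y, z). ?g (z, y)) has_sum S) (UNIV \<times> UNIV)" using S has_sum_swap by blast
    then show "((\<lambda>y. iterated_kernel K k (Suc n) x y * f y * ?\<mu> y) has_sum (K ^^ Suc n) f x) UNIV"
      unfolding S_eq by (rule has_sum_SigmaD) (use j in simp)
  qed
qed

end

theory Submission
  imports Defs "HOL-Real_Asymp.Real_Asymp"
begin

text \<open>
  Write \<open>\<alpha>\<close> for the volume exponent \<open>d_f\<close>. The on-diagonal upper bound \<open>n powr (-\<alpha>/\<beta>)\<close> holds for every kernel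
  satisfying \<open>J(\<beta>)\<close>, because the lower bound on jumps yields a Nash inequality.
  Everything else reduces to one survival estimate: uniformly in the starting point,
  the walk stays for time \<open>n\<close> in a ball of radius \<open>L n\<^sup>1\<^sup>/\<^sup>\<beta>\<close> with probability close to one.
  Given survival, the off-diagonal upper bound follows by induction on \<open>n\<close> from a decomposition at the first
  exit, and the lower bound from paths that make exactly one long jump.

  To transfer survival from \<open>K\<^sub>1\<close> to \<open>K\<^sub>2\<close>, average \<open>g, K\<^sub>1 g, K\<^sub>1\<^sup>2 g, \<dots>\<close> over \<open>n\<close> steps. The result \<open>\<psi>\<close> satisfies
  \<open>\<bar>\<psi> - K\<^sub>1 \<psi>\<bar> \<le> 2/n\<close>, hence a cutoff Sobolev inequality for \<open>K\<^sub>1\<close>, which is stable under comparison of the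
  kernels and so holds for \<open>K\<^sub>2\<close>; by the tail bound for \<open>K\<^sub>1\<close>, \<open>\<psi>\<close> is still close to \<open>g\<close>.
  With exponential weights built from such functions, discounted exit probabilities of \<open>K\<^sub>2\<close> with
  truncated jumps are exponentially small in \<open>\<ell>\<^sup>2\<close>. The on-diagonal bound turns this into a pointwise
  statement one scale further up, and induction over the scales \<open>M\<^sup>j\<close> gives survival for \<open>K\<^sub>2\<close>.
\<close>

section \<open>Symmetric kernels and double sums\<close>

text \<open>For \<open>\<beta> \<ge> 2\<close> a cutoff that is Lipschitz in the distance at scale
  \<open>r\<close> is in general guaranteed only an energy density of order \<open>r powr -2\<close>
  (with a logarithm at \<open>\<beta> = 2\<close>), not \<open>r powr -\<beta>\<close>, so
  exponential weights in the distance itself, as in Davies' method, are too rough. This is why the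
  first operator has to produce the cutoffs. The averaged functions are bounded and follow their
  model only up to a fixed error of 1/8, whereas a weight decaying through \<open>N\<close> layers
  must grow with \<open>N\<close>. Hence the periodic wave, from whose smoothed version a growing
  function is read off; truncating jumps at \<open>r / 8\<close> keeps this reading consistent along
  each jump. Passing from the l2 estimate to points costs a power of \<open>N\<close>, while the
  weight gains \<open>exp (- (\<kappa> * N))\<close> with \<open>\<kappa>\<close> independent of
  \<open>N\<close>; so the error can be made as small as desired. Exits before time \<open>n\<close>
  are controlled only by the previous scale. Restarting at the exit point squares that probability,
  up to a small error, and so the induction over scales does not accumulate losses.\<close>

lemma summable_on_bound:
  fixes f g :: "'b \<Rightarrow> real"
  assumes "g summable_on A" and "\<And>x. x \<in> A \<Longrightarrow> \<bar>f x\<bar> \<le> g x"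
  shows "f summable_on A"
proof -
  have "(\<lambda>x. norm (f x)) summable_on A"
    by (rule summable_on_comparison_test[OF assms(1)]) (use assms(2) in auto)
  then show ?thesis by (rule abs_summable_summable)
qed

lemma summable_on_abs_real:
  fixes f :: "'b \<Rightarrow> real"
  assumes "f summable_on A"
  shows "(\<lambda>x. \<bar>f x\<bar>) summable_on A"
  using iffD1[OF summable_on_iff_abs_summable_on_real assms] by simp

lemma infsum_diff_real:
  fixes f g :: "'b \<Rightarrow> real"
  assumes "f summable_on A" "g summable_on A"
  shows "(\<lambda>x. f x - g x) summable_on A"
    and "(\<Sum>\<^sub>\<infinity>x\<in>A. f x - g x) = infsum f A - infsum g A"
proof -
  have g: "(\<lambda>x. - g x) summable_on A" using assms(2) by (simp add: summable_on_uminus)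
  show "(\<lambda>x. f x - g x) summable_on A" using summable_on_add[OF assms(1) g] by simp
  show "(\<Sum>\<^sub>\<infinity>x\<in>A. f x - g x) = infsum f A - infsum g A"
    using infsum_add[OF assms(1) g] by (simp add: infsum_uminus)
qed

text \<open>Total mass at most 1 is all that is asked, so that kernels with their long jumps removed
  are covered too; \<open>1 - kop (\<lambda>_. 1) x\<close> is then a killing probability.\<close>

locale symmetric_kernel =
  fixes m :: "'a \<Rightarrow> real" and k :: "'a \<Rightarrow> 'a \<Rightarrow> real"
  assumes m_nonneg: "0 \<le> m x" and k_nonneg: "0 \<le> k x y" and k_sym: "k x y = k y x"
    and k_summable: "(\<lambda>y. k x y * m y) summable_on UNIV"
    and k_mass: "(\<Sum>\<^sub>\<infinity>y. k x y * m y) \<le> 1"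
begin

definition kop :: "('a \<Rightarrow> real) \<Rightarrow> 'a \<Rightarrow> real" where
  "kop f x = (\<Sum>\<^sub>\<infinity>y. f y * (k x y * m y))"

definition dsummable :: "('a \<Rightarrow> 'a \<Rightarrow> real) \<Rightarrow> bool" where
  "dsummable F \<longleftrightarrow> (\<lambda>(x, y). F x y * (k x y * m x * m y)) summable_on UNIV"

text \<open>Integration against the symmetric jump measure; for
  \<open>F x y = (f x - f y)\<^sup>2\<close> it is twice the Dirichlet form of
  \<open>f\<close>.\<close>

definition dsum :: "('a \<Rightarrow> 'a \<Rightarrow> real) \<Rightarrow> real" where
  "dsum F = (\<Sum>\<^sub>\<infinity>(x, y). F x y * (k x y * m x * m y))"

lemma kop_summable:
  assumes "\<And>y. \<bar>f y\<bar> \<le> B"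
  shows "(\<lambda>y. f y * (k x y * m y)) summable_on UNIV"
proof (rule summable_on_bound)
  show "(\<lambda>y. B * (k x y * m y)) summable_on UNIV"
    by (intro summable_on_cmult_right k_summable)
  show "\<bar>f y * (k x y * m y)\<bar> \<le> B * (k x y * m y)" for y
    using mult_right_mono[OF assms, of "k x y * m y" y] by (simp add: abs_mult k_nonneg m_nonneg)
qed

lemma kop_add:
  assumes "\<And>y. \<bar>f y\<bar> \<le> B" "\<And>y. \<bar>g y\<bar> \<le> C"
  shows "kop (\<lambda>y. f y + g y) x = kop f x + kop g x"
  unfolding kop_def distrib_right
  by (intro infsum_add kop_summable[OF assms(1)] kop_summable[OF assms(2)])

lemma kop_cmult: "kop (\<lambda>y. c * f y) x = c * kop f x"
  unfolding kop_def by (simp add: mult.assoc infsum_cmult_right')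

lemma kop_diff:
  assumes "\<And>y. \<bar>f y\<bar> \<le> B" "\<And>y. \<bar>g y\<bar> \<le> C"
  shows "kop (\<lambda>y. f y - g y) x = kop f x - kop g x"
  using kop_add[of f B "\<lambda>y. (-1) * g y" C x] assms kop_cmult[of "-1" g x] by simp

lemma kop_mono:
  assumes "\<And>y. \<bar>f y\<bar> \<le> B" "\<And>y. \<bar>g y\<bar> \<le> C" "\<And>y. f y \<le> g y"
  shows "kop f x \<le> kop g x"
  unfolding kop_def
  by (intro infsum_mono kop_summable[OF assms(1)] kop_summable[OF assms(2)] mult_right_mono assms(3))
     (simp add: k_nonneg m_nonneg)

lemma kop_nonneg: "(\<And>y. 0 \<le> f y) \<Longrightarrow> 0 \<le> kop f x"
  unfolding kop_def by (intro infsum_nonneg) (simp add: k_nonneg m_nonneg)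

lemma kop_const_le: "0 \<le> c \<Longrightarrow> kop (\<lambda>_. c) x \<le> c"
  using mult_left_mono[OF k_mass, of c x] unfolding kop_def by (simp add: infsum_cmult_right')

lemma kop_abs_le:
  assumes "\<And>y. \<bar>f y\<bar> \<le> B"
  shows "\<bar>kop f x\<bar> \<le> B"
proof -
  have B: "0 \<le> B" using assms[of x] by linarith
  have "kop f x \<le> kop (\<lambda>_. B) x" using B assms abs_le_D1 by (intro kop_mono[of f B _ B]) auto
  moreover have "kop (\<lambda>y. - 1 * f y) x \<le> kop (\<lambda>_. B) x"
    using B assms abs_le_D2 by (intro kop_mono[of _ B _ B]) auto
  ultimately show ?thesis
    using kop_const_le[OF B, of x] kop_cmult[of "-1" f x] by simp
qed

lemma kop_le:
  assumes "\<And>y. 0 \<le> f y" "\<And>y. f y \<le> B"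
  shows "kop f x \<le> B"
  using kop_abs_le[of f B x] assms by (simp add: abs_le_iff)

lemma dsummable_left:
  assumes "(\<lambda>x. G x * m x) summable_on UNIV" and G: "\<And>x. 0 \<le> G x"
  shows "dsummable (\<lambda>x y. G x)"
proof -
  have "(\<lambda>(x, y). G x * (k x y * m x * m y)) summable_on (UNIV \<times> UNIV)"
  proof (rule summable_on_SigmaI[where g = "\<lambda>x. G x * m x * (\<Sum>\<^sub>\<infinity>y. k x y * m y)"])
    show "((\<lambda>y. case (x, y) of (x, y) \<Rightarrow> G x * (k x y * m x * m y)) has_sum
        G x * m x * (\<Sum>\<^sub>\<infinity>y. k x y * m y)) UNIV" for x
      using has_sum_cmult_right[OF has_sum_infsum[OF k_summable[of x]], of "G x * m x"]
      by (simp add: mult_ac)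
    show "(\<lambda>x. G x * m x * (\<Sum>\<^sub>\<infinity>y. k x y * m y)) summable_on UNIV"
    proof (rule summable_on_bound[OF assms(1)])
      fix x
      have "0 \<le> (\<Sum>\<^sub>\<infinity>y. k x y * m y)" by (intro infsum_nonneg) (simp add: k_nonneg m_nonneg)
      then show "\<bar>G x * m x * (\<Sum>\<^sub>\<infinity>y. k x y * m y)\<bar> \<le> G x * m x"
        using k_mass[of x] G[of x] m_nonneg[of x] by (simp add: abs_mult mult_left_le)
    qed
  qed (simp add: G k_nonneg m_nonneg)
  then show ?thesis unfolding dsummable_def by simp
qed

lemma dsummable_swap: "dsummable (\<lambda>x y. F y x) \<longleftrightarrow> dsummable F"
  and dsum_swap: "dsum (\<lambda>x y. F y x) = dsum F"
proof -
  have b: "bij_betw prod.swap (UNIV :: ('a \<times> 'a) set) UNIV"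
    by (rule bij_swap)
  have eq: "(\<lambda>(x, y). F y x * (k x y * m x * m y)) =
      (\<lambda>q. (\<lambda>(x, y). F x y * (k x y * m x * m y)) (prod.swap q))"
    by (auto simp: fun_eq_iff k_sym mult_ac)
  show "dsummable (\<lambda>x y. F y x) \<longleftrightarrow> dsummable F"
    unfolding dsummable_def eq by (rule summable_on_reindex_bij_betw[OF b])
  show "dsum (\<lambda>x y. F y x) = dsum F"
    unfolding dsum_def eq by (rule infsum_reindex_bij_betw[OF b])
qed

lemma dsummable_add: "dsummable F \<Longrightarrow> dsummable G \<Longrightarrow> dsummable (\<lambda>x y. F x y + G x y)"
  and dsum_add: "dsummable F \<Longrightarrow> dsummable G \<Longrightarrow> dsum (\<lambda>x y. F x y + G x y) = dsum F + dsum G"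
  unfolding dsummable_def dsum_def case_prod_unfold distrib_right
  by (intro summable_on_add infsum_add; assumption)+

lemma dsummable_cmult: "dsummable F \<Longrightarrow> dsummable (\<lambda>x y. c * F x y)"
  and dsum_cmult: "dsum (\<lambda>x y. c * F x y) = c * dsum F"
  unfolding dsummable_def dsum_def case_prod_unfold mult.assoc
  by (auto intro: summable_on_cmult_right simp: infsum_cmult_right')

lemma dsummable_bound:
  assumes "dsummable G" "\<And>x y. \<bar>F x y\<bar> \<le> G x y"
  shows "dsummable F"
  unfolding dsummable_def
proof (rule summable_on_bound)
  show "(\<lambda>(x, y). G x y * (k x y * m x * m y)) summable_on UNIV"
    using assms(1) unfolding dsummable_def .
  show "\<bar>case q of (x, y) \<Rightarrow> F x y * (k x y * m x * m y)\<bar>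
      \<le> (case q of (x, y) \<Rightarrow> G x y * (k x y * m x * m y))" for q
    using mult_right_mono[OF assms(2)] by (auto simp: abs_mult k_nonneg m_nonneg split: prod.split)
qed

text \<open>Comparing only on the support of the kernel matters for truncated kernels, where it
  restricts the pointwise inequality to pairs at small distance.\<close>

lemma dsum_mono:
  assumes "dsummable F" "dsummable G" "\<And>x y. k x y \<noteq> 0 \<Longrightarrow> F x y \<le> G x y"
  shows "dsum F \<le> dsum G"
proof -
  have "F x y * (k x y * m x * m y) \<le> G x y * (k x y * m x * m y)" for x y
    using assms(3)[of x y] by (cases "k x y = 0") (auto intro!: mult_right_mono simp: k_nonneg m_nonneg)
  then show ?thesis
    using assms(1,2) unfolding dsum_def dsummable_def by (intro infsum_mono) auto
qed

lemma dsummableI: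
  assumes "(\<lambda>x. G x * m x) summable_on UNIV" and F: "\<And>x y. \<bar>F x y\<bar> \<le> G x + G y"
  shows "dsummable F"
proof (rule dsummable_bound[OF _ F])
  have "0 \<le> G x" for x using F[of x x] by linarith
  then have "dsummable (\<lambda>x y. G x)" by (rule dsummable_left[OF assms(1)])
  then show "dsummable (\<lambda>x y. G x + G y)"
    using dsummable_swap[of "\<lambda>x y. G x"] by (intro dsummable_add) auto
qed

lemma dsummable_prod:
  assumes G: "(\<lambda>x. G x * m x) summable_on UNIV" and H: "\<And>y. \<bar>H y\<bar> \<le> B"
  shows "dsummable (\<lambda>x y. G x * H y)"
proof (rule dsummable_bound)
  have "(\<lambda>x. \<bar>G x * m x\<bar>) summable_on UNIV"
    by (rule summable_on_abs_real[OF G])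
  then have "dsummable (\<lambda>x y. \<bar>G x\<bar>)" by (intro dsummable_left) (auto simp: abs_mult m_nonneg)
  then show "dsummable (\<lambda>x y. B * \<bar>G x\<bar>)" by (rule dsummable_cmult)
  show "\<bar>G x * H y\<bar> \<le> B * \<bar>G x\<bar>" for x y
    using mult_left_mono[OF H[of y], of "\<bar>G x\<bar>"] by (simp add: abs_mult mult.commute)
qed

lemma dsum_prod:
  assumes G: "(\<lambda>x. G x * m x) summable_on UNIV" and H: "\<And>y. \<bar>H y\<bar> \<le> B"
  shows "dsum (\<lambda>x y. G x * H y) = (\<Sum>\<^sub>\<infinity>x. G x * kop H x * m x)"
proof -
  have "dsum (\<lambda>x y. G x * H y) = (\<Sum>\<^sub>\<infinity>x. \<Sum>\<^sub>\<infinity>y. G x * H y * (k x y * m x * m y))"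
    using dsummable_prod[OF assms] unfolding dsum_def dsummable_def
    by (subst infsum_Sigma'_banach) auto
  also have "\<dots> = (\<Sum>\<^sub>\<infinity>x. G x * kop H x * m x)"
  proof (rule infsum_cong)
    fix x
    have "(\<Sum>\<^sub>\<infinity>y. G x * H y * (k x y * m x * m y)) = (\<Sum>\<^sub>\<infinity>y. (G x * m x) * (H y * (k x y * m y)))"
      by (simp only: mult_ac)
    also have "\<dots> = (G x * m x) * kop H x"
      unfolding kop_def by (rule infsum_cmult_right')
    finally show "(\<Sum>\<^sub>\<infinity>y. G x * H y * (k x y * m x * m y)) = G x * kop H x * m x"
      by (simp only: mult_ac)
  qed
  finally show ?thesis .
qed

text \<open>Green's formula: the product expands into \<open>G x * H x - G x * H y\<close> plus its
  transpose, and both have the same double sum by symmetry of \<open>k\<close>. The factor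
  \<open>kop (\<lambda>_. 1) x\<close> stands for 1 because mass may be lost.\<close>

lemma dsum_by_parts:
  assumes G: "(\<lambda>x. G x * m x) summable_on UNIV" and H: "\<And>y. \<bar>H y\<bar> \<le> B"
  shows "dsummable (\<lambda>x y. (H x - H y) * (G x - G y))"
    and "dsum (\<lambda>x y. (H x - H y) * (G x - G y))
      = 2 * (\<Sum>\<^sub>\<infinity>x. G x * (kop (\<lambda>_. 1) x * H x - kop H x) * m x)"
proof -
  have GH: "(\<lambda>x. G x * H x * m x) summable_on UNIV"
  proof (rule summable_on_bound)
    show "(\<lambda>x. B * \<bar>G x * m x\<bar>) summable_on UNIV"
      by (intro summable_on_cmult_right summable_on_abs_real G)
    show "\<bar>G x * H x * m x\<bar> \<le> B * \<bar>G x * m x\<bar>" for x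
      using mult_left_mono[OF H[of x], of "\<bar>G x * m x\<bar>"] by (simp add: abs_mult mult_ac)
  qed
  have a: "dsummable (\<lambda>x y. G x * H y)" "dsum (\<lambda>x y. G x * H y) = (\<Sum>\<^sub>\<infinity>x. G x * kop H x * m x)"
    by (rule dsummable_prod[OF G H] dsum_prod[OF G H])+
  have b: "dsummable (\<lambda>x y. (G x * H x) * 1)"
      "dsum (\<lambda>x y. (G x * H x) * 1) = (\<Sum>\<^sub>\<infinity>x. (G x * H x) * kop (\<lambda>_. 1) x * m x)"
    by (rule dsummable_prod[OF GH, of "\<lambda>_. 1" 1] dsum_prod[OF GH, of "\<lambda>_. 1" 1]; simp)+
  let ?F = "\<lambda>x y. (G x * H x) * 1 + (-1) * (G x * H y)"
  have F: "dsummable ?F" by (intro dsummable_add dsummable_cmult a b)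
  then have F': "dsummable (\<lambda>x y. ?F y x)" using dsummable_swap[of ?F] by simp
  have eq: "(\<lambda>x y. (H x - H y) * (G x - G y)) = (\<lambda>x y. ?F x y + ?F y x)"
    by (auto simp: fun_eq_iff algebra_simps)
  show "dsummable (\<lambda>x y. (H x - H y) * (G x - G y))"
    unfolding eq by (rule dsummable_add[OF F F'])
  have s1: "(\<lambda>x. (G x * H x) * kop (\<lambda>_. 1) x * m x) summable_on UNIV"
  proof (rule summable_on_bound)
    show "(\<lambda>x. \<bar>G x * H x * m x\<bar>) summable_on UNIV"
      by (rule summable_on_abs_real[OF GH])
    show "\<bar>(G x * H x) * kop (\<lambda>_. 1) x * m x\<bar> \<le> \<bar>G x * H x * m x\<bar>" for x
      using mult_left_mono[OF kop_abs_le[of "\<lambda>_. 1" 1 x], of "\<bar>G x * H x * m x\<bar>"]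
      by (simp add: abs_mult mult_ac)
  qed
  have s2: "(\<lambda>x. G x * kop H x * m x) summable_on UNIV"
  proof (rule summable_on_bound)
    show "(\<lambda>x. B * \<bar>G x * m x\<bar>) summable_on UNIV"
      by (intro summable_on_cmult_right summable_on_abs_real G)
    show "\<bar>G x * kop H x * m x\<bar> \<le> B * \<bar>G x * m x\<bar>" for x
      using mult_left_mono[OF kop_abs_le[where x=x, OF H], of "\<bar>G x * m x\<bar>"] by (simp add: abs_mult mult_ac)
  qed
  have "dsum (\<lambda>x y. (H x - H y) * (G x - G y)) = dsum ?F + dsum (\<lambda>x y. ?F y x)"
    unfolding eq by (rule dsum_add[OF F F'])
  also have "\<dots> = 2 * dsum ?F" using dsum_swap[of ?F] by simp
  also have "dsum ?F = dsum (\<lambda>x y. (G x * H x) * 1) + dsum (\<lambda>x y. (-1) * (G x * H y))"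
    by (intro dsum_add dsummable_cmult a b)
  also have "\<dots> = (\<Sum>\<^sub>\<infinity>x. (G x * H x) * kop (\<lambda>_. 1) x * m x) - (\<Sum>\<^sub>\<infinity>x. G x * kop H x * m x)"
    using a b dsum_cmult[of "-1"] by simp
  also have "\<dots> = (\<Sum>\<^sub>\<infinity>x. (G x * H x) * kop (\<lambda>_. 1) x * m x - G x * kop H x * m x)"
    using infsum_diff_real[OF s1 s2] by simp
  finally show "dsum (\<lambda>x y. (H x - H y) * (G x - G y))
      = 2 * (\<Sum>\<^sub>\<infinity>x. G x * (kop (\<lambda>_. 1) x * H x - kop H x) * m x)"
    by (simp add: algebra_simps)
qed

end

section \<open>Iterated Markov kernels\<close>

locale markov_kernel = symmetric_kernel +
  fixes kB :: real
  assumes k_mass1: "(\<Sum>\<^sub>\<infinity>y. k x y * m y) = 1" and k_le: "k x y \<le> kB"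
begin

abbreviation p :: "nat \<Rightarrow> 'a \<Rightarrow> 'a \<Rightarrow> real" where
  "p \<equiv> iterated_kernel kop k"

lemma kop_const: "kop (\<lambda>_. c) x = c"
  unfolding kop_def by (simp add: infsum_cmult_right' k_mass1)

lemma p_1: "p 1 x y = k x y" "p (Suc 0) x y = k x y"
  by (simp_all add: iterated_kernel_def)

lemma p_Suc: "1 \<le> n \<Longrightarrow> p (Suc n) x y = kop (\<lambda>z. p n z y) x"
  by (cases n) (auto simp: iterated_kernel_def)

lemma p_nonneg: "0 \<le> p n x y" and p_le: "p n x y \<le> kB"
proof -
  have "0 \<le> (kop ^^ j) (\<lambda>z. k z y) x \<and> (kop ^^ j) (\<lambda>z. k z y) x \<le> kB" for j x
  proof (induction j arbitrary: x)
    case (Suc j)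
    then show ?case using kop_nonneg[of "(kop ^^ j) (\<lambda>z. k z y)" x] kop_le[of "(kop ^^ j) (\<lambda>z. k z y)" kB x]
      by simp
  qed (simp add: k_nonneg k_le)
  then show "0 \<le> p n x y" "p n x y \<le> kB" by (auto simp: iterated_kernel_def)
qed

lemma abs_p_le: "\<bar>p n x y\<bar> \<le> kB"
  using p_nonneg[of n x y] p_le[of n x y] by linarith

lemma has_kernel_p:
  assumes "1 \<le> n" and f: "\<And>y. \<bar>f y\<bar> \<le> B"
  shows "((\<lambda>y. f y * (p n x y * m y)) has_sum (kop ^^ n) f x) UNIV"
proof -
  \<comment> \<open>\<open>has_kernel_iterated_kernel\<close> speaks of a measure; the point measure
    with density \<open>m\<close> makes it available for bare weights.\<close>
  define M where "M = point_measure UNIV (\<lambda>x. ennreal (m x))"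
  have M: "measure M {x} = m x" for x
    unfolding M_def measure_def by (subst emeasure_point_measure_finite2) (auto simp: m_nonneg)
  have "symmetric_markov_operator M kop k"
    unfolding symmetric_markov_operator_def has_kernel_def M
  proof (intro conjI allI impI)
    show "((\<lambda>y. k x y * m y) has_sum 1) UNIV" for x
      using has_sum_infsum[OF k_summable[of x]] by (simp add: k_mass1)
    fix f :: "'a \<Rightarrow> real" and x
    assume "bounded (range f)"
    then obtain A where A: "\<And>y. \<bar>f y\<bar> \<le> A" by (auto simp: bounded_iff)
    from has_sum_infsum[OF kop_summable[of f A x, OF A]]
    show "((\<lambda>y. k x y * f y * m y) has_sum kop f x) UNIV"
      unfolding kop_def by (simp add: mult_ac)
  qed (auto simp: k_nonneg k_sym)
  from has_kernel_iterated_kernel[OF this k_le assms(1)]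
  have "((\<lambda>y. p n x y * f y * m y) has_sum (kop ^^ n) f x) UNIV"
    using f unfolding has_kernel_def M by (auto simp: bounded_iff)
  then show ?thesis by (simp only: mult_ac)
qed

lemma funpow_kop:
  assumes "1 \<le> n" and f: "\<And>y. \<bar>f y\<bar> \<le> B"
  shows "(kop ^^ n) f x = (\<Sum>\<^sub>\<infinity>y. f y * (p n x y * m y))"
  by (rule infsumI[symmetric], rule has_kernel_p[OF assms])

lemma funpow_kop_const: "(kop ^^ n) (\<lambda>_. c) x = c"
proof -
  have "(kop ^^ n) (\<lambda>_. c) = (\<lambda>_. c)" by (induction n) (auto simp: kop_const intro: ext)
  then show ?thesis by simp
qed

lemma p_summable: "1 \<le> n \<Longrightarrow> (\<lambda>y. p n x y * m y) summable_on UNIV"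
  and p_mass: "1 \<le> n \<Longrightarrow> (\<Sum>\<^sub>\<infinity>y. p n x y * m y) = 1"
proof -
  assume "1 \<le> n"
  then have "((\<lambda>y. 1 * (p n x y * m y)) has_sum (kop ^^ n) (\<lambda>_. 1) x) UNIV"
    by (intro has_kernel_p[where B = 1]) auto
  then have "((\<lambda>y. p n x y * m y) has_sum 1) UNIV"
    unfolding funpow_kop_const by simp
  then show "(\<lambda>y. p n x y * m y) summable_on UNIV" "(\<Sum>\<^sub>\<infinity>y. p n x y * m y) = 1"
    by (rule has_sum_imp_summable, rule infsumI)
qed

lemma p_chapman_kolmogorov:
  assumes "1 \<le> n" "1 \<le> l"
  shows "p (n + l) x y = (\<Sum>\<^sub>\<infinity>z. p l z y * (p n x z * m z))"
proof -
  have "p (n + l) x y = (kop ^^ n) (\<lambda>z. p l z y) x"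
  proof -
    have "n + l - 1 = n + (l - 1)" using assms by simp
    then show ?thesis unfolding iterated_kernel_def by (simp only: funpow_add o_apply)
  qed
  also have "\<dots> = (\<Sum>\<^sub>\<infinity>z. p l z y * (p n x z * m z))"
    by (rule funpow_kop[OF assms(1) abs_p_le])
  finally show ?thesis .
qed

lemma p_sym: "1 \<le> n \<Longrightarrow> p n x y = p n y x"
proof (induction n arbitrary: x y rule: nat_induct_at_least)
  case base
  then show ?case by (simp add: p_1 k_sym)
next
  case (Suc n)
  have "p (Suc n) x y = (\<Sum>\<^sub>\<infinity>z. p 1 z y * (p n x z * m z))"
    using p_chapman_kolmogorov[OF Suc.hyps, of 1 x y] by simp
  also have "\<dots> = (\<Sum>\<^sub>\<infinity>z. p n z x * (p 1 y z * m z))"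
  proof (rule infsum_cong)
    fix z
    show "p 1 z y * (p n x z * m z) = p n z x * (p 1 y z * m z)"
      using Suc.IH[of x z] k_sym[of z y] by (simp add: p_1)
  qed
  also have "\<dots> = p (Suc n) y x"
    using p_chapman_kolmogorov[of 1 n y x] Suc.hyps by simp
  finally show ?case .
qed

lemma markov_kernel_p: "1 \<le> n \<Longrightarrow> markov_kernel m (p n) kB"
proof unfold_locales
  assume n: "1 \<le> n"
  fix x y
  show "0 \<le> m x" by (rule m_nonneg)
  show "0 \<le> p n x y" by (rule p_nonneg)
  show "p n x y = p n y x" by (rule p_sym[OF n])
  show "(\<lambda>y. p n x y * m y) summable_on UNIV" by (rule p_summable[OF n])
  show "(\<Sum>\<^sub>\<infinity>y. p n x y * m y) \<le> 1" by (rule eq_refl[OF p_mass[OF n]])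
  show "(\<Sum>\<^sub>\<infinity>y. p n x y * m y) = 1" by (rule p_mass[OF n])
  show "p n x y \<le> kB" by (rule p_le)
qed

lemma funpow_kop_eq:
  assumes "1 \<le> n" and f: "\<And>y. \<bar>f y\<bar> \<le> B"
  shows "(kop ^^ n) f x = symmetric_kernel.kop m (p n) f x"
proof -
  interpret pn: markov_kernel m "p n" kB by (rule markov_kernel_p[OF assms(1)])
  show ?thesis unfolding pn.kop_def by (rule funpow_kop[OF assms])
qed

lemma abs_funpow_kop_le:
  assumes "\<And>y. \<bar>f y\<bar> \<le> B"
  shows "\<bar>(kop ^^ n) f x\<bar> \<le> B"
proof (induction n arbitrary: x)
  case 0
  show ?case using assms by simp
next
  case (Suc n)
  show ?case using kop_abs_le[of "(kop ^^ n) f" B x, OF Suc.IH] by simp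
qed

lemma funpow_kop_nonneg:
  assumes "\<And>y. 0 \<le> f y"
  shows "0 \<le> (kop ^^ n) f x"
proof (induction n arbitrary: x)
  case 0
  show ?case using assms by simp
next
  case (Suc n)
  show ?case using kop_nonneg[of "(kop ^^ n) f" x, OF Suc.IH] by simp
qed

end

section \<open>Volume growth\<close>

text \<open>With \<open>\<nu> = \<beta>/\<alpha>\<close>, optimising over \<open>s\<close> gives \<open>a\<^sub>n - a\<^sub>n\<^sub>+\<^sub>1 \<ge> c a\<^sub>n powr (1 + \<nu>)\<close>,
  so \<open>a\<^sub>n powr (-\<nu>)\<close> grows at least linearly.\<close>
lemma nash_decay:
  fixes \<alpha> \<beta> C1 C2 A :: real
  assumes pos: "\<alpha> > 0" "\<beta> > 0" "C1 > 0" "C2 > 0" "A > 0"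
  obtains C where "C > 0" and
    "\<And>a n. (\<And>n. 1 \<le> n \<Longrightarrow> 0 \<le> a n \<and> a n \<le> A) \<Longrightarrow>
      (\<And>n s. 1 \<le> n \<Longrightarrow> 1 \<le> s \<Longrightarrow>
         s powr \<alpha> * a n \<le> C1 * s powr (\<alpha> + \<beta>) * (a n - a (Suc n)) + C2) \<Longrightarrow>
      1 \<le> n \<Longrightarrow> a n \<le> C * real n powr (- (\<alpha> / \<beta>))"
proof
  define \<nu> where "\<nu> = \<beta> / \<alpha>"
  \<comment> \<open>\<open>D \<ge> C2\<close> lets the additive constant be absorbed;
    \<open>D \<ge> A\<close> gives \<open>2 * D / a n \<ge> 1\<close>, so that the optimal
    \<open>s\<close> below is at least 1.\<close>
  define D where "D = max C2 A"
  define c where "c = (D / C1) * (1 / (2 * D)) powr (1 + \<nu>)"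
  \<comment> \<open>The first entry is the increment of \<open>a n powr (- \<nu>)\<close> per step,
    the second its lower bound at \<open>n = 1\<close>.\<close>
  define c' where "c' = min (\<nu> * c) (A powr (- \<nu>))"
  have D: "D > 0" "C2 \<le> D" "A \<le> D" using pos by (auto simp: D_def)
  have \<nu>: "\<nu> > 0" using pos by (simp add: \<nu>_def)
  have c: "c > 0" using D pos by (simp add: c_def)
  have c': "c' > 0" using \<nu> c pos by (simp add: c'_def)
  show "c' powr (- (\<alpha> / \<beta>)) > 0" using c' by simp
  fix a :: "nat \<Rightarrow> real" and n :: nat
  assume a: "\<And>n. 1 \<le> n \<Longrightarrow> 0 \<le> a n \<and> a n \<le> A"
    and step: "\<And>n s. 1 \<le> n \<Longrightarrow> 1 \<le> s \<Longrightarrow>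
         s powr \<alpha> * a n \<le> C1 * s powr (\<alpha> + \<beta>) * (a n - a (Suc n)) + C2"
    and n: "1 \<le> n"
  have drop: "c * a n powr (1 + \<nu>) \<le> a n - a (Suc n)" if n: "1 \<le> n" and an: "a n > 0" for n
  proof -
    \<comment> \<open>This choice makes the left side of the hypothesis equal to
      \<open>2 * D\<close>, twice what the constant \<open>C2\<close> can account for.\<close>
    define s where "s = (2 * D / a n) powr (1 / \<alpha>)"
    have "2 * D / a n \<ge> 1" using an a[OF n] D by (simp add: field_simps)
    then have s1: "s \<ge> 1" using pos unfolding s_def by (intro ge_one_powr_ge_zero) auto
    have s\<alpha>: "s powr \<alpha> = 2 * D / a n"
      using pos an D by (simp add: s_def powr_powr)
    have s\<gamma>: "s powr (\<alpha> + \<beta>) = (2 * D / a n) powr (1 + \<nu>)"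
      using pos by (simp add: s_def powr_powr \<nu>_def field_simps)
    have "2 * D \<le> C1 * s powr (\<alpha> + \<beta>) * (a n - a (Suc n)) + C2"
      using step[OF n s1] an by (simp add: s\<alpha>)
    then have "D \<le> C1 * (2 * D / a n) powr (1 + \<nu>) * (a n - a (Suc n))"
      using D by (simp add: s\<gamma>)
    define X where "X = (1 / (2 * D)) powr (1 + \<nu>) * a n powr (1 + \<nu>)"
    have X1: "(2 * D / a n) powr (1 + \<nu>) = 1 / X"
      unfolding X_def using an D by (simp add: powr_divide)
    have X: "X > 0" using an D by (simp add: X_def)
    have "D \<le> C1 * (a n - a (Suc n)) / X"
      using \<open>D \<le> C1 * (2 * D / a n) powr (1 + \<nu>) * (a n - a (Suc n))\<close> unfolding X1 by simp
    then have "D * X \<le> C1 * (a n - a (Suc n))" using X by (simp only: pos_le_divide_eq)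
    moreover have "C1 * (c * a n powr (1 + \<nu>)) = D * X" using pos by (simp add: c_def X_def)
    ultimately show ?thesis using mult_le_cancel_left_pos[OF pos(3)] by metis
  qed
  have grow: "a n > 0 \<Longrightarrow> c' * real n \<le> a n powr (- \<nu>)" if "1 \<le> n" for n
    using that
  proof (induction n rule: nat_induct_at_least)
    case base
    have "A powr (- \<nu>) \<le> a 1 powr (- \<nu>)"
      using a[of 1] base \<nu> by (intro powr_mono2') auto
    then show ?case by (simp add: c'_def)
  next
    case (Suc n)
    \<comment> \<open>If \<open>a n\<close> were 0 with \<open>a (Suc n)\<close> positive, the
      hypothesis would bound \<open>s powr (\<alpha> + \<beta>) * a (Suc n)\<close> uniformly in
      \<open>s\<close>, which fails for large \<open>s\<close>.\<close>
    have an: "a n > 0"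
    proof (rule ccontr)
      assume "\<not> 0 < a n"
      then have "a n = 0" using a[OF Suc.hyps] by linarith
      then have st: "0 \<le> C1 * s powr (\<alpha> + \<beta>) * (0 - a (Suc n)) + C2" if "1 \<le> s" for s
        using step[OF Suc.hyps that] by simp
      define s where "s = (max 1 (2 * C2 / (C1 * a (Suc n)))) powr (1 / (\<alpha> + \<beta>))"
      have "s \<ge> 1" using pos unfolding s_def by (intro ge_one_powr_ge_zero) auto
      moreover have "s powr (\<alpha> + \<beta>) = max 1 (2 * C2 / (C1 * a (Suc n)))"
        using pos by (simp add: s_def powr_powr)
      ultimately have "C1 * max 1 (2 * C2 / (C1 * a (Suc n))) * a (Suc n) \<le> C2"
        using st[of s] by simp
      moreover have "C1 * (2 * C2 / (C1 * a (Suc n))) * a (Suc n) \<le> C1 * max 1 (2 * C2 / (C1 * a (Suc n))) * a (Suc n)"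
        using pos Suc.prems by (intro mult_right_mono mult_left_mono) auto
      ultimately show False using pos Suc.prems by (simp add: field_simps)
    qed
    have "a (Suc n) \<le> a n * (1 - c * a n powr \<nu>)"
      using drop[OF Suc.hyps an] an by (simp add: powr_add algebra_simps)
    also have "\<dots> \<le> a n * exp (- c * a n powr \<nu>)"
      using an exp_ge_add_one_self[of "- c * a n powr \<nu>"] by (intro mult_left_mono) auto
    finally have "(a n * exp (- c * a n powr \<nu>)) powr (- \<nu>) \<le> a (Suc n) powr (- \<nu>)"
      using Suc.prems \<nu> by (intro powr_mono2') auto
    moreover have "(a n * exp (- c * a n powr \<nu>)) powr (- \<nu>) = a n powr (- \<nu>) * exp (\<nu> * c * a n powr \<nu>)"
      using an by (simp add: powr_mult exp_powr_real mult_ac)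
    moreover have "a n powr (- \<nu>) * (1 + \<nu> * c * a n powr \<nu>) \<le> a n powr (- \<nu>) * exp (\<nu> * c * a n powr \<nu>)"
      using exp_ge_add_one_self[of "\<nu> * c * a n powr \<nu>"] by (intro mult_left_mono) auto
    moreover have "a n powr (- \<nu>) * (1 + \<nu> * c * a n powr \<nu>) = a n powr (- \<nu>) + \<nu> * c"
      using an by (simp add: algebra_simps powr_minus)
    ultimately have "a n powr (- \<nu>) + \<nu> * c \<le> a (Suc n) powr (- \<nu>)" by linarith
    moreover have "c' \<le> \<nu> * c" by (simp add: c'_def)
    ultimately show ?case using Suc.IH[OF an] by (simp add: algebra_simps)
  qed
  show "a n \<le> c' powr (- (\<alpha> / \<beta>)) * real n powr (- (\<alpha> / \<beta>))"
  proof (cases "a n > 0")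
    case True
    have "(a n powr (- \<nu>)) powr (- (\<alpha> / \<beta>)) \<le> (c' * real n) powr (- (\<alpha> / \<beta>))"
      using grow[OF n True] c' n pos by (intro powr_mono2') auto
    moreover have "(a n powr (- \<nu>)) powr (- (\<alpha> / \<beta>)) = a n"
      using True pos by (simp add: powr_powr \<nu>_def)
    ultimately show ?thesis using c' by (simp add: powr_mult)
  next
    case False
    then have "a n \<le> 0" by simp
    also have "0 \<le> c' powr (- (\<alpha> / \<beta>)) * real n powr (- (\<alpha> / \<beta>))" by simp
    finally show ?thesis .
  qed
qed

lemma (in symmetric_kernel) dsum_fubini:
  assumes "dsummable F"
  shows "(\<lambda>y. F x y * (k x y * m x * m y)) summable_on UNIV"
    and "(\<lambda>x. \<Sum>\<^sub>\<infinity>y. F x y * (k x y * m x * m y)) summable_on UNIV"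
    and "dsum F = (\<Sum>\<^sub>\<infinity>x. \<Sum>\<^sub>\<infinity>y. F x y * (k x y * m x * m y))"
proof -
  have s: "(\<lambda>(x, y). F x y * (k x y * m x * m y)) summable_on Sigma UNIV (\<lambda>_. UNIV)"
    using assms unfolding dsummable_def by simp
  show "(\<lambda>y. F x y * (k x y * m x * m y)) summable_on UNIV"
    using summable_on_SigmaD1[OF s, of x] by simp
  show "(\<lambda>x. \<Sum>\<^sub>\<infinity>y. F x y * (k x y * m x * m y)) summable_on UNIV"
    using summable_on_Sigma_banach[OF s] by simp
  show "dsum F = (\<Sum>\<^sub>\<infinity>x. \<Sum>\<^sub>\<infinity>y. F x y * (k x y * m x * m y))"
    unfolding dsum_def using infsum_Sigma'_banach[OF s] by simp
qed

section \<open>Ahlfors regular volume: mass of jump tails and of annuli\<close>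

locale ahlfors =
  fixes d :: "'a \<Rightarrow> 'a \<Rightarrow> nat" and m :: "'a \<Rightarrow> real" and \<alpha> CV :: real
  assumes d_refl: "d x x = 0" and d_commute: "d x y = d y x"
    and d_triangle: "d x z \<le> d x y + d y z"
    and finite_d: "finite {y. d x y \<le> n}"
    and m_ge_0: "0 \<le> m x" and \<alpha>_pos: "\<alpha> > 0" and CV_pos: "CV > 0"
    and vol_lower: "1 \<le> r \<Longrightarrow> r powr \<alpha> / CV \<le> (\<Sum>y | real (d x y) \<le> r. m y)"
    and vol_upper: "1 \<le> r \<Longrightarrow> (\<Sum>y | real (d x y) \<le> r. m y) \<le> CV * r powr \<alpha>"
begin

definition cb :: "'a \<Rightarrow> real \<Rightarrow> 'a set" where
  "cb x r = {y. real (d x y) \<le> r}"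

lemma in_cb: "y \<in> cb x r \<longleftrightarrow> real (d x y) \<le> r"
  by (simp add: cb_def)

lemma finite_cb: "finite (cb x r)"
proof (rule finite_subset)
  show "cb x r \<subseteq> {y. d x y \<le> nat \<lfloor>r\<rfloor>}" by (auto simp: cb_def le_nat_floor)
qed (rule finite_d)

lemma d_triangle_real: "real (d x z) \<le> real (d x y) + real (d y z)"
  using d_triangle[of x z y] by linarith

text \<open>Summation over dyadic shells. A shell starting at radius \<open>t\<close> contributes at
  most a constant times \<open>t powr - \<beta>\<close>, which is a multiple of
  \<open>t powr - \<beta> - (2 * t) powr - \<beta>\<close>; in this form the shells telescope, which
  is why the bound is a difference.\<close>

lemma tail_shells:
  assumes "\<beta> > 0" "1 \<le> s" "finite F" "\<And>y. y \<in> F \<Longrightarrow> s < real (d x y) \<and> real (d x y) \<le> 2 ^ J * s"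
  shows "(\<Sum>y\<in>F. real (d x y) powr - (\<alpha> + \<beta>) * m y)
    \<le> CV * 2 powr \<alpha> / (1 - 2 powr - \<beta>) * (s powr - \<beta> - (2 ^ J * s) powr - \<beta>)"
  using assms(3,4)
proof (induction J arbitrary: F)
  case 0
  then have "F = {}" by force
  then show ?case by simp
next
  case (Suc J)
  let ?K = "CV * 2 powr \<alpha> / (1 - 2 powr - \<beta>)" and ?t = "2 ^ J * s"
  let ?F1 = "{y \<in> F. real (d x y) \<le> ?t}" and ?F2 = "{y \<in> F. \<not> real (d x y) \<le> ?t}"
  have t: "1 \<le> ?t" using mult_mono[of 1 "2 ^ J" 1 s] assms(2) by simp
  have b: "2 powr - \<beta> < 1" using assms(1) powr_less_mono[of "- \<beta>" 0 2] by simp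
  have "(\<Sum>y\<in>?F2. real (d x y) powr - (\<alpha> + \<beta>) * m y) \<le> (\<Sum>y\<in>?F2. ?t powr - (\<alpha> + \<beta>) * m y)"
    using t assms(1) \<alpha>_pos m_ge_0 by (intro sum_mono mult_right_mono powr_mono2') auto
  also have "\<dots> = ?t powr - (\<alpha> + \<beta>) * (\<Sum>y\<in>?F2. m y)" by (simp add: sum_distrib_left)
  also have "\<dots> \<le> ?t powr - (\<alpha> + \<beta>) * (\<Sum>y | real (d x y) \<le> 2 * ?t. m y)"
    using Suc.prems(2) finite_cb[of x "2 * ?t"] m_ge_0
    by (intro mult_left_mono sum_mono2) (auto simp: cb_def mult.assoc)
  also have "\<dots> \<le> ?t powr - (\<alpha> + \<beta>) * (CV * (2 * ?t) powr \<alpha>)"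
    using t by (intro mult_left_mono vol_upper) auto
  also have "\<dots> = CV * 2 powr \<alpha> * (?t powr - (\<alpha> + \<beta>) * ?t powr \<alpha>)"
    using t by (simp add: powr_mult)
  also have "?t powr - (\<alpha> + \<beta>) * ?t powr \<alpha> = ?t powr - \<beta>"
    by (simp flip: powr_add)
  also have "CV * 2 powr \<alpha> * ?t powr - \<beta> = ?K * (?t powr - \<beta> - (2 powr - \<beta>) * ?t powr - \<beta>)"
  proof -
    have "1 - 2 powr - \<beta> \<noteq> 0" using b by linarith
    moreover have "?t powr - \<beta> - (2 powr - \<beta>) * ?t powr - \<beta> = (1 - 2 powr - \<beta>) * ?t powr - \<beta>"
      by (simp add: algebra_simps)
    ultimately show ?thesis by simp
  qed
  also have "(2 powr - \<beta>) * ?t powr - \<beta> = (2 ^ Suc J * s) powr - \<beta>"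
    using t by (simp flip: powr_mult add: mult.assoc)
  finally have 2: "(\<Sum>y\<in>?F2. real (d x y) powr - (\<alpha> + \<beta>) * m y) \<le> ?K * (?t powr - \<beta> - (2 ^ Suc J * s) powr - \<beta>)" .
  have 1: "(\<Sum>y\<in>?F1. real (d x y) powr - (\<alpha> + \<beta>) * m y) \<le> ?K * (s powr - \<beta> - ?t powr - \<beta>)"
    using Suc.prems by (intro Suc.IH) auto
  have "(\<Sum>y\<in>F. real (d x y) powr - (\<alpha> + \<beta>) * m y)
     = (\<Sum>y\<in>?F1. real (d x y) powr - (\<alpha> + \<beta>) * m y) + (\<Sum>y\<in>?F2. real (d x y) powr - (\<alpha> + \<beta>) * m y)"
    using Suc.prems(1) by (subst sum.union_disjoint[symmetric]) (auto intro!: sum.cong)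
  also have "\<dots> \<le> ?K * (s powr - \<beta> - ?t powr - \<beta>) + ?K * (?t powr - \<beta> - (2 ^ Suc J * s) powr - \<beta>)"
    by (rule add_mono[OF 1 2])
  also have "\<dots> = ?K * (s powr - \<beta> - (2 ^ Suc J * s) powr - \<beta>)"
    by (simp only: right_diff_distrib)
  finally show ?case .
qed

lemma tail_finite:
  assumes "\<beta> > 0" "1 \<le> s" "finite F" "\<And>y. y \<in> F \<Longrightarrow> s < real (d x y)"
  shows "(\<Sum>y\<in>F. real (d x y) powr - (\<alpha> + \<beta>) * m y)
    \<le> CV * 2 powr \<alpha> / (1 - 2 powr - \<beta>) * s powr - \<beta>"
proof -
  define D where "D = Max (insert 0 (d x ` F))"
  have D: "y \<in> F \<Longrightarrow> d x y \<le> D" for y using assms(3) by (auto simp: D_def)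
  obtain J where J: "real D < 2 ^ J" using real_arch_pow[of 2 "real D"] by auto
  have b: "2 powr - \<beta> < 1" using assms(1) powr_less_mono[of "- \<beta>" 0 2] by simp
  have "real (d x y) \<le> 2 ^ J * s" if "y \<in> F" for y
  proof -
    have "real (d x y) \<le> 2 ^ J" using D[OF that] J by linarith
    also have "\<dots> \<le> 2 ^ J * s" using mult_left_mono[OF assms(2), of "2 ^ J"] by simp
    finally show ?thesis .
  qed
  then have "(\<Sum>y\<in>F. real (d x y) powr - (\<alpha> + \<beta>) * m y)
      \<le> CV * 2 powr \<alpha> / (1 - 2 powr - \<beta>) * (s powr - \<beta> - (2 ^ J * s) powr - \<beta>)"
    using assms by (intro tail_shells) auto
  also have "\<dots> \<le> CV * 2 powr \<alpha> / (1 - 2 powr - \<beta>) * s powr - \<beta>"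
    using b CV_pos by (intro mult_left_mono) auto
  finally show ?thesis .
qed

text \<open>The lower volume bound at \<open>A * r\<close> beats the upper one at \<open>r\<close>
  once \<open>A powr \<alpha> / CV \<ge> CV + 2\<close>. The annulus later supplies intermediate
  points for the lower bound near the diagonal.\<close>

lemma annulus:
  obtains A where "A > 1" "\<And>x r. 1 \<le> r \<Longrightarrow> r powr \<alpha> \<le> (\<Sum>y\<in>cb x (A * r) - cb x r. m y)"
proof
  define A where "A = (CV * (CV + 2)) powr (1 / \<alpha>) + 1"
  show A1: "A > 1" using CV_pos by (simp add: A_def)
  fix x r assume r: "1 \<le> (r :: real)"
  have "CV * (CV + 2) = ((CV * (CV + 2)) powr (1 / \<alpha>)) powr \<alpha>"
    using \<alpha>_pos CV_pos by (simp add: powr_powr)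
  also have "\<dots> \<le> A powr \<alpha>" using \<alpha>_pos by (intro powr_mono2) (auto simp: A_def)
  finally have A: "CV + 2 \<le> A powr \<alpha> / CV" using CV_pos by (simp add: field_simps)
  have Ar: "r \<le> A * r" "1 \<le> A * r" using A1 r mult_mono[of 1 A 1 r] mult_right_mono[of 1 A r] by auto
  have "(CV + 2) * r powr \<alpha> \<le> A powr \<alpha> / CV * r powr \<alpha>"
    by (rule mult_right_mono[OF A]) simp
  also have "\<dots> = (A * r) powr \<alpha> / CV" using A1 r by (simp add: powr_mult)
  also have "\<dots> \<le> sum m (cb x (A * r))" using vol_lower[OF Ar(2)] by (simp add: cb_def)
  finally have 1: "(CV + 2) * r powr \<alpha> \<le> sum m (cb x (A * r))" .
  have 2: "sum m (cb x r) \<le> CV * r powr \<alpha>" using vol_upper[OF r] by (simp add: cb_def)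
  have "sum m (cb x (A * r) - cb x r) = sum m (cb x (A * r)) - sum m (cb x r)"
    using Ar by (intro sum_diff finite_cb) (auto simp: cb_def)
  moreover have "0 \<le> r powr \<alpha>" "(CV + 2) * r powr \<alpha> = CV * r powr \<alpha> + 2 * r powr \<alpha>"
    by (simp_all add: algebra_simps)
  ultimately show "r powr \<alpha> \<le> sum m (cb x (A * r) - cb x r)"
    using 1 2 by linarith
qed

end

section \<open>On-diagonal upper bound\<close>

context ahlfors
begin

definition CT :: "real \<Rightarrow> real" where
  "CT \<beta> = CV * 2 powr \<alpha> / (1 - 2 powr - \<beta>)"

lemma CT_pos: "\<beta> > 0 \<Longrightarrow> CT \<beta> > 0"
  using powr_less_mono[of "- \<beta>" 0 2] CV_pos by (simp add: CT_def)

text \<open>The density \<open>q\<close> is left general: it is used for the jump kernel and for the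
  iterated kernels of the first operator, which have the same spatial decay with a factor
  \<open>n\<close>.\<close>

lemma tail_infsum:
  assumes "\<beta> > 0" "1 \<le> s" and q: "(\<lambda>y. q y * m y) summable_on UNIV" "\<And>y. 0 \<le> q y" "0 \<le> C"
    and le: "\<And>y. s < real (d x y) \<Longrightarrow> q y \<le> C * real (d x y) powr - (\<alpha> + \<beta>)"
  shows "(\<Sum>\<^sub>\<infinity>y. indicator {y. s < real (d x y)} y * (q y * m y)) \<le> C * CT \<beta> * s powr - \<beta>"
proof (rule infsum_le_finite_sums)
  show "(\<lambda>y. indicator {y. s < real (d x y)} y * (q y * m y)) summable_on UNIV"
    by (rule summable_on_bound[OF q(1)]) (simp add: indicator_def q(2) m_ge_0)
  fix F :: "'a set" assume F: "finite F"
  let ?F = "{y \<in> F. s < real (d x y)}"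
  have "(\<Sum>y\<in>F. indicator {y. s < real (d x y)} y * (q y * m y)) = (\<Sum>y\<in>?F. q y * m y)"
    using F by (intro sum.mono_neutral_cong_right) (auto simp: indicator_def)
  also have "\<dots> \<le> (\<Sum>y\<in>?F. C * real (d x y) powr - (\<alpha> + \<beta>) * m y)"
    by (intro sum_mono mult_right_mono le m_ge_0) auto
  also have "\<dots> = C * (\<Sum>y\<in>?F. real (d x y) powr - (\<alpha> + \<beta>) * m y)"
    by (simp add: sum_distrib_left mult.assoc)
  also have "\<dots> \<le> C * (CT \<beta> * s powr - \<beta>)"
    unfolding CT_def using F assms(1,2) by (intro mult_left_mono tail_finite q(3)) auto
  finally show "(\<Sum>y\<in>F. indicator {y. s < real (d x y)} y * (q y * m y)) \<le> C * CT \<beta> * s powr - \<beta>"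
    by (simp add: mult.assoc)
qed

end

section \<open>Jump kernels and their Nash inequality\<close>

locale jump_kernel = ahlfors d m \<alpha> CV + markov_kernel m k kB
  for d :: "'a \<Rightarrow> 'a \<Rightarrow> nat" and m :: "'a \<Rightarrow> real" and \<alpha> CV :: real
    and k :: "'a \<Rightarrow> 'a \<Rightarrow> real" and kB :: real +
  fixes \<beta> CJ :: real
  assumes \<beta>_pos: "\<beta> > 0" and CJ_pos: "CJ > 0"
    and k_lower: "(1 + real (d x y)) powr - (\<alpha> + \<beta>) / CJ \<le> k x y"
    and k_upper: "k x y \<le> CJ * (1 + real (d x y)) powr - (\<alpha> + \<beta>)"
begin

lemma k_upper_far:
  assumes "0 < s" "s \<le> real (d x y)"
  shows "k x y \<le> CJ * s powr - (\<alpha> + \<beta>)"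
proof -
  have "(1 + real (d x y)) powr - (\<alpha> + \<beta>) \<le> s powr - (\<alpha> + \<beta>)"
    using assms \<alpha>_pos \<beta>_pos by (intro powr_mono2') auto
  then have "CJ * (1 + real (d x y)) powr - (\<alpha> + \<beta>) \<le> CJ * s powr - (\<alpha> + \<beta>)"
    using CJ_pos by (intro mult_left_mono) auto
  with k_upper[of x y] show ?thesis by (rule order_trans)
qed

lemma k_lower_near:
  assumes "1 + real (d x y) \<le> s"
  shows "s powr - (\<alpha> + \<beta>) / CJ \<le> k x y"
proof -
  have "s powr - (\<alpha> + \<beta>) \<le> (1 + real (d x y)) powr - (\<alpha> + \<beta>)"
    using assms \<alpha>_pos \<beta>_pos by (intro powr_mono2') auto
  then have "s powr - (\<alpha> + \<beta>) / CJ \<le> (1 + real (d x y)) powr - (\<alpha> + \<beta>) / CJ"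
    using CJ_pos by (intro divide_right_mono) auto
  then show ?thesis using k_lower[of x y] by (rule order_trans)
qed

lemma kop_tail:
  assumes "1 \<le> s"
  shows "kop (indicator {y. s < real (d x y)}) x \<le> CJ * CT \<beta> * s powr - \<beta>"
  unfolding kop_def
proof (rule tail_infsum[OF \<beta>_pos assms k_summable k_nonneg])
  show "k x y \<le> CJ * real (d x y) powr - (\<alpha> + \<beta>)" if "s < real (d x y)" for y
    using that assms by (intro k_upper_far) auto
qed (use CJ_pos in simp)

text \<open>The first step stays in the unit ball, of mass at least \<open>1 / CV\<close>, and the
  second makes the jump. The two-step kernel is needed because \<open>p (2 * n) x x\<close> is a
  squared l2 norm whose decrement is the Dirichlet form of the squared operator.\<close>

lemma p2_lower:
  obtains c where "c > 0" "\<And>x y. c * (1 + real (d x y)) powr - (\<alpha> + \<beta>) \<le> p 2 x y"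
proof
  define c where "c = 2 powr - (\<alpha> + \<beta>) / CJ * (2 powr - (\<alpha> + \<beta>) / CJ) / CV"
  show "c > 0" using CJ_pos CV_pos by (simp add: c_def)
  fix x y
  let ?t = "(1 + real (d x y)) powr - (\<alpha> + \<beta>)"
  have trm: "2 powr - (\<alpha> + \<beta>) / CJ * (2 powr - (\<alpha> + \<beta>) / CJ) * ?t * m z \<le> p 1 z y * (p 1 x z * m z)"
    if "z \<in> cb x 1" for z
  proof -
    have "d x z \<le> 1" using that by (simp add: in_cb)
    then have kxz: "2 powr - (\<alpha> + \<beta>) / CJ \<le> k x z" by (intro k_lower_near) simp
    have "real (d z y) \<le> 1 + real (d x y)"
      using d_triangle_real[of z y x] d_commute[of z x] \<open>d x z \<le> 1\<close> by simp
    then have "(2 * (1 + real (d x y))) powr - (\<alpha> + \<beta>) / CJ \<le> k z y"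
      by (intro k_lower_near) simp
    moreover have "(2 * (1 + real (d x y))) powr - (\<alpha> + \<beta>) = 2 powr - (\<alpha> + \<beta>) * ?t"
      by (subst powr_mult) auto
    ultimately have "2 powr - (\<alpha> + \<beta>) / CJ * ?t \<le> k z y" by simp
    with kxz have "2 powr - (\<alpha> + \<beta>) / CJ * (2 powr - (\<alpha> + \<beta>) / CJ * ?t) \<le> k x z * k z y"
      using CJ_pos k_nonneg by (intro mult_mono) auto
    then have "2 powr - (\<alpha> + \<beta>) / CJ * (2 powr - (\<alpha> + \<beta>) / CJ * ?t) * m z \<le> k x z * k z y * m z"
      by (rule mult_right_mono) (rule m_nonneg)
    then show ?thesis by (simp add: p_1 mult_ac)
  qed
  have s: "(\<lambda>z. p 1 z y * (p 1 x z * m z)) summable_on UNIV"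
  proof (rule summable_on_bound)
    show "(\<lambda>z. kB * (p 1 x z * m z)) summable_on UNIV"
      by (intro summable_on_cmult_right p_summable) simp
    show "\<bar>p 1 z y * (p 1 x z * m z)\<bar> \<le> kB * (p 1 x z * m z)" for z
      using mult_right_mono[OF p_le[of 1 z y], of "p 1 x z * m z"] by (simp add: p_nonneg m_nonneg)
  qed
  have "1 / CV \<le> (\<Sum>z\<in>cb x 1. m z)" using vol_lower[of 1 x] by (simp add: cb_def)
  then have "c * ?t \<le> 2 powr - (\<alpha> + \<beta>) / CJ * (2 powr - (\<alpha> + \<beta>) / CJ) * ?t * (\<Sum>z\<in>cb x 1. m z)"
    using mult_left_mono[of "1 / CV" "\<Sum>z\<in>cb x 1. m z" "2 powr - (\<alpha> + \<beta>) / CJ * (2 powr - (\<alpha> + \<beta>) / CJ) * ?t"]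
      CJ_pos by (simp add: c_def)
  also have "\<dots> \<le> (\<Sum>z\<in>cb x 1. p 1 z y * (p 1 x z * m z))"
    unfolding sum_distrib_left by (intro sum_mono trm)
  also have "\<dots> \<le> (\<Sum>\<^sub>\<infinity>z. p 1 z y * (p 1 x z * m z))"
    by (intro finite_sum_le_infsum s finite_cb) (auto simp: p_nonneg m_nonneg)
  also have "\<dots> = p 2 x y"
    using p_chapman_kolmogorov[of 1 1 x y] by (simp add: numeral_2_eq_2)
  finally show "c * ?t \<le> p 2 x y" .
qed

lemma p_square_summable: "1 \<le> n \<Longrightarrow> (\<lambda>z. (p n x z)\<^sup>2 * m z) summable_on UNIV"
proof (rule summable_on_bound)
  assume "1 \<le> n"
  then show "(\<lambda>z. kB * (p n x z * m z)) summable_on UNIV"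
    by (intro summable_on_cmult_right p_summable)
  show "\<bar>(p n x z)\<^sup>2 * m z\<bar> \<le> kB * (p n x z * m z)" for z
    using mult_right_mono[OF p_le[of n x z], of "p n x z * m z"]
    by (simp add: p_nonneg m_nonneg power2_eq_square mult.assoc)
qed

lemma p_double: "1 \<le> n \<Longrightarrow> p (2 * n) x x = (\<Sum>\<^sub>\<infinity>z. (p n x z)\<^sup>2 * m z)"
proof -
  assume n: "1 \<le> n"
  have "p (2 * n) x x = (\<Sum>\<^sub>\<infinity>z. p n z x * (p n x z * m z))"
    using p_chapman_kolmogorov[OF n n, of x x] by (simp add: mult_2)
  then show ?thesis by (simp add: p_sym[OF n, of _ x] power2_eq_square mult.assoc)
qed

text \<open>Averaging \<open>u\<^sub>a\<^sup>2 \<le> (u\<^sub>a - u\<^sub>b)\<^sup>2 + 2 u\<^sub>a u\<^sub>b\<close> over \<open>b\<close> in a ball of radius \<open>s\<close> bounds the \<open>\<ell>\<^sup>2\<close> norm of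
  \<open>u = p\<^sub>n(x,\<cdot>)\<close> by the Dirichlet form of \<open>K\<^sup>2\<close>, which is the decrement of \<open>p\<^sub>2\<^sub>n(x,x)\<close>.\<close>
lemma nash_step:
  obtains C1 C2 where "C1 > 0" "C2 > 0"
    "\<And>x n s. 1 \<le> n \<Longrightarrow> 1 \<le> s \<Longrightarrow> s powr \<alpha> * p (2 * n) x x
       \<le> C1 * s powr (\<alpha> + \<beta>) * (p (2 * n) x x - p (2 * Suc n) x x) + C2"
proof -
  obtain c where c: "c > 0" "\<And>x y. c * (1 + real (d x y)) powr - (\<alpha> + \<beta>) \<le> p 2 x y"
    using p2_lower by blast
  interpret P2: markov_kernel m "p 2" kB by (rule markov_kernel_p) simp
  show ?thesis
  proof
    show "2 * CV * 2 powr (\<alpha> + \<beta>) / c > 0" "2 * CV > 0" using c CV_pos by auto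
    fix x and n :: nat and s :: real
    assume n: "1 \<le> n" and s: "1 \<le> s"
    define u where "u = p n x"
    have u: "0 \<le> u z" "\<bar>u z\<bar> \<le> kB" for z unfolding u_def by (rule p_nonneg abs_p_le)+
    have um: "(\<lambda>z. u z * m z) summable_on UNIV" unfolding u_def by (rule p_summable[OF n])
    have um1: "(\<Sum>\<^sub>\<infinity>z. u z * m z) = 1" unfolding u_def by (rule p_mass[OF n])
    have uu: "(\<lambda>z. (u z)\<^sup>2 * m z) summable_on UNIV" unfolding u_def by (rule p_square_summable[OF n])
    define F where "F = (\<lambda>a b. (u a - u b) * (u a - u b))"
    have F: "P2.dsummable F" "P2.dsum F = 2 * (\<Sum>\<^sub>\<infinity>z. u z * (P2.kop (\<lambda>_. 1) z * u z - P2.kop u z) * m z)"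
      unfolding F_def by (rule P2.dsum_by_parts[OF um u(2)])+
    have ku: "P2.kop u z = p (2 + n) z x" for z
      using p_chapman_kolmogorov[of 2 n z x] n by (simp add: P2.kop_def u_def p_sym[OF n, of x])
    have s2: "(\<lambda>z. u z * P2.kop u z * m z) summable_on UNIV"
    proof (rule summable_on_bound)
      show "(\<lambda>z. kB * (u z * m z)) summable_on UNIV" by (intro summable_on_cmult_right um)
      show "\<bar>u z * P2.kop u z * m z\<bar> \<le> kB * (u z * m z)" for z
        using mult_right_mono[OF abs_p_le[of "2 + n" z x], of "u z * m z"] u(1)[of z] m_nonneg[of z]
        by (simp add: ku abs_mult mult_ac)
    qed
    have "(\<Sum>\<^sub>\<infinity>z. u z * P2.kop u z * m z) = p (2 * Suc n) x x"
    proof -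
      have "2 * Suc n = n + (2 + n)" by simp
      then have "p (2 * Suc n) x x = p (n + (2 + n)) x x" by (simp only:)
      also have "\<dots> = (\<Sum>\<^sub>\<infinity>z. p (2 + n) z x * (p n x z * m z))"
        using n by (intro p_chapman_kolmogorov) auto
      also have "\<dots> = (\<Sum>\<^sub>\<infinity>z. u z * P2.kop u z * m z)"
        unfolding ku by (simp only: u_def mult_ac)
      finally show ?thesis by simp
    qed
    moreover have "(\<Sum>\<^sub>\<infinity>z. (u z)\<^sup>2 * m z) = p (2 * n) x x" using p_double[OF n] by (simp add: u_def)
    moreover have "(\<Sum>\<^sub>\<infinity>z. u z * (P2.kop (\<lambda>_. 1) z * u z - P2.kop u z) * m z)
        = (\<Sum>\<^sub>\<infinity>z. (u z)\<^sup>2 * m z) - (\<Sum>\<^sub>\<infinity>z. u z * P2.kop u z * m z)"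
    proof -
      have "(u z) * (P2.kop (\<lambda>_. 1) z * u z - P2.kop u z) * m z = (u z)\<^sup>2 * m z - u z * P2.kop u z * m z" for z
        unfolding P2.kop_const by (simp add: power2_eq_square left_diff_distrib right_diff_distrib)
      then show ?thesis using infsum_diff_real(2)[OF uu s2] by simp
    qed
    ultimately have F2: "P2.dsum F = 2 * (p (2 * n) x x - p (2 * Suc n) x x)" using F(2) by simp
    define I where "I = (\<lambda>a. \<Sum>\<^sub>\<infinity>b. F a b * (p 2 a b * m a * m b))"
    \<comment> \<open>Chosen so that \<open>1 \<le> D * p 2 a b\<close> whenever \<open>b\<close>
      lies in the ball of radius \<open>s\<close> around \<open>a\<close>.\<close>
    define D where "D = 2 powr (\<alpha> + \<beta>) / c * s powr (\<alpha> + \<beta>)"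
    have D: "D > 0" using c s by (simp add: D_def)
    have pt: "s powr \<alpha> / CV * ((u a)\<^sup>2 * m a) \<le> D * I a + 2 * (u a * m a)" for a
    proof -
      have "s powr \<alpha> / CV * (u a)\<^sup>2 \<le> (\<Sum>b\<in>cb a s. m b) * (u a)\<^sup>2"
        using vol_lower[OF s, of a] by (intro mult_right_mono) (auto simp: cb_def)
      also have "\<dots> = (\<Sum>b\<in>cb a s. (u a)\<^sup>2 * m b)" by (simp add: sum_distrib_right mult.commute)
      also have "\<dots> \<le> (\<Sum>b\<in>cb a s. D * (F a b * p 2 a b * m b) + 2 * u a * (u b * m b))"
      proof (rule sum_mono)
        fix b assume "b \<in> cb a s"
        then have "1 + real (d a b) \<le> 2 * s" using s by (simp add: in_cb)
        then have "(2 * s) powr - (\<alpha> + \<beta>) \<le> (1 + real (d a b)) powr - (\<alpha> + \<beta>)"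
          using \<alpha>_pos \<beta>_pos by (intro powr_mono2') auto
        then have "c * (2 * s) powr - (\<alpha> + \<beta>) \<le> p 2 a b"
          using c(2)[of a b] mult_left_mono[of "(2 * s) powr - (\<alpha> + \<beta>)" "(1 + real (d a b)) powr - (\<alpha> + \<beta>)" c] c(1)
          by linarith
        then have "D * (c * (2 * s) powr - (\<alpha> + \<beta>)) \<le> D * p 2 a b" using D by simp
        moreover have "D * (c * (2 * s) powr - (\<alpha> + \<beta>)) = 1"
        proof -
          have "(2 * s) powr - (\<alpha> + \<beta>) = 1 / (2 powr (\<alpha> + \<beta>) * s powr (\<alpha> + \<beta>))"
            using s by (simp only: powr_minus_divide) (simp add: powr_mult)
          then show ?thesis using c(1) s by (simp add: D_def)
        qed
        ultimately have "1 \<le> D * p 2 a b" by simp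
        moreover have "0 \<le> F a b" by (simp add: F_def)
        ultimately have "F a b \<le> D * p 2 a b * F a b" using mult_right_mono[of 1 "D * p 2 a b" "F a b"] by simp
        moreover have "(u a)\<^sup>2 \<le> F a b + 2 * u a * u b"
          by (simp add: F_def power2_eq_square algebra_simps)
        ultimately have "(u a)\<^sup>2 \<le> D * p 2 a b * F a b + 2 * u a * u b" by linarith
        from mult_right_mono[OF this m_nonneg[of b]]
        show "(u a)\<^sup>2 * m b \<le> D * (F a b * p 2 a b * m b) + 2 * u a * (u b * m b)"
          by (simp add: algebra_simps)
      qed
      also have "\<dots> = D * (\<Sum>b\<in>cb a s. F a b * p 2 a b * m b) + 2 * u a * (\<Sum>b\<in>cb a s. u b * m b)"
        by (simp add: sum.distrib sum_distrib_left)
      also have "\<dots> \<le> D * (\<Sum>b\<in>cb a s. F a b * p 2 a b * m b) + 2 * u a * 1"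
      proof -
        have "(\<Sum>b\<in>cb a s. u b * m b) \<le> (\<Sum>\<^sub>\<infinity>b. u b * m b)"
          by (intro finite_sum_le_infsum um finite_cb) (auto simp: u m_nonneg)
        then show ?thesis using u(1)[of a] um1 by (intro add_left_mono mult_left_mono) auto
      qed
      finally have "s powr \<alpha> / CV * (u a)\<^sup>2 * m a
          \<le> (D * (\<Sum>b\<in>cb a s. F a b * p 2 a b * m b) + 2 * u a * 1) * m a"
        by (rule mult_right_mono) (rule m_nonneg)
      also have "\<dots> = D * (\<Sum>b\<in>cb a s. F a b * (p 2 a b * m a * m b)) + 2 * (u a * m a)"
        by (simp add: sum_distrib_left sum_distrib_right algebra_simps)
      also have "\<dots> \<le> D * I a + 2 * (u a * m a)"
        unfolding I_def using D P2.dsum_fubini(1)[OF F(1)] finite_cb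
        by (intro add_right_mono mult_left_mono finite_sum_le_infsum)
           (auto simp: F_def p_nonneg m_nonneg)
      finally show ?thesis by (simp add: mult.assoc)
    qed
    have I: "I summable_on UNIV" "infsum I UNIV = P2.dsum F"
      unfolding I_def using P2.dsum_fubini[OF F(1)] by simp_all
    have "s powr \<alpha> / CV * (\<Sum>\<^sub>\<infinity>a. (u a)\<^sup>2 * m a) = (\<Sum>\<^sub>\<infinity>a. s powr \<alpha> / CV * ((u a)\<^sup>2 * m a))"
      by (rule infsum_cmult_right'[symmetric])
    also have "\<dots> \<le> (\<Sum>\<^sub>\<infinity>a. D * I a + 2 * (u a * m a))"
      by (intro infsum_mono pt summable_on_cmult_right summable_on_add uu um I)
    also have "\<dots> = D * infsum I UNIV + 2 * 1"
      by (subst infsum_add) (auto intro!: summable_on_cmult_right um I simp: infsum_cmult_right' um1)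
    finally have "s powr \<alpha> / CV * p (2 * n) x x \<le> D * (2 * (p (2 * n) x x - p (2 * Suc n) x x)) + 2"
      using p_double[OF n] by (simp add: I F2 u_def)
    from mult_left_mono[OF this, of CV]
    show "s powr \<alpha> * p (2 * n) x x
       \<le> 2 * CV * 2 powr (\<alpha> + \<beta>) / c * s powr (\<alpha> + \<beta>) * (p (2 * n) x x - p (2 * Suc n) x x) + 2 * CV"
      using CV_pos by (simp add: D_def algebra_simps)
  qed
qed

text \<open>\<open>nash_decay\<close> gives even times on the diagonal, and the arithmetic-geometric
  inequality in Chapman-Kolmogorov extends this to all pairs. An odd time \<open>2 * j + 1\<close>
  averages an even one; \<open>real n / 3\<close> is a lower bound for \<open>j\<close> in both
  parities.\<close>

lemma on_diagonal_upper:
  obtains C where "C > 0" "\<And>n x y. 1 \<le> n \<Longrightarrow> p n x y \<le> C * real n powr - (\<alpha> / \<beta>)"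
proof -
  obtain C1 C2 where C12: "C1 > 0" "C2 > 0"
    "\<And>x n s. 1 \<le> n \<Longrightarrow> 1 \<le> s \<Longrightarrow> s powr \<alpha> * p (2 * n) x x
       \<le> C1 * s powr (\<alpha> + \<beta>) * (p (2 * n) x x - p (2 * Suc n) x x) + C2"
    using nash_step by blast
  have kB: "kB + 1 > 0" using k_nonneg[of undefined undefined] k_le[of undefined undefined] by linarith
  obtain C where C: "C > 0" and decay: "\<And>a n. (\<And>n. 1 \<le> n \<Longrightarrow> 0 \<le> a n \<and> a n \<le> kB + 1) \<Longrightarrow>
      (\<And>n s. 1 \<le> n \<Longrightarrow> 1 \<le> s \<Longrightarrow>
         s powr \<alpha> * a n \<le> C1 * s powr (\<alpha> + \<beta>) * (a n - a (Suc n)) + C2) \<Longrightarrow>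
      1 \<le> n \<Longrightarrow> a n \<le> C * real n powr (- (\<alpha> / \<beta>))"
    using nash_decay[OF \<alpha>_pos \<beta>_pos C12(1,2) kB] by blast
  have diag: "p (2 * n) x x \<le> C * real n powr - (\<alpha> / \<beta>)" if n: "1 \<le> n" for n x
  proof (rule decay[OF _ _ n])
    show "0 \<le> p (2 * j) x x \<and> p (2 * j) x x \<le> kB + 1" for j
      using p_nonneg[of "2 * j" x x] p_le[of "2 * j" x x] by linarith
  qed (rule C12(3))
  have even: "p (2 * n) x y \<le> C * real n powr - (\<alpha> / \<beta>)" if n: "1 \<le> n" for n x y
  proof -
    have s: "(\<lambda>z. (p n x z)\<^sup>2 * m z + (p n y z)\<^sup>2 * m z) summable_on UNIV"
      by (intro summable_on_add p_square_summable n)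
    have le: "\<bar>2 * (p n z y * (p n x z * m z))\<bar> \<le> (p n x z)\<^sup>2 * m z + (p n y z)\<^sup>2 * m z" for z
    proof -
      have "2 * (p n x z * p n y z) * m z \<le> ((p n x z)\<^sup>2 + (p n y z)\<^sup>2) * m z"
        using sum_squares_bound[of "p n x z" "p n y z"] by (intro mult_right_mono m_nonneg) simp
      then show ?thesis using p_sym[OF n, of z y] by (simp add: p_nonneg m_nonneg algebra_simps)
    qed
    have "2 * p (2 * n) x y = (\<Sum>\<^sub>\<infinity>z. 2 * (p n z y * (p n x z * m z)))"
      unfolding mult_2[of n] p_chapman_kolmogorov[OF n n, of x y] by (rule infsum_cmult_right'[symmetric])
    also have "\<dots> \<le> (\<Sum>\<^sub>\<infinity>z. (p n x z)\<^sup>2 * m z + (p n y z)\<^sup>2 * m z)"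
    proof (rule infsum_mono)
      show "2 * (p n z y * (p n x z * m z)) \<le> (p n x z)\<^sup>2 * m z + (p n y z)\<^sup>2 * m z" for z
        by (rule order_trans[OF abs_ge_self le])
    qed (rule summable_on_bound[OF s le] s)+
    also have "\<dots> = p (2 * n) x x + p (2 * n) y y"
      unfolding p_double[OF n] by (intro infsum_add p_square_summable n)
    finally show ?thesis using diag[OF n, of x] diag[OF n, of y] by simp
  qed
  have all: "p n x y \<le> (C + kB + 1) * (real n / 3) powr - (\<alpha> / \<beta>)" if n: "1 \<le> n" for n x y
  proof -
    have mono: "C * real j powr - (\<alpha> / \<beta>) \<le> (C + kB + 1) * (real n / 3) powr - (\<alpha> / \<beta>)"
      if "1 \<le> j" "real n / 3 \<le> real j" for j
      using that n C kB \<alpha>_pos \<beta>_pos by (intro mult_mono powr_mono2') auto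
    consider "n = 1" | j where "1 \<le> j" "n = 2 * j" | j where "1 \<le> j" "n = Suc (2 * j)"
    proof (cases "even n")
      case True
      then obtain j where "n = 2 * j" by (rule evenE)
      with n that(2)[of j] show thesis by simp
    next
      case False
      then obtain j where j: "n = Suc (2 * j)" by (auto elim: oddE)
      with that(1) that(3)[of j] show thesis by (cases j) auto
    qed
    then show ?thesis
    proof cases
      case 1
      have "(C + kB + 1) * 1 \<le> (C + kB + 1) * (1 / 3) powr - (\<alpha> / \<beta>)"
        using C kB \<alpha>_pos \<beta>_pos powr_mono2'[of "- (\<alpha> / \<beta>)" "1/3" 1] by (intro mult_left_mono) auto
      then show ?thesis using 1 p_le[of n x y] C by simp
    next
      case (2 j)
      then show ?thesis using even[OF 2(1), of x y] mono[OF 2(1)] by simp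
    next
      case (3 j)
      have "p n x y = kop (\<lambda>z. p (2 * j) z y) x" using 3 p_Suc[of "2 * j"] by simp
      also have "\<dots> \<le> C * real j powr - (\<alpha> / \<beta>)"
        by (rule kop_le) (rule p_nonneg, rule even[OF 3(1)])
      also have "\<dots> \<le> (C + kB + 1) * (real n / 3) powr - (\<alpha> / \<beta>)"
        using 3 by (intro mono) auto
      finally show ?thesis .
    qed
  qed
  show ?thesis
  proof
    show "(C + kB + 1) * (1 / 3) powr - (\<alpha> / \<beta>) > 0" using C kB by simp
    show "p n x y \<le> (C + kB + 1) * (1 / 3) powr - (\<alpha> / \<beta>) * real n powr - (\<alpha> / \<beta>)" if "1 \<le> n" for n x y
      using all[OF that, of x y] powr_mult[of "1/3" "real n" "- (\<alpha> / \<beta>)"] by simp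
  qed
qed

end

section \<open>Cutoff Sobolev inequality\<close>

lemma l2_of_bounded_l1:
  fixes f :: "'b \<Rightarrow> real"
  assumes "(\<lambda>x. f x * m x) summable_on A" "\<And>x. 0 \<le> f x" "\<And>x. f x \<le> B" "\<And>x. 0 \<le> m x"
  shows "(\<lambda>x. (f x)\<^sup>2 * m x) summable_on A"
    and "(\<Sum>\<^sub>\<infinity>x\<in>A. (f x)\<^sup>2 * m x) \<le> B * (\<Sum>\<^sub>\<infinity>x\<in>A. f x * m x)"
proof -
  have le: "\<bar>(f x)\<^sup>2 * m x\<bar> \<le> B * (f x * m x)" for x
    using mult_right_mono[OF assms(3), of "f x * m x"] assms(2,4) by (simp add: power2_eq_square mult.assoc)
  have s: "(\<lambda>x. B * (f x * m x)) summable_on A" by (intro summable_on_cmult_right assms(1))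
  show sq: "(\<lambda>x. (f x)\<^sup>2 * m x) summable_on A" by (rule summable_on_bound[OF s le])
  have "(\<Sum>\<^sub>\<infinity>x\<in>A. (f x)\<^sup>2 * m x) \<le> (\<Sum>\<^sub>\<infinity>x\<in>A. B * (f x * m x))"
    by (rule infsum_mono[OF sq s]) (rule order_trans[OF abs_ge_self le])
  then show "(\<Sum>\<^sub>\<infinity>x\<in>A. (f x)\<^sup>2 * m x) \<le> B * (\<Sum>\<^sub>\<infinity>x\<in>A. f x * m x)"
    by (simp add: infsum_cmult_right')
qed

context symmetric_kernel
begin

lemma dsummable_sq_diff:
  assumes "(\<lambda>x. (f x)\<^sup>2 * m x) summable_on UNIV"
  shows "dsummable (\<lambda>x y. (f x - f y)\<^sup>2)"
proof (rule dsummableI)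
  show "(\<lambda>x. 2 * (f x)\<^sup>2 * m x) summable_on UNIV"
    unfolding mult.assoc by (intro summable_on_cmult_right assms)
  show "\<bar>(f x - f y)\<^sup>2\<bar> \<le> 2 * (f x)\<^sup>2 + 2 * (f y)\<^sup>2" for x y
  proof -
    have "(f x - f y)\<^sup>2 \<le> 2 * (f x)\<^sup>2 + 2 * (f y)\<^sup>2"
      using zero_le_power2[of "f x + f y"] by (simp add: power2_eq_square algebra_simps)
    then show ?thesis by simp
  qed
qed

lemma dsummable_sq_mult_diff:
  assumes f: "(\<lambda>x. (f x)\<^sup>2 * m x) summable_on UNIV" and \<psi>: "\<And>x. \<bar>\<psi> x\<bar> \<le> (1::real)"
  shows "dsummable (\<lambda>x y. (f x)\<^sup>2 * (\<psi> x - \<psi> y)\<^sup>2)"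
proof (rule dsummableI)
  show "(\<lambda>x. 4 * (f x)\<^sup>2 * m x) summable_on UNIV"
    unfolding mult.assoc by (intro summable_on_cmult_right f)
  show "\<bar>(f x)\<^sup>2 * (\<psi> x - \<psi> y)\<^sup>2\<bar> \<le> 4 * (f x)\<^sup>2 + 4 * (f y)\<^sup>2" for x y
  proof -
    have "\<bar>\<psi> x - \<psi> y\<bar> \<le> 2" using \<psi>[of x] \<psi>[of y] by linarith
    then have "(\<psi> x - \<psi> y)\<^sup>2 \<le> 2\<^sup>2" by (intro power2_le_iff_abs_le[THEN iffD2]) auto
    then have "(f x)\<^sup>2 * (\<psi> x - \<psi> y)\<^sup>2 \<le> (f x)\<^sup>2 * 4" by (intro mult_left_mono) auto
    moreover have "0 \<le> (f x)\<^sup>2 * (\<psi> x - \<psi> y)\<^sup>2" "0 \<le> (f y)\<^sup>2" by simp_all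
    ultimately show ?thesis by linarith
  qed
qed

lemma kop_l1:
  assumes g: "(\<lambda>x. g x * m x) summable_on UNIV" "\<And>x. 0 \<le> g x"
  shows "(\<lambda>x. kop g x * m x) summable_on UNIV"
    and "(\<Sum>\<^sub>\<infinity>x. kop g x * m x) \<le> (\<Sum>\<^sub>\<infinity>x. g x * m x)"
proof -
  have s: "dsummable (\<lambda>x y. g x)" by (rule dsummable_left[OF g])
  then have s': "dsummable (\<lambda>x y. g y)" using dsummable_swap[of "\<lambda>x y. g x"] by simp
  have eq: "(\<Sum>\<^sub>\<infinity>y. g y * (k x y * m x * m y)) = kop g x * m x" for x
  proof -
    have "(\<Sum>\<^sub>\<infinity>y. g y * (k x y * m x * m y)) = (\<Sum>\<^sub>\<infinity>y. g y * (k x y * m y) * m x)"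
      by (simp only: mult_ac)
    then show ?thesis unfolding kop_def by (simp add: infsum_cmult_left')
  qed
  show "(\<lambda>x. kop g x * m x) summable_on UNIV"
    using dsum_fubini(2)[OF s'] unfolding eq .
  have "(\<Sum>\<^sub>\<infinity>x. kop g x * m x) = dsum (\<lambda>x y. g y)"
    using dsum_fubini(3)[OF s'] unfolding eq by simp
  also have "\<dots> = dsum (\<lambda>x y. g x * 1)" using dsum_swap[of "\<lambda>x y. g x"] by simp
  also have "\<dots> = (\<Sum>\<^sub>\<infinity>x. g x * kop (\<lambda>_. 1) x * m x)" by (rule dsum_prod[OF g(1), of _ 1]) simp
  also have "\<dots> \<le> (\<Sum>\<^sub>\<infinity>x. g x * m x)"
  proof -
    have le: "\<bar>g x * kop (\<lambda>_. 1) x * m x\<bar> \<le> g x * m x" for x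
      using kop_abs_le[of "\<lambda>_. 1" 1 x] g(2)[of x] m_nonneg[of x]
        mult_left_mono[of "\<bar>kop (\<lambda>_. 1) x\<bar>" 1 "g x * m x"] by (simp add: abs_mult mult_ac)
    show ?thesis
      by (rule infsum_mono[OF summable_on_bound[OF g(1) le] g(1)]) (rule order_trans[OF abs_ge_self le])
  qed
  finally show "(\<Sum>\<^sub>\<infinity>x. kop g x * m x) \<le> (\<Sum>\<^sub>\<infinity>x. g x * m x)" .
qed

end

text \<open>Write \<open>a\<^sup>2 * u - b\<^sup>2 * v\<close> as \<open>(a\<^sup>2 + b\<^sup>2) *
  (u - v) / 2 + (a\<^sup>2 - b\<^sup>2) * (u + v) / 2\<close>. Completing the square absorbs the
  cross term; the bounds on \<open>u\<close> and \<open>v\<close> enter only through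
  \<open>\<bar>u + v\<bar> \<le> 2\<close>.\<close>

lemma cutoff_sobolev_pointwise:
  fixes a b u v :: real
  assumes "\<bar>u\<bar> \<le> 1" "\<bar>v\<bar> \<le> 1"
  shows "(a\<^sup>2 + b\<^sup>2) * (u - v)\<^sup>2 / 4 \<le> (u - v) * (a\<^sup>2 * u - b\<^sup>2 * v) + 2 * (a - b)\<^sup>2"
proof -
  have "(u + v)\<^sup>2 \<le> 2\<^sup>2" using assms by (intro power2_le_iff_abs_le[THEN iffD2]) auto
  then have "0 \<le> (2 - (u + v)\<^sup>2 / 2) * (a - b)\<^sup>2" by (intro mult_nonneg_nonneg) auto
  moreover have "0 \<le> ((a + b) * (u - v) + 2 * (u + v) * (a - b))\<^sup>2 / 8" by simp
  moreover have "0 \<le> ((a - b) * (u - v))\<^sup>2 / 8" by simp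
  moreover have "(u - v) * (a\<^sup>2 * u - b\<^sup>2 * v) + 2 * (a - b)\<^sup>2 - (a\<^sup>2 + b\<^sup>2) * (u - v)\<^sup>2 / 4
     = (2 - (u + v)\<^sup>2 / 2) * (a - b)\<^sup>2 + ((a + b) * (u - v) + 2 * (u + v) * (a - b))\<^sup>2 / 8
       + ((a - b) * (u - v))\<^sup>2 / 8"
    by (simp add: power2_eq_square field_simps)
  ultimately show ?thesis by linarith
qed

context markov_kernel
begin

text \<open>The test function is \<open>f\<^sup>2 \<psi>\<close>.\<close>
lemma cutoff_sobolev:
  assumes f: "(\<lambda>x. (f x)\<^sup>2 * m x) summable_on UNIV" and \<psi>: "\<And>x. \<bar>\<psi> x\<bar> \<le> 1"
    and \<delta>: "\<And>x. \<bar>\<psi> x - kop \<psi> x\<bar> \<le> \<delta>"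
  shows "dsum (\<lambda>x y. (f x)\<^sup>2 * (\<psi> x - \<psi> y)\<^sup>2)
    \<le> 4 * dsum (\<lambda>x y. (f x - f y)\<^sup>2) + 4 * \<delta> * (\<Sum>\<^sub>\<infinity>x. (f x)\<^sup>2 * m x)"
proof -
  let ?A = "\<lambda>x y. (f x)\<^sup>2 * (\<psi> x - \<psi> y)\<^sup>2"
  let ?G = "\<lambda>x. (f x)\<^sup>2 * \<psi> x"
  have le1: "\<bar>?G x * m x\<bar> \<le> (f x)\<^sup>2 * m x" for x
    using mult_left_mono[OF \<psi>[of x], of "(f x)\<^sup>2 * m x"] m_nonneg[of x] by (simp add: abs_mult mult_ac)
  have G: "(\<lambda>x. ?G x * m x) summable_on UNIV" by (rule summable_on_bound[OF f le1])
  have A: "dsummable ?A" by (rule dsummable_sq_mult_diff[OF f \<psi>])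
  then have A': "dsummable (\<lambda>x y. ?A y x)" using dsummable_swap[of ?A] by blast
  have D: "dsummable (\<lambda>x y. (f x - f y)\<^sup>2)" by (rule dsummable_sq_diff[OF f])
  note bp = dsum_by_parts[OF G \<psi>]
  have le2: "\<bar>?G x * (kop (\<lambda>_. 1) x * \<psi> x - kop \<psi> x) * m x\<bar> \<le> \<delta> * ((f x)\<^sup>2 * m x)" for x
  proof -
    have "\<bar>?G x * m x\<bar> * \<bar>\<psi> x - kop \<psi> x\<bar> \<le> ((f x)\<^sup>2 * m x) * \<delta>"
      by (intro mult_mono le1 \<delta>) (simp_all add: m_nonneg)
    then show ?thesis by (simp add: kop_const abs_mult mult_ac)
  qed
  have s2: "(\<lambda>x. \<delta> * ((f x)\<^sup>2 * m x)) summable_on UNIV" by (intro summable_on_cmult_right f)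
  have "(\<Sum>\<^sub>\<infinity>x. ?G x * (kop (\<lambda>_. 1) x * \<psi> x - kop \<psi> x) * m x) \<le> (\<Sum>\<^sub>\<infinity>x. \<delta> * ((f x)\<^sup>2 * m x))"
    by (rule infsum_mono[OF summable_on_bound[OF s2 le2] s2]) (rule order_trans[OF abs_ge_self le2])
  then have up: "dsum (\<lambda>x y. (\<psi> x - \<psi> y) * (?G x - ?G y)) \<le> 2 * \<delta> * (\<Sum>\<^sub>\<infinity>x. (f x)\<^sup>2 * m x)"
    unfolding bp(2) by (simp add: infsum_cmult_right')
  \<comment> \<open>The pointwise inequality is symmetric in the two points, so \<open>?A\<close> is
    first averaged with its transpose, which has the same double sum.\<close>
  have "dsum ?A / 2 = (1/4) * (dsum ?A + dsum (\<lambda>x y. ?A y x))"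
    using dsum_swap[of ?A] by simp
  also have "\<dots> = dsum (\<lambda>x y. (1/4) * (?A x y + ?A y x))"
    unfolding dsum_cmult dsum_add[OF A A'] by simp
  also have "\<dots> \<le> dsum (\<lambda>x y. (\<psi> x - \<psi> y) * (?G x - ?G y) + 2 * (f x - f y)\<^sup>2)"
  proof (rule dsum_mono)
    show "dsummable (\<lambda>x y. (1/4) * (?A x y + ?A y x))" by (intro dsummable_cmult dsummable_add A A')
    show "dsummable (\<lambda>x y. (\<psi> x - \<psi> y) * (?G x - ?G y) + 2 * (f x - f y)\<^sup>2)"
      by (intro dsummable_cmult dsummable_add D bp(1))
    show "(1/4) * (?A x y + ?A y x) \<le> (\<psi> x - \<psi> y) * (?G x - ?G y) + 2 * (f x - f y)\<^sup>2" for x y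
      using cutoff_sobolev_pointwise[OF \<psi>[of x] \<psi>[of y], of "f x" "f y"]
      by (simp add: power2_commute[of "\<psi> y"] algebra_simps add_divide_distrib)
  qed
  also have "\<dots> = dsum (\<lambda>x y. (\<psi> x - \<psi> y) * (?G x - ?G y)) + 2 * dsum (\<lambda>x y. (f x - f y)\<^sup>2)"
    by (simp add: dsum_add[OF bp(1) dsummable_cmult[OF D]] dsum_cmult)
  finally show ?thesis using up by simp
qed

section \<open>Cesaro means of the iterates\<close>

definition ces :: "nat \<Rightarrow> ('a \<Rightarrow> real) \<Rightarrow> 'a \<Rightarrow> real" where
  "ces n g x = (\<Sum>j<n. (kop ^^ j) g x) / real n"

lemma kop_sum:
  assumes "\<And>j x. \<bar>h j x\<bar> \<le> B"
  shows "kop (\<lambda>x. \<Sum>j<n. h j x) x = (\<Sum>j<(n::nat). kop (h j) x)"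
proof (induction n)
  case 0
  show ?case using kop_const[of 0] by simp
next
  case (Suc n)
  have b: "\<bar>\<Sum>j<n. h j x\<bar> \<le> real n * B" for x
    using order_trans[OF sum_abs sum_bounded_above[of "{..<n}" "\<lambda>j. \<bar>h j x\<bar>" B]] assms by simp
  show ?case using kop_add[of "\<lambda>x. \<Sum>j<n. h j x" "real n * B" "h n" B x, OF b assms] Suc by simp
qed

lemma ces_minus_kop:
  assumes g: "\<And>x. \<bar>g x\<bar> \<le> B" and n: "1 \<le> n"
  shows "ces n g x - kop (ces n g) x = (g x - (kop ^^ n) g x) / real n"
proof -
  have "kop (ces n g) x = kop (\<lambda>x. (1 / real n) * (\<Sum>j<n. (kop ^^ j) g x)) x"
    by (simp add: ces_def[abs_def])
  also have "\<dots> = (1 / real n) * (\<Sum>j<n. kop ((kop ^^ j) g) x)"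
    unfolding kop_cmult by (simp add: kop_sum[OF abs_funpow_kop_le[OF g]])
  also have "\<dots> = (\<Sum>j<n. (kop ^^ Suc j) g x) / real n" by simp
  also have "(\<Sum>j<n. (kop ^^ Suc j) g x) = (\<Sum>j<n. (kop ^^ j) g x) - g x + (kop ^^ n) g x"
    by (induction n) auto
  finally show ?thesis
    unfolding ces_def[of n g x] by (simp add: diff_divide_distrib add_divide_distrib)
qed

lemma abs_ces_le:
  assumes g: "\<And>x. \<bar>g x\<bar> \<le> B" and n: "1 \<le> n"
  shows "\<bar>ces n g x\<bar> \<le> B"
proof -
  have "\<bar>\<Sum>j<n. (kop ^^ j) g x\<bar> \<le> real n * B"
    using order_trans[OF sum_abs sum_bounded_above[of "{..<n}" "\<lambda>j. \<bar>(kop ^^ j) g x\<bar>" B]]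
      abs_funpow_kop_le[OF g] by simp
  then show ?thesis using n by (simp add: ces_def field_simps)
qed

lemma ces_approx:
  assumes "\<And>j. j < n \<Longrightarrow> \<bar>(kop ^^ j) g x - c\<bar> \<le> \<eta>" and n: "1 \<le> n"
  shows "\<bar>ces n g x - c\<bar> \<le> \<eta>"
proof -
  have "ces n g x - c = (\<Sum>j<n. (kop ^^ j) g x - c) / real n"
    using n by (simp add: ces_def sum_subtractf diff_divide_distrib)
  moreover have "\<bar>\<Sum>j<n. (kop ^^ j) g x - c\<bar> \<le> real n * \<eta>"
    using order_trans[OF sum_abs sum_bounded_above[of "{..<n}" "\<lambda>j. \<bar>(kop ^^ j) g x - c\<bar>" \<eta>]]
      assms(1) by simp
  ultimately show ?thesis using n by (simp add: abs_divide divide_le_eq mult.commute)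
qed

text \<open>Integrates a pointwise bound against the \<open>n\<close>-step kernel, which is positive
  and of mass 1. In the applications \<open>h\<close> is the indicator of a far region or a squared
  exit function cut off to a ball.\<close>

lemma funpow_kop_diff_le:
  assumes g: "\<And>y. \<bar>g y\<bar> \<le> B" and h: "\<And>y. \<bar>h y\<bar> \<le> B'" and le: "\<And>y. \<bar>g y - c\<bar> \<le> a + b * h y"
    and n: "1 \<le> n"
  shows "\<bar>(kop ^^ n) g x - c\<bar> \<le> a + b * (kop ^^ n) h x"
proof -
  interpret pn: markov_kernel m "p n" kB by (rule markov_kernel_p[OF n])
  have bh0: "\<bar>b * h y\<bar> \<le> \<bar>b\<bar> * B'" for y
    unfolding abs_mult by (rule mult_left_mono[OF h]) simp
  have bh: "\<bar>a + b * h y\<bar> \<le> \<bar>a\<bar> + \<bar>b\<bar> * B'" for y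
    using bh0[of y] by linarith
  have ca: "\<bar>(\<lambda>_. a) y\<bar> \<le> \<bar>a\<bar>" "\<bar>(\<lambda>_. c) y\<bar> \<le> \<bar>c\<bar>" for y :: 'a by simp_all
  have 1: "pn.kop (\<lambda>y. a + b * h y) x = a + b * pn.kop h x"
    unfolding pn.kop_add[OF ca(1) bh0] pn.kop_const pn.kop_cmult ..
  have 2: "pn.kop (\<lambda>y. g y - c) x = pn.kop g x - c"
    unfolding pn.kop_diff[OF g ca(2)] pn.kop_const ..
  have bg: "\<bar>g y - c\<bar> \<le> \<bar>a\<bar> + \<bar>b\<bar> * B'" for y using le[of y] bh[of y] by linarith
  have bg': "\<bar>-1 * (g y - c)\<bar> \<le> \<bar>a\<bar> + \<bar>b\<bar> * B'" for y unfolding abs_mult using bg[of y] by simp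
  have "pn.kop (\<lambda>y. g y - c) x \<le> pn.kop (\<lambda>y. a + b * h y) x"
  proof (rule pn.kop_mono[OF bg bh])
    show "g y - c \<le> a + b * h y" for y using le[of y] by linarith
  qed
  moreover have "pn.kop (\<lambda>y. -1 * (g y - c)) x \<le> pn.kop (\<lambda>y. a + b * h y) x"
  proof (rule pn.kop_mono[OF bg' bh])
    show "-1 * (g y - c) \<le> a + b * h y" for y using le[of y] by (simp add: abs_le_iff)
  qed
  ultimately have "\<bar>pn.kop g x - c\<bar> \<le> a + b * pn.kop h x"
    unfolding pn.kop_cmult 1 2 by (simp add: abs_le_iff)
  then show ?thesis
    unfolding funpow_kop_eq[OF n g] funpow_kop_eq[OF n h] .
qed

lemma ces_l1:
  assumes g: "(\<lambda>x. g x * m x) summable_on UNIV" "\<And>x. 0 \<le> g x" and n: "1 \<le> n"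
  shows "(\<lambda>x. ces n g x * m x) summable_on UNIV"
    and "(\<Sum>\<^sub>\<infinity>x. ces n g x * m x) \<le> (\<Sum>\<^sub>\<infinity>x. g x * m x)"
proof -
  have f: "(\<lambda>x. (kop ^^ j) g x * m x) summable_on UNIV
      \<and> (\<Sum>\<^sub>\<infinity>x. (kop ^^ j) g x * m x) \<le> (\<Sum>\<^sub>\<infinity>x. g x * m x)" for j
  proof (induction j)
    case (Suc j)
    have "0 \<le> (kop ^^ j) g x" for x by (rule funpow_kop_nonneg[OF g(2)])
    note l1 = kop_l1[OF conjunct1[OF Suc] this]
    show ?case using l1(1) order_trans[OF l1(2) conjunct2[OF Suc]] by simp
  qed (simp add: g)
  have eq: "ces n g x * m x = (1 / real n) * (\<Sum>j<n. (kop ^^ j) g x * m x)" for x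
    by (simp add: ces_def sum_distrib_right)
  have s: "(\<lambda>x. \<Sum>j<n. (kop ^^ j) g x * m x) summable_on UNIV
      \<and> (\<Sum>\<^sub>\<infinity>x. \<Sum>j<n. (kop ^^ j) g x * m x) = (\<Sum>j<n. \<Sum>\<^sub>\<infinity>x. (kop ^^ j) g x * m x)" for n
  proof (induction n)
    case (Suc n)
    then show ?case using f[of n] by (simp add: summable_on_add infsum_add)
  qed simp
  show "(\<lambda>x. ces n g x * m x) summable_on UNIV"
    unfolding eq by (rule summable_on_cmult_right) (use s in blast)
  have "(\<Sum>\<^sub>\<infinity>x. ces n g x * m x) = (1 / real n) * (\<Sum>j<n. \<Sum>\<^sub>\<infinity>x. (kop ^^ j) g x * m x)"
    unfolding eq infsum_cmult_right' using s by simp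
  also have "\<dots> \<le> (1 / real n) * (\<Sum>j<n. \<Sum>\<^sub>\<infinity>x. g x * m x)"
    using f by (intro mult_left_mono sum_mono) auto
  also have "\<dots> = (\<Sum>\<^sub>\<infinity>x. g x * m x)" using n by simp
  finally show "(\<Sum>\<^sub>\<infinity>x. ces n g x * m x) \<le> (\<Sum>\<^sub>\<infinity>x. g x * m x)" .
qed

text \<open>Twice the pairing of \<open>ces n g\<close> with \<open>ces n g - kop (ces n g)\<close>.
  By telescoping and positivity of the iterates the latter is at most \<open>g / n\<close>, while
  \<open>ces n g \<le> 1\<close>.\<close>

lemma ces_energy:
  assumes g: "(\<lambda>x. g x * m x) summable_on UNIV" "\<And>x. 0 \<le> g x" "\<And>x. g x \<le> 1" and n: "1 \<le> n"
  shows "dsum (\<lambda>x y. (ces n g x - ces n g y)\<^sup>2) \<le> 2 / real n * (\<Sum>\<^sub>\<infinity>x. g x * m x)"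
proof -
  have g1: "\<bar>g x\<bar> \<le> 1" for x using g(2,3)[of x] by simp
  have c0: "0 \<le> ces n g x" for x
    using funpow_kop_nonneg[OF g(2)] by (simp add: ces_def sum_nonneg)
  have ca: "\<bar>ces n g x\<bar> \<le> 1" for x by (rule abs_ces_le[OF g1 n])
  have c1: "ces n g x \<le> 1" for x using ca[of x] by simp
  have cmk: "ces n g x - kop (ces n g) x = (g x - (kop ^^ n) g x) / real n" for x
    by (rule ces_minus_kop[OF g1 n])
  have le: "ces n g x * (kop (\<lambda>_. 1) x * ces n g x - kop (ces n g) x) * m x \<le> (1 / real n) * (g x * m x)" for x
  proof -
    have "ces n g x * ((g x - (kop ^^ n) g x) / real n) \<le> ces n g x * (g x / real n)"
      using c0 funpow_kop_nonneg[of g n x, OF g(2)] by (intro mult_left_mono divide_right_mono) auto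
    also have "\<dots> \<le> 1 * (g x / real n)" using c1 g by (intro mult_right_mono) auto
    finally have "ces n g x * (1 * ces n g x - kop (ces n g) x) \<le> 1 / real n * g x"
      using cmk[of x] by simp
    from mult_right_mono[OF this m_nonneg[of x]] show ?thesis unfolding kop_const by (simp add: mult.assoc)
  qed
  have 1: "dsum (\<lambda>x y. (ces n g x - ces n g y)\<^sup>2)
      = 2 * (\<Sum>\<^sub>\<infinity>x. ces n g x * (kop (\<lambda>_. 1) x * ces n g x - kop (ces n g) x) * m x)"
    unfolding power2_eq_square by (rule dsum_by_parts(2)[OF ces_l1(1)[OF g(1,2) n] ca])
  have 2: "(\<Sum>\<^sub>\<infinity>x. ces n g x * (kop (\<lambda>_. 1) x * ces n g x - kop (ces n g) x) * m x)
      \<le> (\<Sum>\<^sub>\<infinity>x. (1 / real n) * (g x * m x))"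
  proof (rule infsum_mono[OF _ summable_on_cmult_right[OF g(1)] le])
    show "(\<lambda>x. ces n g x * (kop (\<lambda>_. 1) x * ces n g x - kop (ces n g) x) * m x) summable_on UNIV"
    proof (rule summable_on_bound)
      show "(\<lambda>x. 2 * (ces n g x * m x)) summable_on UNIV"
        by (intro summable_on_cmult_right ces_l1(1) g n)
      fix x
      have "\<bar>kop (\<lambda>_. 1) x * ces n g x - kop (ces n g) x\<bar> \<le> 2"
        using ca[of x] kop_abs_le[of "ces n g" 1 x, OF ca]
        by (simp add: kop_const)
      then have "ces n g x * m x * \<bar>kop (\<lambda>_. 1) x * ces n g x - kop (ces n g) x\<bar> \<le> ces n g x * m x * 2"
        using c0 m_nonneg by (intro mult_left_mono) auto
      then show "\<bar>ces n g x * (kop (\<lambda>_. 1) x * ces n g x - kop (ces n g) x) * m x\<bar> \<le> 2 * (ces n g x * m x)"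
        using c0[of x] m_nonneg[of x] by (simp add: abs_mult mult_ac)
    qed
  qed
  have 3: "(\<Sum>\<^sub>\<infinity>x. (1 / real n) * (g x * m x)) = (1 / real n) * (\<Sum>\<^sub>\<infinity>x. g x * m x)"
    by (rule infsum_cmult_right')
  show ?thesis unfolding 1 using 2 unfolding 3 by simp
qed

end

section \<open>Cutoff functions at a given scale\<close>

text \<open>A wave \<open>Z\<close> of period 2 is bounded, so that it can be mollified with uniform control. The phase \<open>\<Theta>\<close> recovers
  the unbounded quantity \<open>s/2\<close> from a perturbation of the wave: it increases by one on
  \<open>[2j, 2j+1]\<close>, where \<open>Z\<close> increases, and is constant on \<open>[2j+1, 2j+2]\<close>.\<close>

definition wave :: "real \<Rightarrow> real" where
  "wave s = (let t = s - 2 * of_int \<lfloor>s / 2\<rfloor> in if t < 1 then t else 2 - t)"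

definition phase :: "real \<Rightarrow> real \<Rightarrow> real" where
  "phase s p = (if s - 2 * of_int \<lfloor>s / 2\<rfloor> < 1
     then of_int \<lfloor>s / 2\<rfloor> + min 1 (max 0 (2 * p - 1 / 2)) else of_int \<lfloor>s / 2\<rfloor> + 1)"

lemma floor_half: "0 \<le> s - 2 * of_int \<lfloor>s / 2\<rfloor>" "s - 2 * of_int \<lfloor>s / 2\<rfloor> < (2::real)"
  by linarith+

lemma wave_bounds: "0 \<le> wave s" "wave s \<le> 1"
  using floor_half[of s] by (auto simp: wave_def Let_def)

lemma wave_le: "wave s \<le> \<bar>s - 2 * of_int i\<bar>"
proof -
  have "i \<le> \<lfloor>s / 2\<rfloor> \<or> i \<ge> \<lfloor>s / 2\<rfloor> + 1" by linarith
  then have "real_of_int i \<le> of_int \<lfloor>s / 2\<rfloor> \<or> of_int i \<ge> real_of_int \<lfloor>s / 2\<rfloor> + 1"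
    by linarith
  then show ?thesis using floor_half[of s] by (auto simp: wave_def Let_def)
qed

lemma wave_attained: "\<exists>i. wave s = \<bar>s - 2 * of_int i\<bar>"
proof (cases "s - 2 * of_int \<lfloor>s / 2\<rfloor> < 1")
  case True
  then show ?thesis using floor_half[of s] by (intro exI[of _ "\<lfloor>s / 2\<rfloor>"]) (auto simp: wave_def Let_def)
next
  case False
  then show ?thesis using floor_half[of s] by (intro exI[of _ "\<lfloor>s / 2\<rfloor> + 1"]) (auto simp: wave_def Let_def)
qed

lemma wave_lipschitz: "\<bar>wave s - wave t\<bar> \<le> \<bar>s - t\<bar>"
proof -
  obtain i j where "wave s = \<bar>s - 2 * of_int i\<bar>" "wave t = \<bar>t - 2 * of_int j\<bar>"
    using wave_attained by metis
  then show ?thesis using wave_le[of s j] wave_le[of t i] by linarith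
qed

text \<open>The clamp in \<open>phase\<close> is 0 for \<open>p \<le> 1 / 4\<close> and 1 for
  \<open>p \<ge> 3 / 4\<close>. If \<open>s\<close> and \<open>t\<close> lie on different monotone
  pieces of the wave, the wave is within 1/8 of its extreme value there; with the error 1/8 the
  perturbed value lies in the flat part, so the branches agree. On one rising piece the clamp has
  slope 2.\<close>

lemma phase_lipschitz_aux:
  assumes "s \<le> t" "t - s \<le> 1 / 8" "\<bar>p - wave s\<bar> \<le> 1 / 8" "\<bar>q - wave t\<bar> \<le> 1 / 8"
  shows "\<bar>phase s p - phase t q\<bar> \<le> 2 * \<bar>p - q\<bar>" "\<bar>phase s p - phase t q\<bar> \<le> 1"
proof -
  define i where "i = \<lfloor>s / 2\<rfloor>"
  define j where "j = \<lfloor>t / 2\<rfloor>"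
  have ij: "j = i \<or> j = i + 1"
    using assms(1,2) unfolding i_def j_def by linarith
  have fs: "0 \<le> s - 2 * of_int i" "s - 2 * of_int i < 2" "0 \<le> t - 2 * of_int j" "t - 2 * of_int j < 2"
    unfolding i_def j_def by (rule floor_half)+
  have w: "wave s = (if s - 2 * of_int i < 1 then s - 2 * of_int i else 2 - (s - 2 * of_int i))"
     "wave t = (if t - 2 * of_int j < 1 then t - 2 * of_int j else 2 - (t - 2 * of_int j))"
    by (simp_all add: wave_def i_def j_def Let_def)
  have ph: "phase s p = (if s - 2 * of_int i < 1 then of_int i + min 1 (max 0 (2 * p - 1 / 2)) else of_int i + 1)"
     "phase t q = (if t - 2 * of_int j < 1 then of_int j + min 1 (max 0 (2 * q - 1 / 2)) else of_int j + 1)"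
    by (simp_all add: phase_def i_def j_def)
  have c: "\<bar>min 1 (max 0 a) - min 1 (max 0 b)\<bar> \<le> \<bar>a - b\<bar>"
      "\<bar>min 1 (max 0 a) - min 1 (max 0 b)\<bar> \<le> 1" for a b :: real
    by (auto simp: min_def max_def abs_if)
  have "\<bar>(2 * p - 1 / 2) - (2 * q - 1 / 2)\<bar> = 2 * \<bar>p - q\<bar>" by (simp add: abs_if)
  note clamp = c(1)[of "2 * p - 1 / 2" "2 * q - 1 / 2", unfolded this] c(2)[of "2 * p - 1 / 2" "2 * q - 1 / 2"]
  have "\<bar>phase s p - phase t q\<bar> \<le> 2 * \<bar>p - q\<bar> \<and> \<bar>phase s p - phase t q\<bar> \<le> 1"
    using ij
  proof
    assume j: "j = i"
    show ?thesis
    proof (cases "s - 2 * of_int i < 1"; cases "t - 2 * of_int i < 1")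
      assume "s - 2 * of_int i < 1" "\<not> t - 2 * of_int i < 1"
      then have "wave s = s - 2 * of_int i" "wave t = 2 - (t - 2 * of_int i)" using w j by auto
      then have "p \<ge> 3 / 4" "q \<ge> 3 / 4"
        using assms \<open>s - 2 * of_int i < 1\<close> \<open>\<not> t - 2 * of_int i < 1\<close> by linarith+
      then show ?thesis using ph j \<open>s - 2 * of_int i < 1\<close> \<open>\<not> t - 2 * of_int i < 1\<close> by simp
    next
      assume "\<not> s - 2 * of_int i < 1" "t - 2 * of_int i < 1"
      then show ?thesis using assms by linarith
    qed (use ph j clamp in auto)
  next
    assume j: "j = i + 1"
    have "\<not> s - 2 * of_int i < 1" "t - 2 * of_int j < 1" using assms fs j by auto
    moreover from this have "wave s = 2 - (s - 2 * of_int i)" "wave t = t - 2 * of_int j" using w by auto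
    moreover have "real_of_int j = of_int i + 1" using j by simp
    ultimately have "q \<le> 1 / 4" using assms fs by linarith
    with \<open>\<not> s - 2 * of_int i < 1\<close> \<open>t - 2 * of_int j < 1\<close>
    show ?thesis using ph j by simp
  qed
  then show "\<bar>phase s p - phase t q\<bar> \<le> 2 * \<bar>p - q\<bar>" "\<bar>phase s p - phase t q\<bar> \<le> 1" by auto
qed

lemma phase_lipschitz:
  assumes "\<bar>s - t\<bar> \<le> 1 / 8" "\<bar>p - wave s\<bar> \<le> 1 / 8" "\<bar>q - wave t\<bar> \<le> 1 / 8"
  shows "\<bar>phase s p - phase t q\<bar> \<le> 2 * \<bar>p - q\<bar>" "\<bar>phase s p - phase t q\<bar> \<le> 1"
proof -
  have "\<bar>phase s p - phase t q\<bar> \<le> 2 * \<bar>p - q\<bar> \<and> \<bar>phase s p - phase t q\<bar> \<le> 1"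
  proof (cases "s \<le> t")
    case True
    then show ?thesis using phase_lipschitz_aux[of s t p q] assms by simp
  next
    case False
    then show ?thesis using phase_lipschitz_aux[of t s q p] assms
      by (simp add: abs_minus_commute[of "phase s p"] abs_minus_commute[of p])
  qed
  then show "\<bar>phase s p - phase t q\<bar> \<le> 2 * \<bar>p - q\<bar>" "\<bar>phase s p - phase t q\<bar> \<le> 1" by auto
qed

lemma phase_upper: "phase s p \<le> s / 2 + 1"
  using floor_half[of s] by (auto simp: phase_def min_def)

lemma phase_lower: "2 * real n \<le> s \<Longrightarrow> real n \<le> phase s p"
proof -
  assume "2 * real n \<le> s"
  then have "int n \<le> \<lfloor>s / 2\<rfloor>" by (simp add: le_floor_iff)
  then have "real n \<le> of_int \<lfloor>s / 2\<rfloor>" by linarith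
  then show ?thesis by (auto simp: phase_def)
qed

text \<open>A Markov kernel whose iterates obey the upper tail bound contained in \<open>HKP(\<alpha>,\<beta>)\<close>.\<close>
locale tight_kernel = jump_kernel d m \<alpha> CV k kB \<beta> CJ
  for d :: "'a \<Rightarrow> 'a \<Rightarrow> nat" and m :: "'a \<Rightarrow> real" and \<alpha> CV :: real
    and k :: "'a \<Rightarrow> 'a \<Rightarrow> real" and kB \<beta> CJ :: real +
  fixes T :: real
  assumes T_pos: "T > 0"
    and tight: "1 \<le> n \<Longrightarrow> 1 \<le> s \<Longrightarrow>
      (kop ^^ n) (indicator {y. s < real (d x y)}) x \<le> T * real n * s powr - \<beta>"
begin

text \<open>Up to time \<open>c0 * r powr \<beta>\<close> the walk is further than
  \<open>r / 16\<close> away with probability at most 1/32. For a function of slope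
  \<open>1 / r\<close> the averaging error is then at most 1/16 + 1/32, below the tolerance 1/8 of
  \<open>phase_lipschitz\<close>.\<close>

definition c0 :: real where
  "c0 = 1 / (32 * T * 16 powr \<beta>)"

lemma c0_pos: "c0 > 0"
  using T_pos by (simp add: c0_def)

lemma tight_c0:
  assumes "16 \<le> r" "real n \<le> c0 * r powr \<beta>" "1 \<le> n"
  shows "(kop ^^ n) (indicator {y. r / 16 < real (d x y)}) x \<le> 1 / 32"
proof -
  have "(kop ^^ n) (indicator {y. r / 16 < real (d x y)}) x \<le> T * real n * (r / 16) powr - \<beta>"
    using assms by (intro tight) auto
  also have "\<dots> \<le> T * (c0 * r powr \<beta>) * (r / 16) powr - \<beta>"
    using T_pos assms by (intro mult_right_mono mult_left_mono) auto
  also have "(r / 16) powr - \<beta> = 16 powr \<beta> / r powr \<beta>"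
    using assms by (simp add: powr_minus_divide powr_divide)
  also have "T * (c0 * r powr \<beta>) * (16 powr \<beta> / r powr \<beta>) = 1 / 32"
    using assms T_pos by (simp add: c0_def)
  finally show ?thesis .
qed

lemma ces_lipschitz_approx:
  assumes r: "16 \<le> r" and n: "1 \<le> n" "real n \<le> c0 * r powr \<beta>"
    and g: "\<And>x. 0 \<le> g x" "\<And>x. g x \<le> 1" "\<And>x y. \<bar>g x - g y\<bar> \<le> real (d x y) / r"
  shows "\<bar>ces n g x - g x\<bar> \<le> 1 / 8"
proof (rule ces_approx[OF _ n(1)])
  fix j assume j: "j < n"
  show "\<bar>(kop ^^ j) g x - g x\<bar> \<le> 1 / 8"
  proof (cases "j = 0")
    case False
    let ?h = "indicator {y. r / 16 < real (d x y)} :: 'a \<Rightarrow> real"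
    have "\<bar>(kop ^^ j) g x - g x\<bar> \<le> 1 / 16 + 1 * (kop ^^ j) ?h x"
    proof (rule funpow_kop_diff_le)
      show "\<bar>g y\<bar> \<le> 1" for y using g(1,2)[of y] by simp
      show "\<bar>?h y\<bar> \<le> 1" for y by (simp add: indicator_def)
      show "\<bar>g y - g x\<bar> \<le> 1 / 16 + 1 * ?h y" for y
      proof (cases "r / 16 < real (d x y)")
        case True
        moreover have "\<bar>g y - g x\<bar> \<le> 1" using g(1,2)[of y] g(1,2)[of x] by linarith
        ultimately show ?thesis by simp
      next
        case False
        then have "real (d y x) / r \<le> 1 / 16" using r by (simp add: d_commute[of y] field_simps)
        with g(3)[of y x] have "\<bar>g y - g x\<bar> \<le> 1 / 16" by linarith
        then show ?thesis using False by simp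
      qed
    qed (use False in simp)
    moreover have "(kop ^^ j) ?h x \<le> 1 / 32"
      using j False n r by (intro tight_c0) auto
    ultimately show ?thesis by simp
  qed simp
qed

lemma ces_indicator_ge:
  assumes r: "16 \<le> r" and n: "1 \<le> n" "real n \<le> c0 * r powr \<beta>" and y: "real (d x y) + r \<le> R"
  shows "1 / 2 \<le> ces n (indicator (cb x R)) y"
proof -
  have "\<bar>ces n (indicator (cb x R)) y - 1\<bar> \<le> 1 / 2"
  proof (rule ces_approx[OF _ n(1)])
    fix j assume j: "j < n"
    show "\<bar>(kop ^^ j) (indicator (cb x R)) y - 1\<bar> \<le> 1 / 2"
    proof (cases "j = 0")
      case True
      then show ?thesis using y r by (simp add: in_cb)
    next
      case False
      let ?h = "indicator {z. r / 16 < real (d y z)} :: 'a \<Rightarrow> real"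
      have "\<bar>(kop ^^ j) (indicator (cb x R)) y - 1\<bar> \<le> 0 + 1 * (kop ^^ j) ?h y"
      proof (rule funpow_kop_diff_le)
        show "\<bar>indicator (cb x R) z - 1\<bar> \<le> 0 + 1 * ?h z" for z
          using d_triangle_real[of x z y] y r by (auto simp: indicator_def in_cb)
      qed (use False in \<open>auto simp: indicator_def\<close>)
      moreover have "(kop ^^ j) ?h y \<le> 1 / 32"
        using j False n r by (intro tight_c0) auto
      ultimately show ?thesis by simp
    qed
  qed
  then show ?thesis by linarith
qed

lemma indicator_cb_l1:
  "(\<lambda>y. indicator (cb x R) y * m y) summable_on UNIV"
  "(\<Sum>\<^sub>\<infinity>y. indicator (cb x R) y * m y) = sum m (cb x R)"
proof -
  have "((\<lambda>y. indicator (cb x R) y * m y) has_sum (\<Sum>y\<in>cb x R. indicator (cb x R) y * m y)) (cb x R)"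
    by (rule has_sum_finite[OF finite_cb])
  then have "((\<lambda>y. indicator (cb x R) y * m y) has_sum sum m (cb x R)) UNIV"
    by (subst (asm) has_sum_cong_neutral[where T = UNIV and g = "\<lambda>y. indicator (cb x R) y * m y"])
       (auto simp: indicator_def intro!: sum.cong)
  then show "(\<lambda>y. indicator (cb x R) y * m y) summable_on UNIV"
    "(\<Sum>\<^sub>\<infinity>y. indicator (cb x R) y * m y) = sum m (cb x R)"
    by (rule has_sum_imp_summable, rule infsumI)
qed

lemma ces_cutoff_sobolev:
  assumes n: "1 \<le> n" and g: "\<And>x. 0 \<le> g x" "\<And>x. g x \<le> 1"
    and f: "(\<lambda>x. (f x)\<^sup>2 * m x) summable_on UNIV"
  shows "dsum (\<lambda>x y. (f x)\<^sup>2 * (ces n g x - ces n g y)\<^sup>2)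
    \<le> 4 * dsum (\<lambda>x y. (f x - f y)\<^sup>2) + 8 / real n * (\<Sum>\<^sub>\<infinity>x. (f x)\<^sup>2 * m x)"
proof -
  have g1: "\<bar>g x\<bar> \<le> 1" for x using g[of x] by simp
  have "dsum (\<lambda>x y. (f x)\<^sup>2 * (ces n g x - ces n g y)\<^sup>2)
    \<le> 4 * dsum (\<lambda>x y. (f x - f y)\<^sup>2) + 4 * (2 / real n) * (\<Sum>\<^sub>\<infinity>x. (f x)\<^sup>2 * m x)"
  proof (rule cutoff_sobolev[OF f])
    show "\<bar>ces n g x\<bar> \<le> 1" for x by (rule abs_ces_le[OF g1 n])
    show "\<bar>ces n g x - kop (ces n g) x\<bar> \<le> 2 / real n" for x
    proof -
      have "\<bar>(kop ^^ n) g x\<bar> \<le> 1" by (rule abs_funpow_kop_le[OF g1])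
      then have "\<bar>g x - (kop ^^ n) g x\<bar> \<le> 2" using g1[of x] by linarith
      moreover have "ces n g x - kop (ces n g) x = (g x - (kop ^^ n) g x) / real n"
        by (rule ces_minus_kop[OF g1 n])
      ultimately show ?thesis by (simp add: abs_divide divide_right_mono)
    qed
  qed
  then show ?thesis by simp
qed

text \<open>The cutoff Sobolev inequality is applied to \<open>\<xi>\<close>, a substitute for the
  indicator of a ball: it is at least 1 well inside by \<open>ces_indicator_ge\<close>, and unlike a
  sharp indicator it has energy of order volume over \<open>n\<close> by
  \<open>ces_energy\<close>.\<close>

lemma cutoff_gradient_total:
  fixes x0 :: 'a and R :: real
  assumes n: "1 \<le> n" and g: "\<And>x. 0 \<le> g x" "\<And>x. g x \<le> 1"
  defines "\<xi> \<equiv> \<lambda>x. 2 * ces n (indicator (cb x0 R)) x"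
  shows "(\<lambda>x. (\<xi> x)\<^sup>2 * m x) summable_on UNIV"
    and "dsum (\<lambda>x y. (\<xi> x)\<^sup>2 * (ces n g x - ces n g y)\<^sup>2) \<le> 64 / real n * sum m (cb x0 R)"
proof -
  let ?I = "indicator (cb x0 R) :: 'a \<Rightarrow> real"
  let ?c = "ces n ?I"
  have I: "0 \<le> ?I x" "?I x \<le> 1" "\<bar>?I x\<bar> \<le> 1" for x by (auto simp: indicator_def)
  have c: "0 \<le> ?c x" "?c x \<le> 1" for x
  proof -
    show "0 \<le> ?c x" unfolding ces_def
      by (intro divide_nonneg_nonneg sum_nonneg funpow_kop_nonneg I(1)) simp
    have "\<bar>?c x\<bar> \<le> 1" by (rule abs_ces_le[OF I(3) n])
    then show "?c x \<le> 1" by simp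
  qed
  note l1 = ces_l1[OF indicator_cb_l1(1) I(1) n]
  note l2 = l2_of_bounded_l1[of ?c m UNIV 1, OF l1(1) c m_nonneg]
  have l2le: "(\<Sum>\<^sub>\<infinity>x. (?c x)\<^sup>2 * m x) \<le> sum m (cb x0 R)"
    using l2(2) l1(2) unfolding indicator_cb_l1(2) by simp
  have en: "dsum (\<lambda>x y. (?c x - ?c y)\<^sup>2) \<le> 2 / real n * sum m (cb x0 R)"
    using ces_energy[OF indicator_cb_l1(1) I(1,2) n] unfolding indicator_cb_l1(2) .
  have sq: "(\<xi> x)\<^sup>2 * m x = 4 * ((?c x)\<^sup>2 * m x)" for x by (simp add: \<xi>_def power2_eq_square)
  show \<xi>2: "(\<lambda>x. (\<xi> x)\<^sup>2 * m x) summable_on UNIV"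
    unfolding sq by (rule summable_on_cmult_right[OF l2(1)])
  have 1: "(\<Sum>\<^sub>\<infinity>x. (\<xi> x)\<^sup>2 * m x) = 4 * (\<Sum>\<^sub>\<infinity>x. (?c x)\<^sup>2 * m x)"
    unfolding sq by (rule infsum_cmult_right')
  have "(\<lambda>x y. (\<xi> x - \<xi> y)\<^sup>2) = (\<lambda>x y. 4 * (?c x - ?c y)\<^sup>2)"
    by (auto simp: \<xi>_def fun_eq_iff power2_eq_square algebra_simps)
  then have 2: "dsum (\<lambda>x y. (\<xi> x - \<xi> y)\<^sup>2) = 4 * dsum (\<lambda>x y. (?c x - ?c y)\<^sup>2)"
    by (simp add: dsum_cmult)
  have "dsum (\<lambda>x y. (\<xi> x)\<^sup>2 * (ces n g x - ces n g y)\<^sup>2)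
      \<le> 4 * (4 * dsum (\<lambda>x y. (?c x - ?c y)\<^sup>2)) + 8 / real n * (4 * (\<Sum>\<^sub>\<infinity>x. (?c x)\<^sup>2 * m x))"
    using ces_cutoff_sobolev[OF n g \<xi>2] unfolding 1 2 .
  also have "\<dots> \<le> 4 * (4 * (2 / real n * sum m (cb x0 R))) + 8 / real n * (4 * sum m (cb x0 R))"
    by (intro add_mono mult_left_mono en l2le) auto
  finally show "dsum (\<lambda>x y. (\<xi> x)\<^sup>2 * (ces n g x - ces n g y)\<^sup>2) \<le> 64 / real n * sum m (cb x0 R)"
    by simp
qed

end

text \<open>A Caccioppoli estimate with test function \<open>h * w\<^sup>2\<close>, based on the
  identity \<open>h x * h y * (w x - w y)\<^sup>2 = (f x - f y)\<^sup>2 - (h x - h y) * (h x * (w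
  x)\<^sup>2 - h y * (w y)\<^sup>2)\<close>. The discount \<open>q\<close> yields the zero order
  term on the left, which later absorbs errors of order one over the time horizon.\<close>

lemma (in symmetric_kernel) subsolution_energy:
  assumes q: "0 < q" "q \<le> 1" and h: "\<And>x. 0 \<le> h x" "\<And>x. h x \<le> 1"
    and w: "finite {x. w x \<noteq> 0}"
    and sub: "\<And>x. w x \<noteq> 0 \<Longrightarrow> h x \<le> q * kop h x"
  defines "f \<equiv> \<lambda>x. h x * w x"
  shows "2 * (1 - q) / q * (\<Sum>\<^sub>\<infinity>x. (f x)\<^sup>2 * m x) + dsum (\<lambda>x y. (f x - f y)\<^sup>2)
    \<le> dsum (\<lambda>x y. h x * h y * (w x - w y)\<^sup>2)"
proof -
  have fin: "(\<lambda>x. F x) summable_on UNIV" if "\<And>x. w x = 0 \<Longrightarrow> F x = 0" for F :: "'a \<Rightarrow> real"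
    using summable_on_cong_neutral[of "{x. w x \<noteq> 0}" UNIV F F] that summable_on_finite[OF w] by auto
  let ?G = "\<lambda>x. h x * (w x)\<^sup>2"
  have h1: "\<bar>h x\<bar> \<le> 1" for x using h[of x] by simp
  have G: "(\<lambda>x. ?G x * m x) summable_on UNIV" by (rule fin) simp
  have f2: "(\<lambda>x. (f x)\<^sup>2 * m x) summable_on UNIV" unfolding f_def by (rule fin) simp
  note bp = dsum_by_parts[OF G h1]
  have D: "dsummable (\<lambda>x y. (f x - f y)\<^sup>2)" by (rule dsummable_sq_diff[OF f2])
  have eq: "(\<lambda>x y. h x * h y * (w x - w y)\<^sup>2) = (\<lambda>x y. (f x - f y)\<^sup>2 + (-1) * ((h x - h y) * (?G x - ?G y)))"
    by (auto simp: fun_eq_iff f_def power2_eq_square algebra_simps)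
  have 1: "dsum (\<lambda>x y. h x * h y * (w x - w y)\<^sup>2)
      = dsum (\<lambda>x y. (f x - f y)\<^sup>2) - 2 * (\<Sum>\<^sub>\<infinity>x. ?G x * (kop (\<lambda>_. 1) x * h x - kop h x) * m x)"
    unfolding eq dsum_add[OF D dsummable_cmult[OF bp(1)]] dsum_cmult bp(2) by simp
  have le: "?G x * (kop (\<lambda>_. 1) x * h x - kop h x) * m x \<le> - ((1 - q) / q) * ((f x)\<^sup>2 * m x)" for x
  proof (cases "w x = 0")
    case False
    have "kop (\<lambda>_. 1) x * h x \<le> 1 * h x" by (intro mult_right_mono h kop_const_le) simp
    moreover have "h x / q \<le> kop h x" using sub[OF False] q by (simp add: field_simps)
    ultimately have "kop (\<lambda>_. 1) x * h x - kop h x \<le> h x - h x / q" by simp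
    also have "\<dots> = - ((1 - q) / q) * h x" using q by (simp add: field_simps)
    finally have "?G x * (kop (\<lambda>_. 1) x * h x - kop h x) \<le> ?G x * (- ((1 - q) / q) * h x)"
      using h by (intro mult_left_mono) auto
    from mult_right_mono[OF this m_nonneg[of x]] show ?thesis
      by (simp add: f_def power2_eq_square mult_ac)
  qed (simp add: f_def)
  have 2: "(\<Sum>\<^sub>\<infinity>x. ?G x * (kop (\<lambda>_. 1) x * h x - kop h x) * m x)
      \<le> (\<Sum>\<^sub>\<infinity>x. - ((1 - q) / q) * ((f x)\<^sup>2 * m x))"
    by (rule infsum_mono[OF _ summable_on_cmult_right[OF f2] le]) (rule fin, simp)
  have 3: "(\<Sum>\<^sub>\<infinity>x. - ((1 - q) / q) * ((f x)\<^sup>2 * m x)) = - ((1 - q) / q) * (\<Sum>\<^sub>\<infinity>x. (f x)\<^sup>2 * m x)"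
    by (rule infsum_cmult_right')
  have "2 * (1 - q) / q * (\<Sum>\<^sub>\<infinity>x. (f x)\<^sup>2 * m x) = - (2 * (- ((1 - q) / q) * (\<Sum>\<^sub>\<infinity>x. (f x)\<^sup>2 * m x)))"
    by simp
  then show ?thesis using 1 2 unfolding 3 by linarith
qed

section \<open>Weighted energy estimate for the second kernel\<close>

text \<open>The product \<open>exp a * exp b\<close> replaces the larger square, at the cost of a
  factor \<open>exp 1 \<le> 3\<close>; it pairs with the factor \<open>h x * h y\<close> of the
  energy estimate.\<close>

lemma exp_diff_square_le:
  fixes a b :: real
  assumes "\<bar>a - b\<bar> \<le> 1"
  shows "(exp a - exp b)\<^sup>2 \<le> 3 * (a - b)\<^sup>2 * (exp a * exp b)"
proof -
  have *: "(exp a - exp b)\<^sup>2 \<le> 3 * (a - b)\<^sup>2 * (exp a * exp b)" if "b \<le> a" "a - b \<le> 1" for a b :: real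
  proof -
    have "1 - exp (- (a - b)) \<le> a - b" using exp_ge_add_one_self[of "- (a - b)"] by linarith
    from mult_left_mono[OF this, of "exp a"] have "exp a - exp b \<le> exp a * (a - b)"
      by (simp add: right_diff_distrib flip: exp_add)
    moreover have "0 \<le> exp a - exp b" using that by simp
    ultimately have "(exp a - exp b)\<^sup>2 \<le> (exp a * (a - b))\<^sup>2" by (intro power_mono)
    also have "\<dots> = (a - b)\<^sup>2 * (exp a * exp b) * exp (a - b)"
      by (simp add: power2_eq_square mult_ac flip: exp_add)
    also have "\<dots> \<le> (a - b)\<^sup>2 * (exp a * exp b) * 3"
    proof (rule mult_left_mono)
      have "exp (a - b) \<le> exp 1" using that by simp
      also have "\<dots> \<le> 3" by (rule exp_le)
      finally show "exp (a - b) \<le> 3" .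
    qed simp
    finally show ?thesis by (simp add: mult_ac)
  qed
  show ?thesis
  proof (cases "b \<le> a")
    case True
    then show ?thesis using *[of b a] assms by simp
  next
    case False
    then have "(exp b - exp a)\<^sup>2 \<le> 3 * (b - a)\<^sup>2 * (exp b * exp a)" using assms by (intro *) auto
    then show ?thesis by (simp add: power2_commute[of "exp b"] power2_commute[of b] mult.commute)
  qed
qed

lemma dsum_compare:
  assumes k: "symmetric_kernel m k" "symmetric_kernel m k'"
    and F: "symmetric_kernel.dsummable m k F" and G: "symmetric_kernel.dsummable m k' G"
    and le: "\<And>x y. F x y * k x y \<le> G x y * k' x y"
  shows "symmetric_kernel.dsum m k F \<le> symmetric_kernel.dsum m k' G"
proof -
  interpret one: symmetric_kernel m k by (rule k)
  interpret two: symmetric_kernel m k' by (rule k)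
  show ?thesis unfolding one.dsum_def two.dsum_def
  proof (rule infsum_mono)
    show "(\<lambda>(x, y). F x y * (k x y * m x * m y)) summable_on UNIV"
      using F unfolding one.dsummable_def .
    show "(\<lambda>(x, y). G x y * (k' x y * m x * m y)) summable_on UNIV"
      using G unfolding two.dsummable_def .
    fix q :: "'a \<times> 'a"
    show "(case q of (x, y) \<Rightarrow> F x y * (k x y * m x * m y))
        \<le> (case q of (x, y) \<Rightarrow> G x y * (k' x y * m x * m y))"
    proof (cases q)
      case (Pair x y)
      have "F x y * k x y * (m x * m y) \<le> G x y * k' x y * (m x * m y)"
        by (intro mult_right_mono le) (simp add: one.m_nonneg)
      then show ?thesis using Pair by (simp add: mult_ac)
    qed
  qed
qed

context jump_kernel
begin

definition trunc :: "real \<Rightarrow> 'a \<Rightarrow> 'a \<Rightarrow> real" where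
  "trunc \<rho> x y = (if real (d x y) \<le> \<rho> then k x y else 0)"

lemma symmetric_kernel_trunc: "symmetric_kernel m (trunc \<rho>)"
proof unfold_locales
  fix x y
  show "0 \<le> m x" by (rule m_nonneg)
  show "0 \<le> trunc \<rho> x y" by (simp add: trunc_def k_nonneg)
  show "trunc \<rho> x y = trunc \<rho> y x" unfolding trunc_def d_commute[of x y] k_sym[of x y] ..
  have le: "\<bar>trunc \<rho> x y * m y\<bar> \<le> k x y * m y" for y by (simp add: trunc_def k_nonneg m_nonneg)
  show s: "(\<lambda>y. trunc \<rho> x y * m y) summable_on UNIV" by (rule summable_on_bound[OF k_summable le])
  have "(\<Sum>\<^sub>\<infinity>y. trunc \<rho> x y * m y) \<le> (\<Sum>\<^sub>\<infinity>y. k x y * m y)"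
    by (rule infsum_mono[OF s k_summable]) (rule order_trans[OF abs_ge_self le])
  then show "(\<Sum>\<^sub>\<infinity>y. trunc \<rho> x y * m y) \<le> 1" by (simp add: k_mass1)
qed

lemma dsum_far:
  assumes f: "(\<lambda>x. (f x)\<^sup>2 * m x) summable_on UNIV" and \<rho>: "1 \<le> \<rho>"
  shows "dsummable (\<lambda>x y. (f x)\<^sup>2 * indicator {y. \<rho> < real (d x y)} y)"
    and "dsum (\<lambda>x y. (f x)\<^sup>2 * indicator {y. \<rho> < real (d x y)} y)
      \<le> CJ * CT \<beta> * \<rho> powr - \<beta> * (\<Sum>\<^sub>\<infinity>x. (f x)\<^sup>2 * m x)"
proof -
  let ?F = "\<lambda>x y. (f x)\<^sup>2 * indicator {y. \<rho> < real (d x y)} y"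
  show F: "dsummable ?F"
    by (rule dsummable_bound[OF dsummable_left[OF f]]) (auto simp: indicator_def)
  let ?c = "CJ * CT \<beta> * \<rho> powr - \<beta>"
  have "(\<Sum>\<^sub>\<infinity>y. ?F x y * (k x y * m x * m y)) \<le> ?c * ((f x)\<^sup>2 * m x)" for x
  proof -
    have "(\<Sum>\<^sub>\<infinity>y. ?F x y * (k x y * m x * m y))
      = (\<Sum>\<^sub>\<infinity>y. ((f x)\<^sup>2 * m x) * (indicator {y. \<rho> < real (d x y)} y * (k x y * m y)))"
      by (simp only: mult_ac)
    also have "\<dots> = ((f x)\<^sup>2 * m x) * kop (indicator {y. \<rho> < real (d x y)}) x"
      unfolding kop_def by (rule infsum_cmult_right')
    also have "\<dots> \<le> ((f x)\<^sup>2 * m x) * ?c"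
      by (intro mult_left_mono kop_tail \<rho>) (simp add: m_nonneg)
    finally show ?thesis by (simp only: mult_ac)
  qed
  then have "dsum ?F \<le> (\<Sum>\<^sub>\<infinity>x. ?c * ((f x)\<^sup>2 * m x))"
    unfolding dsum_fubini(3)[OF F]
    by (intro infsum_mono dsum_fubini(2)[OF F] summable_on_cmult_right f)
  also have "\<dots> = ?c * (\<Sum>\<^sub>\<infinity>x. (f x)\<^sup>2 * m x)" by (rule infsum_cmult_right')
  finally show "dsum ?F \<le> ?c * (\<Sum>\<^sub>\<infinity>x. (f x)\<^sup>2 * m x)" .
qed

end

section \<open>Comparison of the quadratic forms of two kernels\<close>

locale two_kernels = ahlfors d m \<alpha> CV + one: tight_kernel d m \<alpha> CV k1 kB1 \<beta> CJ1 T
    + two: jump_kernel d m \<alpha> CV k2 kB2 \<beta> CJ2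
  for d :: "'a \<Rightarrow> 'a \<Rightarrow> nat" and m :: "'a \<Rightarrow> real" and \<alpha> CV :: real
    and k1 :: "'a \<Rightarrow> 'a \<Rightarrow> real" and kB1 \<beta> CJ1 T :: real
    and k2 :: "'a \<Rightarrow> 'a \<Rightarrow> real" and kB2 CJ2 :: real
begin

definition kratio :: real where "kratio = max 1 (CJ1 * CJ2)"

lemma kratio_ge_1: "1 \<le> kratio"
  by (simp add: kratio_def)

lemma kernel_compare: "k2 x y \<le> kratio * k1 x y" "k1 x y \<le> kratio * k2 x y"
proof -
  let ?w = "(1 + real (d x y)) powr - (\<alpha> + \<beta>)"
  have "k2 x y \<le> CJ2 * ?w" "k1 x y \<le> CJ1 * ?w" "?w \<le> CJ1 * k1 x y" "?w \<le> CJ2 * k2 x y"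
    using two.k_upper[of x y] one.k_upper[of x y] one.k_lower[of x y] two.k_lower[of x y]
      one.CJ_pos two.CJ_pos by (simp_all add: field_simps)
  then have "k2 x y \<le> CJ2 * (CJ1 * k1 x y)" "k1 x y \<le> CJ1 * (CJ2 * k2 x y)"
    using one.CJ_pos two.CJ_pos by (meson mult_le_cancel_left_pos order_trans)+
  moreover have "CJ1 * CJ2 * k1 x y \<le> kratio * k1 x y" "CJ1 * CJ2 * k2 x y \<le> kratio * k2 x y"
    by (intro mult_right_mono one.k_nonneg two.k_nonneg; simp add: kratio_def)+
  ultimately show "k2 x y \<le> kratio * k1 x y" "k1 x y \<le> kratio * k2 x y" by (simp_all add: mult_ac)
qed

text \<open>Jumps up to \<open>\<rho>\<close> are compared kernel by kernel. The longer ones,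
  missing from the truncated kernel, are estimated by \<open>(f x - f y)\<^sup>2 \<le> 2 * (f
  x)\<^sup>2 + 2 * (f y)\<^sup>2\<close> and the jump tail, so they cost only a zero order
  term.\<close>

lemma energy_compare:
  assumes f: "(\<lambda>x. (f x)\<^sup>2 * m x) summable_on UNIV" and \<rho>: "1 \<le> \<rho>"
  shows "one.dsum (\<lambda>x y. (f x - f y)\<^sup>2) \<le> kratio * symmetric_kernel.dsum m (two.trunc \<rho>) (\<lambda>x y. (f x - f y)\<^sup>2)
    + 4 * CJ1 * CT \<beta> * \<rho> powr - \<beta> * (\<Sum>\<^sub>\<infinity>x. (f x)\<^sup>2 * m x)"
proof -
  interpret R: symmetric_kernel m "two.trunc \<rho>" by (rule two.symmetric_kernel_trunc)
  let ?D = "\<lambda>x y. (f x - f y)\<^sup>2" and ?I = "\<lambda>x y. indicator {y. \<rho> < real (d x y)} y :: real"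
  have sq: "?D x y \<le> 2 * (f x)\<^sup>2 + 2 * (f y)\<^sup>2" for x y
    using zero_le_power2[of "f x + f y"] by (simp add: power2_eq_square algebra_simps)
  note D1 = one.dsummable_sq_diff[OF f] and DR = R.dsummable_sq_diff[OF f]
  note far = one.dsum_far[OF f \<rho>]
  have far': "one.dsummable (\<lambda>x y. (f y)\<^sup>2 * ?I x y)"
      "one.dsum (\<lambda>x y. (f y)\<^sup>2 * ?I x y) = one.dsum (\<lambda>x y. (f x)\<^sup>2 * ?I x y)"
  proof -
    have "(\<lambda>x y. (f y)\<^sup>2 * ?I x y) = (\<lambda>x y. (\<lambda>x y. (f x)\<^sup>2 * ?I x y) y x)"
      by (auto simp: fun_eq_iff indicator_def d_commute)
    then show "one.dsummable (\<lambda>x y. (f y)\<^sup>2 * ?I x y)"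
      "one.dsum (\<lambda>x y. (f y)\<^sup>2 * ?I x y) = one.dsum (\<lambda>x y. (f x)\<^sup>2 * ?I x y)"
      using one.dsummable_swap[of "\<lambda>x y. (f x)\<^sup>2 * ?I x y"] one.dsum_swap[of "\<lambda>x y. (f x)\<^sup>2 * ?I x y"] far(1)
      by simp_all
  qed
  have near: "one.dsummable (\<lambda>x y. ?D x y * (1 - ?I x y))"
    by (rule one.dsummable_bound[OF D1]) (auto simp: indicator_def)
  have "one.dsum ?D \<le> one.dsum (\<lambda>x y. ?D x y * (1 - ?I x y) + (2 * ((f x)\<^sup>2 * ?I x y) + 2 * ((f y)\<^sup>2 * ?I x y)))"
  proof (rule one.dsum_mono[OF D1])
    show "one.dsummable (\<lambda>x y. ?D x y * (1 - ?I x y) + (2 * ((f x)\<^sup>2 * ?I x y) + 2 * ((f y)\<^sup>2 * ?I x y)))"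
      by (intro one.dsummable_add one.dsummable_cmult near far(1) far'(1))
    show "?D x y \<le> ?D x y * (1 - ?I x y) + (2 * ((f x)\<^sup>2 * ?I x y) + 2 * ((f y)\<^sup>2 * ?I x y))" for x y
      using sq[of x y] by (auto simp: indicator_def)
  qed
  also have "\<dots> = one.dsum (\<lambda>x y. ?D x y * (1 - ?I x y)) + 4 * one.dsum (\<lambda>x y. (f x)\<^sup>2 * ?I x y)"
    unfolding one.dsum_add[OF near one.dsummable_add[OF one.dsummable_cmult[OF far(1)] one.dsummable_cmult[OF far'(1)]]]
      one.dsum_add[OF one.dsummable_cmult[OF far(1)] one.dsummable_cmult[OF far'(1)]] one.dsum_cmult far'(2)
    by simp
  also have "one.dsum (\<lambda>x y. ?D x y * (1 - ?I x y)) \<le> R.dsum (\<lambda>x y. kratio * ?D x y)"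
  proof (rule dsum_compare[OF one.symmetric_kernel_axioms R.symmetric_kernel_axioms near R.dsummable_cmult[OF DR]])
    show "?D x y * (1 - ?I x y) * k1 x y \<le> kratio * ?D x y * two.trunc \<rho> x y" for x y
      using mult_left_mono[OF kernel_compare(2)[of x y], of "?D x y"]
      by (simp add: indicator_def two.trunc_def mult_ac)
  qed
  also have "R.dsum (\<lambda>x y. kratio * ?D x y) = kratio * R.dsum ?D" by (rule R.dsum_cmult)
  finally show ?thesis using far(2) by simp
qed

lemma gradient_compare:
  assumes f: "(\<lambda>x. (f x)\<^sup>2 * m x) summable_on UNIV" and \<psi>: "\<And>x. \<bar>\<psi> x\<bar> \<le> 1"
  shows "symmetric_kernel.dsum m (two.trunc \<rho>) (\<lambda>x y. (f x)\<^sup>2 * (\<psi> x - \<psi> y)\<^sup>2)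
    \<le> kratio * one.dsum (\<lambda>x y. (f x)\<^sup>2 * (\<psi> x - \<psi> y)\<^sup>2)"
proof -
  interpret R: symmetric_kernel m "two.trunc \<rho>" by (rule two.symmetric_kernel_trunc)
  let ?F = "\<lambda>x y. (f x)\<^sup>2 * (\<psi> x - \<psi> y)\<^sup>2"
  have "R.dsum ?F \<le> one.dsum (\<lambda>x y. kratio * ?F x y)"
  proof (rule dsum_compare[OF R.symmetric_kernel_axioms one.symmetric_kernel_axioms])
    show "R.dsummable ?F" by (rule R.dsummable_sq_mult_diff[OF f \<psi>])
    show "one.dsummable (\<lambda>x y. kratio * ?F x y)"
      by (rule one.dsummable_cmult[OF one.dsummable_sq_mult_diff[OF f \<psi>]])
    show "?F x y * two.trunc \<rho> x y \<le> kratio * ?F x y * k1 x y" for x y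
    proof -
      have "two.trunc \<rho> x y \<le> kratio * k1 x y"
        using kernel_compare(1)[of x y] kratio_ge_1 one.k_nonneg[of x y] by (simp add: two.trunc_def)
      from mult_left_mono[OF this, of "?F x y"] show ?thesis by (simp add: mult_ac)
    qed
  qed
  then show ?thesis unfolding one.dsum_cmult .
qed

text \<open>An exponential weight of small slope \<open>\<kappa>\<close> per layer of width \<open>2 r\<close> lets the gradient term be absorbed,
  whatever the constant in the cutoff Sobolev inequality.\<close>
lemma weighted_exit_estimate:
  obtains C4 \<kappa> :: real where "C4 > 0" "0 < \<kappa>"
    "\<And>x0 r N n' h. 16 \<le> r \<Longrightarrow> 2 \<le> n' \<Longrightarrow> 4 \<le> N \<Longrightarrow> C4 * real n' \<le> r powr \<beta> \<Longrightarrow>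
      2 \<le> exp (\<kappa> * real N / 2) \<Longrightarrow> (\<And>x. 0 \<le> h x \<and> h x \<le> 1) \<Longrightarrow>
      (\<And>x. x \<in> cb x0 (2 * r * real N) \<Longrightarrow>
         h x \<le> (1 - 1 / real n') * symmetric_kernel.kop m (two.trunc (r / 8)) h x) \<Longrightarrow>
      (\<Sum>y\<in>cb x0 (r * real N / 2). (h y)\<^sup>2 * m y)
        \<le> 8 * exp (- (\<kappa> * real N)) * sum m (cb x0 (2 * r * real N + 2 * r))"
proof
  \<comment> \<open>The first summand brings the long-jump term of \<open>energy_compare\<close> at
    radius \<open>r / 8\<close> below \<open>1 / n'\<close>; the second gives
    \<open>8 * n' \<le> c0 * r powr \<beta>\<close>, so that the averaged wave stays within 1/8 of
    the wave.\<close>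
  define C4 where "C4 = 16 * (CJ1 * CT \<beta>) * 8 powr \<beta> + 8 / one.c0"
  \<comment> \<open>The weight contributes \<open>24 * \<kappa>\<^sup>2\<close>, the cutoff Sobolev
    inequality 4, and the two comparisons \<open>kratio\<close> each; with
    \<open>96 * \<kappa>\<^sup>2 * kratio\<^sup>2 = 1\<close> the energy appears with coefficient 1
    on both sides and cancels.\<close>
  define \<kappa> where "\<kappa> = 1 / (sqrt 96 * kratio)"
  have CT0: "CT \<beta> > 0" by (rule CT_pos[OF one.\<beta>_pos])
  show "C4 > 0" using CT0 one.CJ_pos one.c0_pos by (simp add: C4_def add_pos_pos)
  show \<kappa>0: "0 < \<kappa>" using kratio_ge_1 by (simp add: \<kappa>_def)
  have \<kappa>2: "96 * \<kappa>\<^sup>2 * kratio\<^sup>2 = 1" using kratio_ge_1 by (simp add: \<kappa>_def power_divide power_mult_distrib)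
  have \<kappa>1: "\<kappa> \<le> 1"
  proof -
    have "1 * 1 \<le> sqrt 96 * kratio" using kratio_ge_1 by (intro mult_mono) auto
    then show ?thesis by (simp add: \<kappa>_def)
  qed
  fix x0 :: 'a and r :: real and N n' :: nat and h :: "'a \<Rightarrow> real"
  assume r: "16 \<le> r" and n': "2 \<le> n'" and N: "4 \<le> N" and C4: "C4 * real n' \<le> r powr \<beta>"
    and N2: "2 \<le> exp (\<kappa> * real N / 2)" and h: "\<And>x. 0 \<le> h x \<and> h x \<le> 1"
    and sub: "\<And>x. x \<in> cb x0 (2 * r * real N) \<Longrightarrow>
         h x \<le> (1 - 1 / real n') * symmetric_kernel.kop m (two.trunc (r / 8)) h x"
  interpret R: symmetric_kernel m "two.trunc (r / 8)" by (rule two.symmetric_kernel_trunc)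
  \<comment> \<open>With this averaging time the zero order coefficient \<open>8 / n\<close> of
    \<open>ces_cutoff_sobolev\<close> is \<open>1 / n'\<close>, comparable to the gain from the
    discount.\<close>
  define n where "n = 8 * n'"
  have n1: "1 \<le> n" using n' by (simp add: n_def)
  have "8 / one.c0 * real n' \<le> C4 * real n'"
    using CT0 one.CJ_pos by (intro mult_right_mono) (auto simp: C4_def)
  then have nc: "real n \<le> one.c0 * r powr \<beta>"
  proof -
    assume "8 / one.c0 * real n' \<le> C4 * real n'"
    then have "8 / one.c0 * real n' \<le> r powr \<beta>" using C4 by linarith
    then show ?thesis using one.c0_pos by (simp add: n_def field_simps)
  qed
  have r\<beta>: "16 * (CJ1 * CT \<beta>) * (r / 8) powr - \<beta> \<le> 1 / real n'"
  proof -
    have "16 * (CJ1 * CT \<beta>) * 8 powr \<beta> * real n' \<le> C4 * real n'"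
      using one.c0_pos by (intro mult_right_mono) (auto simp: C4_def)
    then have "16 * (CJ1 * CT \<beta>) * 8 powr \<beta> * real n' \<le> r powr \<beta>" using C4 by linarith
    moreover have "(r / 8) powr - \<beta> = 8 powr \<beta> / r powr \<beta>"
      using r by (simp add: powr_minus_divide powr_divide)
    moreover have "0 < r powr \<beta>" "0 < real n'" using r n' by auto
    moreover have "a * (b / c) \<le> 1 / e" if "a * b * e \<le> c" "0 < c" "0 < e" for a b c e :: real
      using that by (simp add: field_simps)
    ultimately show ?thesis by simp
  qed
  define g where "g = (\<lambda>x. wave (real (d x0 x) / r))"
  have g: "0 \<le> g x" "g x \<le> 1" for x by (simp_all add: g_def wave_bounds)
  have gl: "\<bar>g x - g y\<bar> \<le> real (d x y) / r" for x y
  proof -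
    have "\<bar>real (d x0 x) - real (d x0 y)\<bar> \<le> real (d x y)"
      using d_triangle_real[of x0 x y] d_triangle_real[of x0 y x] d_commute[of x y] by simp
    then have "\<bar>real (d x0 x) / r - real (d x0 y) / r\<bar> \<le> real (d x y) / r"
      using r by (simp add: abs_divide divide_right_mono flip: diff_divide_distrib)
    then show ?thesis unfolding g_def using wave_lipschitz order_trans by blast
  qed
  define \<psi> where "\<psi> = one.ces n g"
  have \<psi>1: "\<bar>\<psi> x\<bar> \<le> 1" for x
  proof -
    have "\<bar>g x\<bar> \<le> 1" for x using g[of x] by simp
    then show ?thesis unfolding \<psi>_def by (rule one.abs_ces_le[OF _ n1])
  qed
  have \<psi>g: "\<bar>\<psi> x - wave (real (d x0 x) / r)\<bar> \<le> 1 / 8" for x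
    using one.ces_lipschitz_approx[OF r n1 nc g gl, of x] by (simp add: \<psi>_def g_def)
  \<comment> \<open>The phase is at least \<open>N\<close> outside the ball of radius
    \<open>2 * r * N\<close>; the cap makes the weight constant there.\<close>
  define \<Theta> where "\<Theta> = (\<lambda>x. min (real N) (phase (real (d x0 x) / r) (\<psi> x)))"
  have \<Theta>_lip: "\<bar>\<Theta> x - \<Theta> y\<bar> \<le> 2 * \<bar>\<psi> x - \<psi> y\<bar>" "\<bar>\<Theta> x - \<Theta> y\<bar> \<le> 1" if "real (d x y) \<le> r / 8" for x y
  proof -
    have "\<bar>real (d x0 x) - real (d x0 y)\<bar> \<le> real (d x y)"
      using d_triangle_real[of x0 x y] d_triangle_real[of x0 y x] d_commute[of x y] by simp
    then have "\<bar>real (d x0 x) - real (d x0 y)\<bar> \<le> r / 8" using that by linarith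
    then have "\<bar>real (d x0 x) / r - real (d x0 y) / r\<bar> \<le> 1 / 8"
      using r by (simp add: abs_divide field_simps flip: diff_divide_distrib)
    note ph = phase_lipschitz[OF this \<psi>g \<psi>g]
    have "\<bar>\<Theta> x - \<Theta> y\<bar> \<le> \<bar>phase (real (d x0 x) / r) (\<psi> x) - phase (real (d x0 y) / r) (\<psi> y)\<bar>"
      unfolding \<Theta>_def by linarith
    then show "\<bar>\<Theta> x - \<Theta> y\<bar> \<le> 2 * \<bar>\<psi> x - \<psi> y\<bar>" "\<bar>\<Theta> x - \<Theta> y\<bar> \<le> 1" using ph by linarith+
  qed
  have \<Theta>N: "\<Theta> x = real N" if "x \<notin> cb x0 (2 * r * real N)" for x
  proof -
    have "2 * real N \<le> real (d x0 x) / r" using that r by (simp add: in_cb field_simps)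
    from phase_lower[OF this] show ?thesis by (simp add: \<Theta>_def)
  qed
  define W where "W = (\<lambda>x. exp (\<kappa> * (real N - \<Theta> x)))"
  \<comment> \<open>Subtracting 1 gives the weight finite support, as
    \<open>subsolution_energy\<close> requires, and leaves its differences unchanged.\<close>
  define w where "w = (\<lambda>x. W x - 1)"
  have W: "0 < W x" "1 \<le> W x" for x using \<kappa>0 by (auto simp: W_def \<Theta>_def)
  have w0: "0 \<le> w x" for x using W(2)[of x] by (simp add: w_def)
  have w_off: "w x = 0" if "x \<notin> cb x0 (2 * r * real N)" for x
    using \<Theta>N[OF that] by (simp add: w_def W_def)
  have w_fin: "finite {x. w x \<noteq> 0}"
    by (rule finite_subset[OF _ finite_cb[of x0 "2 * r * real N"]]) (use w_off in blast)
  define f where "f = (\<lambda>x. h x * w x)"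
  have fin: "(\<lambda>x. F x) summable_on UNIV" if "\<And>x. w x = 0 \<Longrightarrow> F x = 0" for F :: "'a \<Rightarrow> real"
    using summable_on_cong_neutral[of "{x. w x \<noteq> 0}" UNIV F F] that summable_on_finite[OF w_fin] by auto
  have f2: "(\<lambda>x. (f x)\<^sup>2 * m x) summable_on UNIV" by (rule fin) (simp add: f_def)
  have f0: "0 \<le> f x" for x using h[of x] w0[of x] by (simp add: f_def)
  define q where "q = 1 - 1 / real n'"
  have q: "0 < q" "q \<le> 1" using n' by (auto simp: q_def field_simps)
  \<comment> \<open>Compensates the subtracted 1: \<open>h * W = f + h \<le> f + \<xi>\<close>
    wherever \<open>\<xi> \<ge> 1\<close>, so the gradient term splits into one with
    \<open>f\<close>, to be absorbed, and one with \<open>\<xi>\<close>, bounded by volume.\<close>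
  define \<xi> where "\<xi> = (\<lambda>x. 2 * one.ces n (indicator (cb x0 (2 * r * real N + 2 * r))) x)"
  have \<xi>: "(\<lambda>x. (\<xi> x)\<^sup>2 * m x) summable_on UNIV"
      "one.dsum (\<lambda>x y. (\<xi> x)\<^sup>2 * (\<psi> x - \<psi> y)\<^sup>2)
        \<le> 64 / real n * sum m (cb x0 (2 * r * real N + 2 * r))"
    unfolding \<xi>_def \<psi>_def by (rule one.cutoff_gradient_total[OF n1 g])+
  define S where "S = (\<Sum>\<^sub>\<infinity>x. (f x)\<^sup>2 * m x)"
  define En where "En = R.dsum (\<lambda>x y. (f x - f y)\<^sup>2)"
  define V where "V = sum m (cb x0 (2 * r * real N + 2 * r))"
  have S0: "0 \<le> S" unfolding S_def by (intro infsum_nonneg) (simp add: m_ge_0)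
  have V0: "0 \<le> V" unfolding V_def by (intro sum_nonneg m_ge_0)
  let ?P = "\<lambda>x y. (f x)\<^sup>2 * (\<psi> x - \<psi> y)\<^sup>2" and ?Q = "\<lambda>x y. (\<xi> x)\<^sup>2 * (\<psi> x - \<psi> y)\<^sup>2"
  let ?F = "\<lambda>x y. h x * h y * (w x - w y)\<^sup>2"
  have P: "R.dsummable ?P" by (rule R.dsummable_sq_mult_diff[OF f2 \<psi>1])
  have Q: "R.dsummable ?Q" by (rule R.dsummable_sq_mult_diff[OF \<xi>(1) \<psi>1])
  have PQ: "R.dsummable (\<lambda>x y. ?P x y + ?Q x y)" by (rule R.dsummable_add[OF P Q])
  have PQ': "R.dsummable (\<lambda>x y. ?P y x + ?Q y x)"
    using PQ R.dsummable_swap[of "\<lambda>x y. ?P x y + ?Q x y"] by blast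
  have Fs: "R.dsummable ?F"
  proof (rule R.dsummableI)
    show "(\<lambda>x. 2 * (w x)\<^sup>2 * m x) summable_on UNIV" by (rule fin) simp
    show "\<bar>?F x y\<bar> \<le> 2 * (w x)\<^sup>2 + 2 * (w y)\<^sup>2" for x y
    proof -
      have "h x * h y \<le> 1 * 1" using h by (intro mult_mono) auto
      then have "h x * h y * (w x - w y)\<^sup>2 \<le> 1 * (w x - w y)\<^sup>2" by (intro mult_right_mono) auto
      also have "\<dots> \<le> 2 * (w x)\<^sup>2 + 2 * (w y)\<^sup>2"
        using zero_le_power2[of "w x + w y"] by (simp add: power2_eq_square algebra_simps)
      finally show ?thesis using h[of x] h[of y] by (simp add: abs_mult)
    qed
  qed
  have pt: "?F x y \<le> 12 * \<kappa>\<^sup>2 * ((?P x y + ?Q x y) + (?P y x + ?Q y x))" if kxy: "two.trunc (r / 8) x y \<noteq> 0" for x y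
  proof (cases "x \<in> cb x0 (2 * r * real N) \<or> y \<in> cb x0 (2 * r * real N)")
    case False
    then show ?thesis using w_off[of x] w_off[of y] by simp
  next
    case True
    have dxy: "real (d x y) \<le> r / 8" using kxy by (auto simp: two.trunc_def split: if_splits)
    have "real (d x0 x) + r \<le> 2 * r * real N + 2 * r" "real (d x0 y) + r \<le> 2 * r * real N + 2 * r"
      using True dxy r d_triangle_real[of x0 x y] d_triangle_real[of x0 y x] d_commute[of x y] by (auto simp: in_cb)
    then have \<xi>1: "1 \<le> \<xi> x" "1 \<le> \<xi> y"
      using one.ces_indicator_ge[OF r n1 nc] unfolding \<xi>_def by fastforce+
    have hW: "0 \<le> h z * W z" "(h z * W z)\<^sup>2 \<le> 2 * ((f z)\<^sup>2 + (\<xi> z)\<^sup>2)" if "1 \<le> \<xi> z" for z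
    proof -
      show 0: "0 \<le> h z * W z" using h[of z] W[of z] by simp
      have "h z * W z \<le> f z + \<xi> z" using h[of z] that by (simp add: f_def w_def algebra_simps)
      then have "(h z * W z)\<^sup>2 \<le> (f z + \<xi> z)\<^sup>2" using 0 by (intro power_mono)
      also have "\<dots> \<le> 2 * ((f z)\<^sup>2 + (\<xi> z)\<^sup>2)"
        using zero_le_power2[of "f z - \<xi> z"] by (simp add: power2_eq_square algebra_simps)
      finally show "(h z * W z)\<^sup>2 \<le> 2 * ((f z)\<^sup>2 + (\<xi> z)\<^sup>2)" .
    qed
    have k\<Theta>: "\<kappa> * (real N - \<Theta> x) - \<kappa> * (real N - \<Theta> y) = \<kappa> * (\<Theta> y - \<Theta> x)" by (simp add: algebra_simps)
    have "\<bar>\<kappa> * (\<Theta> y - \<Theta> x)\<bar> \<le> 1 * 1"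
      unfolding abs_mult using \<kappa>0 \<kappa>1 \<Theta>_lip(2)[OF dxy] by (intro mult_mono) auto
    then have "(W x - W y)\<^sup>2 \<le> 3 * (\<kappa> * (\<Theta> y - \<Theta> x))\<^sup>2 * (W x * W y)"
      using exp_diff_square_le[of "\<kappa> * (real N - \<Theta> x)" "\<kappa> * (real N - \<Theta> y)"] unfolding k\<Theta> W_def by simp
    also have "\<dots> \<le> 3 * (\<kappa> * (2 * (\<psi> x - \<psi> y)))\<^sup>2 * (W x * W y)"
    proof (intro mult_right_mono mult_left_mono)
      have "\<bar>\<kappa> * (\<Theta> y - \<Theta> x)\<bar> \<le> \<bar>\<kappa> * (2 * (\<psi> x - \<psi> y))\<bar>"
        unfolding abs_mult using \<Theta>_lip(1)[OF dxy] by (intro mult_left_mono) auto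
      then show "(\<kappa> * (\<Theta> y - \<Theta> x))\<^sup>2 \<le> (\<kappa> * (2 * (\<psi> x - \<psi> y)))\<^sup>2" by (simp only: abs_le_square_iff)
    qed (use W(1)[of x] W(1)[of y] in auto)
    also have "\<dots> = 12 * \<kappa>\<^sup>2 * (\<psi> x - \<psi> y)\<^sup>2 * (W x * W y)"
      unfolding power_mult_distrib by simp
    finally have "h x * h y * (W x - W y)\<^sup>2 \<le> h x * h y * (12 * \<kappa>\<^sup>2 * (\<psi> x - \<psi> y)\<^sup>2 * (W x * W y))"
      using h by (intro mult_left_mono) auto
    also have "\<dots> = 6 * \<kappa>\<^sup>2 * (\<psi> x - \<psi> y)\<^sup>2 * (2 * (h x * W x) * (h y * W y))" by simp
    also have "\<dots> \<le> 6 * \<kappa>\<^sup>2 * (\<psi> x - \<psi> y)\<^sup>2 * ((h x * W x)\<^sup>2 + (h y * W y)\<^sup>2)"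
      by (intro mult_left_mono sum_squares_bound) auto
    also have "\<dots> \<le> 6 * \<kappa>\<^sup>2 * (\<psi> x - \<psi> y)\<^sup>2 * (2 * ((f x)\<^sup>2 + (\<xi> x)\<^sup>2) + 2 * ((f y)\<^sup>2 + (\<xi> y)\<^sup>2))"
      by (intro mult_left_mono add_mono hW \<xi>1) auto
    also have "\<dots> = 12 * \<kappa>\<^sup>2 * ((?P x y + ?Q x y) + (?P y x + ?Q y x))"
      by (simp add: power2_commute[of "\<psi> y"] algebra_simps)
    finally show ?thesis by (simp add: w_def)
  qed
  have energy: "2 * (1 - q) / q * S + En \<le> R.dsum ?F"
    unfolding S_def En_def f_def
    by (rule R.subsolution_energy[OF q _ _ w_fin]) (use h w_off sub in \<open>auto simp: q_def\<close>)
  have "R.dsum ?F \<le> R.dsum (\<lambda>x y. 12 * \<kappa>\<^sup>2 * ((?P x y + ?Q x y) + (?P y x + ?Q y x)))"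
    by (rule R.dsum_mono[OF Fs R.dsummable_cmult[OF R.dsummable_add[OF PQ PQ']] pt])
  also have "\<dots> = 24 * \<kappa>\<^sup>2 * (R.dsum ?P + R.dsum ?Q)"
    unfolding R.dsum_cmult R.dsum_add[OF PQ PQ'] R.dsum_swap[of "\<lambda>x y. ?P x y + ?Q x y"] R.dsum_add[OF P Q] by simp
  finally have 1: "2 * (1 - q) / q * S + En \<le> 24 * \<kappa>\<^sup>2 * (R.dsum ?P + R.dsum ?Q)"
    using energy by linarith
  have "R.dsum ?P \<le> kratio * one.dsum ?P" by (rule gradient_compare[OF f2 \<psi>1])
  also have "\<dots> \<le> kratio * (4 * one.dsum (\<lambda>x y. (f x - f y)\<^sup>2) + 8 / real n * S)"
    unfolding \<psi>_def S_def using kratio_ge_1 by (intro mult_left_mono one.ces_cutoff_sobolev n1 g f2) auto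
  also have "\<dots> \<le> kratio * (4 * (kratio * En + 4 * CJ1 * CT \<beta> * (r / 8) powr - \<beta> * S) + 8 / real n * S)"
    unfolding S_def En_def using kratio_ge_1 r by (intro mult_left_mono add_right_mono energy_compare f2) auto
  also have "\<dots> = kratio * (4 * (kratio * En) + (16 * (CJ1 * CT \<beta>) * (r / 8) powr - \<beta>) * S + 8 / real n * S)"
    by (simp add: algebra_simps)
  also have "\<dots> \<le> kratio * (4 * (kratio * En) + 1 / real n' * S + 8 / real n * S)"
    using kratio_ge_1 S0 by (intro mult_left_mono add_right_mono add_left_mono mult_right_mono r\<beta>) auto
  also have "\<dots> = kratio * (4 * kratio * En + 2 / real n' * S)" by (simp add: n_def)
  finally have 2: "R.dsum ?P \<le> kratio * (4 * kratio * En + 2 / real n' * S)" .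
  have "R.dsum ?Q \<le> kratio * one.dsum ?Q" by (rule gradient_compare[OF \<xi>(1) \<psi>1])
  also have "\<dots> \<le> kratio * (64 / real n * V)"
    using \<xi>(2) kratio_ge_1 unfolding V_def by (intro mult_left_mono) auto
  finally have 3: "R.dsum ?Q \<le> kratio * (8 / real n' * V)" by (simp add: n_def)
  have "2 * (1 - q) / q * S + En \<le> 24 * \<kappa>\<^sup>2 * (kratio * (4 * kratio * En + 2 / real n' * S) + kratio * (8 / real n' * V))"
    using 1 mult_left_mono[OF add_mono[OF 2 3], of "24 * \<kappa>\<^sup>2"] by simp
  also have "\<dots> = (96 * \<kappa>\<^sup>2 * kratio\<^sup>2) * En + (96 * \<kappa>\<^sup>2 * kratio\<^sup>2) * ((2 / real n' * S + 8 / real n' * V) / (4 * kratio))"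
    using kratio_ge_1 by (simp add: power2_eq_square field_simps)
  also have "\<dots> = En + (2 / real n' * S + 8 / real n' * V) / (4 * kratio)" unfolding \<kappa>2 by simp
  also have "(2 / real n' * S + 8 / real n' * V) / (4 * kratio) \<le> (2 / real n' * S + 8 / real n' * V) / 4"
    using kratio_ge_1 S0 V0 by (intro divide_left_mono) auto
  finally have 4: "2 * (1 - q) / q * S \<le> (2 / real n' * S + 8 / real n' * V) / 4" by simp
  have "1 / real n' \<le> (1 - q) / q"
  proof -
    have "(1 - q) * 1 \<le> (1 - q) * (1 / q)" using q by (intro mult_left_mono) auto
    then show ?thesis by (simp add: q_def)
  qed
  then have "1 / real n' * S \<le> (1 - q) / q * S" using S0 by (rule mult_right_mono)
  moreover have "2 * (1 - q) / q * S = 2 * ((1 - q) / q * S)" by simp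
  ultimately have "2 * (1 / real n' * S) \<le> (2 / real n' * S + 8 / real n' * V) / 4"
    using 4 by linarith
  then have SV: "S \<le> 2 * V" using n' S0 V0 by (simp add: field_simps)
  \<comment> \<open>In the inner ball the phase is at most \<open>N / 4 + 1 \<le> N / 2\<close>, so
    half of the exponent is left; by \<open>N2\<close> passing from \<open>W\<close> to
    \<open>w = W - 1\<close> costs at most a factor 2.\<close>
  have low: "exp (\<kappa> * real N) / 4 * ((h y)\<^sup>2 * m y) \<le> (f y)\<^sup>2 * m y" if "y \<in> cb x0 (r * real N / 2)" for y
  proof -
    have "real (d x0 y) / r \<le> real N / 2" using that r by (simp add: in_cb field_simps)
    moreover have "4 \<le> real N" using N by simp
    moreover have "phase s p \<le> real N / 2" if "s \<le> real N / 2" "4 \<le> real N" for s p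
      using phase_upper[of s p] that by linarith
    ultimately have "phase (real (d x0 y) / r) (\<psi> y) \<le> real N / 2" by blast
    then have "\<Theta> y \<le> real N / 2" unfolding \<Theta>_def by linarith
    then have "\<kappa> * (real N / 2) \<le> \<kappa> * (real N - \<Theta> y)" using \<kappa>0 by (intro mult_left_mono) auto
    then have "exp (\<kappa> * real N / 2) \<le> W y" by (simp add: W_def)
    then have "exp (\<kappa> * real N / 2) / 2 \<le> w y" using N2 by (simp add: w_def)
    then have "(exp (\<kappa> * real N / 2) / 2)\<^sup>2 \<le> (w y)\<^sup>2" by (intro power_mono) auto
    moreover have "(exp (\<kappa> * real N / 2) / 2)\<^sup>2 = exp (\<kappa> * real N) / 4"
      by (simp add: power_divide power2_eq_square flip: exp_add)
    ultimately have "exp (\<kappa> * real N) / 4 \<le> (w y)\<^sup>2" by simp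
    from mult_right_mono[OF this, of "(h y)\<^sup>2 * m y"] show ?thesis
      using m_ge_0[of y] by (simp add: f_def power_mult_distrib mult_ac)
  qed
  have "exp (\<kappa> * real N) / 4 * (\<Sum>y\<in>cb x0 (r * real N / 2). (h y)\<^sup>2 * m y)
      \<le> (\<Sum>y\<in>cb x0 (r * real N / 2). (f y)\<^sup>2 * m y)"
    unfolding sum_distrib_left by (intro sum_mono low)
  also have "\<dots> \<le> S"
    unfolding S_def by (intro finite_sum_le_infsum f2 finite_cb) (auto simp: m_ge_0)
  also note SV
  finally have "exp (\<kappa> * real N) * (\<Sum>y\<in>cb x0 (r * real N / 2). (h y)\<^sup>2 * m y) \<le> 8 * V" by simp
  from mult_left_mono[OF this, of "exp (- (\<kappa> * real N))"]
  show "(\<Sum>y\<in>cb x0 (r * real N / 2). (h y)\<^sup>2 * m y)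
        \<le> 8 * exp (- (\<kappa> * real N)) * sum m (cb x0 (2 * r * real N + 2 * r))"
    by (simp add: V_def mult.assoc[symmetric] flip: exp_add)
qed

end

section \<open>Exit times\<close>

context symmetric_kernel
begin

text \<open>\<open>exit q B n x\<close> is \<open>E\<^sub>x[q\<^sup>\<tau>; \<tau> \<le> n]\<close> for the exit time \<open>\<tau>\<close> of \<open>B\<close>.\<close>
primrec exit :: "real \<Rightarrow> 'a set \<Rightarrow> nat \<Rightarrow> 'a \<Rightarrow> real" where
  "exit q B 0 = indicator (- B)"
| "exit q B (Suc n) = (\<lambda>x. if x \<in> B then q * kop (exit q B n) x else 1)"

lemma exit_bounds:
  assumes "0 \<le> q" "q \<le> 1"
  shows "0 \<le> exit q B n x" "exit q B n x \<le> 1"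
proof -
  have "0 \<le> exit q B n x \<and> exit q B n x \<le> 1"
  proof (induction n arbitrary: x)
    case (Suc n)
    have "0 \<le> kop (exit q B n) x" "kop (exit q B n) x \<le> 1"
      using Suc by (auto intro!: kop_nonneg kop_le)
    then have "0 \<le> q * kop (exit q B n) x" "q * kop (exit q B n) x \<le> 1 * 1"
      using assms by (intro mult_nonneg_nonneg mult_mono; simp)+
    then show ?case by simp
  qed (simp add: indicator_def)
  then show "0 \<le> exit q B n x" "exit q B n x \<le> 1" by auto
qed

lemma abs_exit_le: "0 \<le> q \<Longrightarrow> q \<le> 1 \<Longrightarrow> \<bar>exit q B n x\<bar> \<le> 1"
  using exit_bounds[of q B n x] by simp

lemma exit_off: "x \<notin> B \<Longrightarrow> exit q B n x = 1"
  by (cases n) auto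

lemma exit_Suc_mono:
  assumes "0 \<le> q" "q \<le> 1"
  shows "exit q B n x \<le> exit q B (Suc n) x"
proof (induction n arbitrary: x)
  case 0
  then show ?case using exit_bounds[OF assms, of B 1 x] by (auto simp: indicator_def)
next
  case (Suc n)
  have "kop (exit q B n) x \<le> kop (exit q B (Suc n)) x"
    by (rule kop_mono[OF abs_exit_le[OF assms] abs_exit_le[OF assms] Suc])
  then have "q * kop (exit q B n) x \<le> q * kop (exit q B (Suc n)) x"
    using assms(1) by (rule mult_left_mono)
  then show ?case by simp
qed

lemma exit_mono: "0 \<le> q \<Longrightarrow> q \<le> 1 \<Longrightarrow> i \<le> n \<Longrightarrow> exit q B i x \<le> exit q B n x"
  by (rule lift_Suc_mono_le[of "\<lambda>n. exit q B n x"]) (rule exit_Suc_mono)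

text \<open>Monotonicity in the horizon turns the recursion into an inequality at one fixed horizon,
  the form that \<open>subsolution_energy\<close> takes.\<close>

lemma exit_subsolution:
  assumes "0 \<le> q" "q \<le> 1" "x \<in> B"
  shows "exit q B n x \<le> q * kop (exit q B n) x"
  using exit_Suc_mono[OF assms(1,2), of B n x] assms(3) by simp

lemma exit_antimono:
  assumes "0 \<le> q" "q \<le> 1" "B \<subseteq> B'"
  shows "exit q B' n x \<le> exit q B n x"
proof (induction n arbitrary: x)
  case 0
  then show ?case using assms(3) by (auto simp: indicator_def)
next
  case (Suc n)
  show ?case
  proof (cases "x \<in> B")
    case True
    have "kop (exit q B' n) x \<le> kop (exit q B n) x"
      by (rule kop_mono[OF abs_exit_le[OF assms(1,2)] abs_exit_le[OF assms(1,2)] Suc])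
    then have "q * kop (exit q B' n) x \<le> q * kop (exit q B n) x"
      using assms(1) by (rule mult_left_mono)
    then show ?thesis using True assms(3) by auto
  next
    case False
    then show ?thesis using exit_off[of x B q "Suc n"] exit_bounds(2)[OF assms(1,2), of B' "Suc n" x] by simp
  qed
qed

end

context markov_kernel
begin

lemma funpow_kop_mono:
  assumes "\<And>y. \<bar>f y\<bar> \<le> B" "\<And>y. \<bar>g y\<bar> \<le> C" "\<And>y. f y \<le> g y"
  shows "(kop ^^ n) f x \<le> (kop ^^ n) g x"
proof (induction n arbitrary: x)
  case 0
  show ?case using assms(3) by simp
next
  case (Suc n)
  have "kop ((kop ^^ n) f) x \<le> kop ((kop ^^ n) g) x"
    by (rule kop_mono[OF abs_funpow_kop_le[OF assms(1)] abs_funpow_kop_le[OF assms(2)] Suc])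
  then show ?case by simp
qed

lemma outside_le_exit: "(kop ^^ n) (indicator (- B)) x \<le> exit 1 B n x"
proof (induction n arbitrary: x)
  case (Suc n)
  have i: "\<bar>indicator (- B) y :: real\<bar> \<le> 1" for y by (simp add: indicator_def)
  show ?case
  proof (cases "x \<in> B")
    case True
    have "kop ((kop ^^ n) (indicator (- B))) x \<le> kop (exit 1 B n) x"
      by (rule kop_mono[OF abs_funpow_kop_le[OF i] _ Suc, where C = 1]) (rule abs_exit_le, simp_all)
    then show ?thesis using True by simp
  next
    case False
    have "\<bar>(kop ^^ Suc n) (indicator (- B)) x\<bar> \<le> 1" by (rule abs_funpow_kop_le[OF i])
    then show ?thesis using False by simp
  qed
qed simp

text \<open>Decomposition at the first exit from \<open>B\<close>: either the walk is still in \<open>B\<close> at time \<open>n\<close>, or it has left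
  to a place where \<open>U\<close> is at most \<open>S\<close>, or it has left by a jump accounted for in \<open>Y\<close>.\<close>
lemma first_exit_bound:
  assumes U: "\<And>j y. \<bar>U j y\<bar> \<le> b" and Y: "\<And>j y. 0 \<le> Y j y" "\<And>j y. Y j y \<le> b"
    and V: "\<And>y. 0 \<le> V y" "\<And>y. V y \<le> b" "\<And>y. y \<in> B \<Longrightarrow> U 0 y \<le> V y"
    and S: "0 \<le> S" and J: "0 \<le> J"
    and step: "\<And>j z. j < n \<Longrightarrow> z \<in> B \<Longrightarrow> U (Suc j) z \<le> kop (U j) z"
    and off: "\<And>j u. j < n \<Longrightarrow> u \<notin> B \<Longrightarrow> U j u \<le> S + Y j u"
    and jump: "\<And>j z. j < n \<Longrightarrow> z \<in> B \<Longrightarrow> kop (Y j) z \<le> J"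
    and z: "z \<in> B"
  shows "U n z \<le> S * exit 1 B n z + real n * J + (kop ^^ n) (\<lambda>y. indicator B y * V y) z"
proof -
  let ?W = "\<lambda>y. indicator B y * V y"
  have W: "\<bar>?W y\<bar> \<le> b" "0 \<le> ?W y" for y using V(1,2)[of y] by (auto simp: indicator_def)
  have "U i z \<le> S * exit 1 B i z + real i * J + (kop ^^ i) ?W z" if "i \<le> n" "z \<in> B" for i z
    using that
  proof (induction i arbitrary: z)
    case 0
    then show ?case using V(3)[of z] by simp
  next
    case (Suc i)
    have i: "i < n" using Suc.prems by simp
    let ?E = "\<lambda>y. S * exit 1 B i y" and ?C = "\<lambda>y. real i * J" and ?P = "(kop ^^ i) ?W"
    have Pb: "\<bar>?P y\<bar> \<le> b" for y by (rule abs_funpow_kop_le[OF W(1)])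
    have P0: "0 \<le> ?P y" for y by (rule funpow_kop_nonneg[OF W(2)])
    have Eb: "\<bar>?E y\<bar> \<le> S" for y
    proof -
      have "\<bar>exit 1 B i y\<bar> \<le> 1" by (rule abs_exit_le) simp_all
      from mult_left_mono[OF this S] show ?thesis using S by (simp add: abs_mult)
    qed
    have Cb: "\<bar>real i * J\<bar> \<le> real i * J" using J by simp
    have Yb: "\<bar>Y i y\<bar> \<le> b" for y using Y[of i y] by simp
    have sum2: "\<bar>?P y + Y i y\<bar> \<le> b + b" for y using Pb[of y] Yb[of y] by linarith
    have sum3: "\<bar>?C y + (?P y + Y i y)\<bar> \<le> real i * J + (b + b)" for y
      using Cb sum2[of y] by linarith
    have sum4: "\<bar>?E y + (?C y + (?P y + Y i y))\<bar> \<le> S + (real i * J + (b + b))" for y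
      using Eb[of y] sum3[of y] by linarith
    have pt: "U i y \<le> ?E y + (?C y + (?P y + Y i y))" for y
    proof (cases "y \<in> B")
      case True
      then show ?thesis using Suc.IH[of y] i Y(1)[of i y] by simp
    next
      case False
      have "0 \<le> real i * J" using J by simp
      then show ?thesis using off[OF i False] P0[of y] exit_off[OF False, of 1 i] by simp
    qed
    have "U (Suc i) z \<le> kop (U i) z" by (rule step[OF i Suc.prems(2)])
    also have "\<dots> \<le> kop (\<lambda>y. ?E y + (?C y + (?P y + Y i y))) z"
      by (rule kop_mono[OF U sum4 pt])
    also have "\<dots> = S * kop (exit 1 B i) z + (real i * J + (kop ?P z + kop (Y i) z))"
      unfolding kop_add[OF Eb sum3] kop_add[OF Cb sum2] kop_add[OF Pb Yb] kop_cmult kop_const ..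
    also have "\<dots> \<le> S * exit 1 B (Suc i) z + real (Suc i) * J + (kop ^^ Suc i) ?W z"
      using jump[OF i Suc.prems(2)] Suc.prems(2) by (simp add: algebra_simps)
    finally show ?case .
  qed
  then show ?thesis using z by simp
qed

end

context jump_kernel
begin

text \<open>On exit within \<open>n\<close> steps the discount is at least \<open>q ^ n\<close>.
  Dropping the jumps longer than \<open>\<rho>\<close> loses at most the probability that one of the
  \<open>n\<close> steps is such a jump.\<close>

lemma discounted_exit_le:
  assumes q: "0 \<le> q" "q \<le> 1" and \<tau>: "\<And>x. kop (indicator {y. \<rho> < real (d x y)}) x \<le> \<tau>"
  shows "q ^ n * exit 1 B n x \<le> symmetric_kernel.exit m (trunc \<rho>) q B n x + real n * \<tau>"
proof -
  interpret R: symmetric_kernel m "trunc \<rho>" by (rule symmetric_kernel_trunc)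
  have \<tau>0: "0 \<le> \<tau>" using \<tau>[of x] kop_nonneg[of "indicator {y. \<rho> < real (d x y)}" x] by simp
  have split: "kop f x \<le> R.kop f x + \<tau>" if f: "\<And>y. 0 \<le> f y" "\<And>y. f y \<le> 1" for f x
  proof -
    have fb: "\<bar>f y\<bar> \<le> 1" for y using f[of y] by simp
    have ib: "\<bar>indicator {y. \<rho> < real (d x y)} y :: real\<bar> \<le> 1" for y by (simp add: indicator_def)
    have "kop f x \<le> (\<Sum>\<^sub>\<infinity>y. f y * (trunc \<rho> x y * m y) + indicator {y. \<rho> < real (d x y)} y * (k x y * m y))"
      unfolding kop_def
    proof (rule infsum_mono[OF kop_summable[OF fb] summable_on_add[OF R.kop_summable[OF fb] kop_summable[OF ib]]])
      show "f y * (k x y * m y) \<le> f y * (trunc \<rho> x y * m y) + indicator {y. \<rho> < real (d x y)} y * (k x y * m y)" for y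
        using mult_right_mono[OF f(2)[of y], of "k x y * m y"] f(1)[of y] k_nonneg[of x y] m_nonneg[of y]
        by (auto simp: trunc_def indicator_def)
    qed
    also have "\<dots> = R.kop f x + kop (indicator {y. \<rho> < real (d x y)}) x"
      unfolding kop_def R.kop_def by (rule infsum_add[OF R.kop_summable[OF fb] kop_summable[OF ib]])
    finally show ?thesis using \<tau>[of x] by simp
  qed
  show ?thesis
  proof (induction n arbitrary: x)
    case (Suc n)
    show ?case
    proof (cases "x \<in> B")
      case True
      let ?f = "\<lambda>y. q ^ n * exit 1 B n y"
      have f: "0 \<le> ?f y" "?f y \<le> 1" for y
        using exit_bounds[of 1 B n y] q mult_mono[of "q ^ n" 1 "exit 1 B n y" 1] by (auto simp: power_le_one)
      have fb: "\<bar>?f y\<bar> \<le> 1" for y using f[of y] by simp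
      have "kop ?f x \<le> R.kop ?f x + \<tau>" by (rule split[OF f])
      also have "R.kop ?f x \<le> R.kop (\<lambda>y. R.exit q B n y + real n * \<tau>) x"
      proof (rule R.kop_mono[OF fb _ Suc])
        show "\<bar>R.exit q B n y + real n * \<tau>\<bar> \<le> 1 + real n * \<tau>" for y
          using R.exit_bounds[OF q, of B n y] \<tau>0 by simp
      qed
      also have "\<dots> = R.kop (R.exit q B n) x + R.kop (\<lambda>_. real n * \<tau>) x"
        by (rule R.kop_add[OF R.abs_exit_le[OF q], where C = "real n * \<tau>"]) (use \<tau>0 in simp)
      also have "R.kop (\<lambda>_. real n * \<tau>) x \<le> real n * \<tau>" using \<tau>0 by (intro R.kop_const_le) simp
      finally have "kop ?f x \<le> R.kop (R.exit q B n) x + real (Suc n) * \<tau>" by (simp add: algebra_simps)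
      then have "q * kop ?f x \<le> q * R.kop (R.exit q B n) x + q * (real (Suc n) * \<tau>)"
        using mult_left_mono[OF _ q(1)] by (fastforce simp flip: distrib_left)
      also have "q * (real (Suc n) * \<tau>) \<le> 1 * (real (Suc n) * \<tau>)"
        using q \<tau>0 by (intro mult_right_mono) auto
      finally show ?thesis using True by (simp add: kop_cmult mult.assoc)
    next
      case False
      have "q ^ Suc n \<le> 1" "0 \<le> real (Suc n) * \<tau>" using q \<tau>0 by (auto intro: power_le_one simp del: power_Suc)
      then show ?thesis unfolding exit_off[OF False] R.exit_off[OF False] by linarith
    qed
  qed simp
qed

end

text \<open>Equality holds at \<open>n = 2\<close> and the sequence is increasing, by Bernoulli's
  inequality for the ratio of consecutive bases. It bounds what the discount loses over its own time
  horizon.\<close>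

lemma quarter_le_power:
  fixes n :: nat
  assumes "2 \<le> n"
  shows "1 / 4 \<le> (1 - 1 / real n) ^ n"
  using assms
proof (induction n rule: nat_induct_at_least)
  case base
  show ?case by (simp add: power2_eq_square)
next
  case (Suc n)
  have n: "0 < real n" "1 < real n" using Suc.hyps by auto
  let ?a = "1 - 1 / real n" and ?b = "1 - 1 / real (Suc n)"
  define y where "y = 1 / ((real n - 1) * (real n + 1))"
  have ba: "?b / ?a = 1 + y" using n by (simp add: y_def divide_simps) (simp add: algebra_simps)
  have "-1 \<le> y" using n by (simp add: y_def order_trans[of _ 0])
  from Bernoulli_inequality[OF this, of "Suc n"]
  have "1 + real (Suc n) * y \<le> (?b / ?a) ^ Suc n" by (simp only: ba)
  moreover have "1 + real (Suc n) * y = 1 / ?a"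
    using n by (simp add: y_def divide_simps) (simp add: algebra_simps)
  ultimately have "1 / ?a \<le> ?b ^ Suc n / ?a ^ Suc n" by (simp only: power_divide)
  then have "1 / ?a * ?a ^ Suc n \<le> ?b ^ Suc n"
    using n by (simp add: pos_le_divide_eq)
  then have "?a ^ n \<le> ?b ^ Suc n" using n by simp
  with Suc.IH show ?case by linarith
qed

section \<open>Scales and limits for the choice of the number of layers\<close>

lemma powr_inverse_powr:
  fixes n :: nat and \<beta> :: real
  assumes "1 \<le> n" "0 < \<beta>"
  shows "1 \<le> real n powr (1 / \<beta>)" "(real n powr (1 / \<beta>)) powr \<beta> = real n"
    "(real n powr (1 / \<beta>)) powr - \<beta> = 1 / real n"
  using assms by (auto simp: powr_powr powr_minus_divide intro!: ge_one_powr_ge_zero)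

lemma exp_beats_powr:
  fixes C \<kappa> \<alpha> e :: real
  assumes "0 < \<kappa>" "0 < e"
  shows "\<forall>\<^sub>F N :: nat in sequentially. C * exp (- (\<kappa> * real N)) * real N powr \<alpha> \<le> e"
proof -
  have "((\<lambda>N::nat. C * exp (- (\<kappa> * real N)) * real N powr \<alpha>) \<longlongrightarrow> 0) sequentially"
    using assms by real_asymp
  then have "\<forall>\<^sub>F N :: nat in sequentially. C * exp (- (\<kappa> * real N)) * real N powr \<alpha> < e"
    using assms(2) by (rule order_tendstoD)
  then show ?thesis by eventually_elim simp
qed

lemma negative_powr_small:
  fixes C c \<beta> e :: real
  assumes "0 < \<beta>" "0 < e" "0 < c"
  shows "\<forall>\<^sub>F N :: nat in sequentially. C * (c * real N) powr - \<beta> \<le> e"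
proof -
  have "((\<lambda>N::nat. C * (c * real N) powr - \<beta>) \<longlongrightarrow> 0) sequentially"
    using assms by real_asymp
  then have "\<forall>\<^sub>F N :: nat in sequentially. C * (c * real N) powr - \<beta> < e"
    using assms(2) by (rule order_tendstoD)
  then show ?thesis by eventually_elim simp
qed

lemma powr_large:
  fixes C c \<beta> :: real
  assumes "0 < \<beta>" "0 < c"
  shows "\<forall>\<^sub>F N :: nat in sequentially. C \<le> (c * real N) powr \<beta>"
proof -
  have "filterlim (\<lambda>N::nat. (c * real N) powr \<beta>) at_top sequentially"
    using assms by real_asymp
  then show ?thesis by (auto simp: filterlim_at_top)
qed

lemma (in markov_kernel) funpow_kop_finite:
  assumes n: "1 \<le> n" and B: "finite B" and f: "\<And>y. \<bar>f y\<bar> \<le> b"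
  shows "(kop ^^ n) (\<lambda>y. indicator B y * f y) x = (\<Sum>y\<in>B. f y * (p n x y * m y))"
proof -
  have b: "\<bar>indicator B y * f y\<bar> \<le> b" for y
    using f[of y] by (auto simp: indicator_def)
  have "(kop ^^ n) (\<lambda>y. indicator B y * f y) x = (\<Sum>\<^sub>\<infinity>y. indicator B y * f y * (p n x y * m y))"
    by (rule funpow_kop[OF n b])
  also have "\<dots> = (\<Sum>\<^sub>\<infinity>y\<in>B. f y * (p n x y * m y))"
    by (rule infsum_cong_neutral) (auto simp: indicator_def)
  finally show ?thesis using B by simp
qed

context two_kernels
begin

text \<open>The l2 estimate averages over starting points, and the law after \<open>n\<close> steps
  has density at most \<open>D * n powr - (\<alpha> / \<beta>)\<close>. Against the volume of a ball
  of radius a multiple of \<open>N\<^sup>2 * n powr (1 / \<beta>)\<close> this leaves a factor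
  \<open>N powr (2 * \<alpha>)\<close>, which \<open>exp (- (\<kappa> * N))\<close> beats.\<close>

lemma ball_exit_small:
  assumes \<epsilon>: "0 < \<epsilon>" and M: "2 \<le> M"
  shows "\<forall>\<^sub>F N in sequentially. \<forall>n\<ge>1. \<forall>x.
    (two.kop ^^ n) (\<lambda>y. indicator (cb x ((real N)\<^sup>2 * real n powr (1 / \<beta>))) y *
       two.exit 1 (cb x (6 * ((real N)\<^sup>2 * real n powr (1 / \<beta>)))) (M * n) y) x \<le> \<epsilon>"
proof -
  obtain C4 \<kappa> :: real where C4: "C4 > 0" and \<kappa>: "0 < \<kappa>" and weighted:
    "\<And>x0 r N n' h. 16 \<le> r \<Longrightarrow> 2 \<le> n' \<Longrightarrow> 4 \<le> N \<Longrightarrow> C4 * real n' \<le> r powr \<beta> \<Longrightarrow>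
      2 \<le> exp (\<kappa> * real N / 2) \<Longrightarrow> (\<And>x. 0 \<le> h x \<and> h x \<le> 1) \<Longrightarrow>
      (\<And>x. x \<in> cb x0 (2 * r * real N) \<Longrightarrow>
         h x \<le> (1 - 1 / real n') * symmetric_kernel.kop m (two.trunc (r / 8)) h x) \<Longrightarrow>
      (\<Sum>y\<in>cb x0 (r * real N / 2). (h y)\<^sup>2 * m y)
        \<le> 8 * exp (- (\<kappa> * real N)) * sum m (cb x0 (2 * r * real N + 2 * r))"
    using weighted_exit_estimate by blast
  obtain D where D: "D > 0" "\<And>n x y. 1 \<le> n \<Longrightarrow> two.p n x y \<le> D * real n powr - (\<alpha> / \<beta>)"
    using two.on_diagonal_upper by blast
  \<comment> \<open>The error budget is \<open>4 * \<delta> = \<epsilon> / 4\<close> for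
    linearising, \<open>\<epsilon> / 2\<close> for long jumps and \<open>\<epsilon> / 4\<close> for
    the exponential term.\<close>
  define \<delta> where "\<delta> = \<epsilon> / 16"
  have \<delta>: "\<delta> > 0" using \<epsilon> by (simp add: \<delta>_def)
  note \<beta> = one.\<beta>_pos
  have "\<forall>\<^sub>F N :: nat in sequentially. 8 \<le> N" by (rule eventually_ge_at_top)
  moreover have "\<forall>\<^sub>F N :: nat in sequentially. C4 * real M \<le> (2 * real N) powr \<beta>"
    using \<beta> by (intro powr_large) auto
  moreover have "\<forall>\<^sub>F N :: nat in sequentially. 2 * exp (- (\<kappa> / 2 * real N)) * real N powr 0 \<le> 1"
    using \<kappa> by (intro exp_beats_powr) auto
  moreover have "\<forall>\<^sub>F N :: nat in sequentially.
      (4 * real M * (CJ2 * CT \<beta>)) * (1 / 4 * real N) powr - \<beta> \<le> \<epsilon> / 2"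
    using \<beta> \<epsilon> by (intro negative_powr_small) auto
  moreover have "\<forall>\<^sub>F N :: nat in sequentially.
      (1 / \<delta> * D * 8 * (CV * 5 powr \<alpha>)) * exp (- (\<kappa> * real N)) * real N powr (2 * \<alpha>) \<le> \<epsilon> / 4"
    using \<kappa> \<epsilon> by (intro exp_beats_powr) auto
  ultimately show ?thesis
  proof eventually_elim
    case (elim N)
    note N8 = elim(1) and E2 = elim(2) and E3 = elim(3) and E4 = elim(4) and E5 = elim(5)
    have N0: "0 < real N" using N8 by simp
    show ?case
    proof (intro allI impI)
      fix n :: nat and x
      assume n: "1 \<le> n"
      define \<nu> where "\<nu> = real n powr (1 / \<beta>)"
      have \<nu>: "1 \<le> \<nu>" "\<nu> powr \<beta> = real n" "\<nu> powr - \<beta> = 1 / real n"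
        unfolding \<nu>_def by (rule powr_inverse_powr[OF n \<beta>])+
      \<comment> \<open>One factor \<open>N\<close> makes the layers wide compared with
        \<open>n powr (1 / \<beta>)\<close>, so that jumps beyond \<open>r / 8\<close> are rare up
        to time \<open>M * n\<close>; the second, in \<open>R0\<close>, comes from the number of
        layers.\<close>
      define r where "r = 2 * real N * \<nu>"
      define R0 where "R0 = (real N)\<^sup>2 * \<nu>"
      have r16: "16 \<le> r"
      proof -
        have "8 * 1 \<le> real N * \<nu>" using N8 \<nu>(1) by (intro mult_mono) auto
        then show ?thesis unfolding r_def by linarith
      qed
      have R0: "r * real N / 2 = R0" "2 * r * real N = 4 * R0" "0 \<le> R0"
        using \<nu>(1) by (simp_all add: r_def R0_def power2_eq_square)
      have R5: "2 * r * real N + 2 * r \<le> 5 * R0" "1 \<le> 5 * R0"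
      proof -
        have "4 * real N * \<nu> \<le> real N * real N * \<nu>"
          using N8 \<nu>(1) by (intro mult_right_mono) auto
        then show 1: "2 * r * real N + 2 * r \<le> 5 * R0"
          unfolding r_def R0_def power2_eq_square by (simp add: mult_ac)
        show "1 \<le> 5 * R0" using 1 r16 R0 by linarith
      qed
      define n' where "n' = M * n"
      have n': "2 \<le> n'" using mult_le_mono[OF M n] by (simp add: n'_def)
      define q where "q = 1 - 1 / real n'"
      have q: "0 \<le> q" "q \<le> 1" using n' by (auto simp: q_def field_simps)
      define \<tau> where "\<tau> = CJ2 * CT \<beta> * (r / 8) powr - \<beta>"
      interpret R: symmetric_kernel m "two.trunc (r / 8)" by (rule two.symmetric_kernel_trunc)
      define h where "h = R.exit q (cb x (4 * R0)) n'"
      have h: "0 \<le> h y" "h y \<le> 1" for y unfolding h_def by (rule R.exit_bounds[OF q])+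
      have C4n: "C4 * real n' \<le> r powr \<beta>"
      proof -
        have "r powr \<beta> = (2 * real N) powr \<beta> * real n"
          using \<nu> N0 unfolding r_def by (subst powr_mult) auto
        moreover have "C4 * real M * real n \<le> (2 * real N) powr \<beta> * real n"
          using E2 by (intro mult_right_mono) auto
        ultimately show ?thesis by (simp add: n'_def mult.assoc)
      qed
      have E3': "2 \<le> exp (\<kappa> * real N / 2)"
        using E3 N0 by (simp add: exp_minus field_simps)
      have sumh: "(\<Sum>y\<in>cb x R0. (h y)\<^sup>2 * m y) \<le> 8 * exp (- (\<kappa> * real N)) * sum m (cb x (5 * R0))"
      proof -
        have "(\<Sum>y\<in>cb x (r * real N / 2). (h y)\<^sup>2 * m y)
            \<le> 8 * exp (- (\<kappa> * real N)) * sum m (cb x (2 * r * real N + 2 * r))"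
        proof (rule weighted[OF r16 n' _ C4n E3'])
          show "4 \<le> N" using N8 by simp
          show "0 \<le> h y \<and> h y \<le> 1" for y using h by simp
          show "h y \<le> (1 - 1 / real n') * R.kop h y" if "y \<in> cb x (2 * r * real N)" for y
            using R.exit_subsolution[OF q, of y "cb x (4 * R0)" n'] that unfolding R0 h_def q_def .
        qed
        also have "\<dots> \<le> 8 * exp (- (\<kappa> * real N)) * sum m (cb x (5 * R0))"
          using R5 by (intro mult_left_mono sum_mono2 finite_cb m_ge_0) (auto simp: in_cb)
        finally show ?thesis unfolding R0 .
      qed
      have \<tau>n: "4 * (real n' * \<tau>) \<le> \<epsilon> / 2"
      proof -
        have "(r / 8) powr - \<beta> = (1 / 4 * real N) powr - \<beta> * (1 / real n)"
        proof -
          have "r / 8 = (1 / 4 * real N) * \<nu>" by (simp add: r_def)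
          then show ?thesis using \<nu> N0 by (simp only: powr_mult)
        qed
        then have "4 * (real n' * \<tau>) = (4 * real M * (CJ2 * CT \<beta>)) * (1 / 4 * real N) powr - \<beta>"
          using n by (simp add: \<tau>_def n'_def)
        then show ?thesis using E4 by simp
      qed
      have \<tau>0: "0 \<le> \<tau>" using two.CJ_pos CT_pos[OF \<beta>] by (simp add: \<tau>_def)
      let ?e = "two.exit 1 (cb x (6 * R0)) n'"
      let ?g = "\<lambda>y. indicator (cb x R0) y * ?e y" and ?H = "\<lambda>y. indicator (cb x R0) y * (h y)\<^sup>2"
      have e: "0 \<le> ?e y" "?e y \<le> 1" for y by (rule two.exit_bounds; simp)+
      \<comment> \<open>The factor 4 undoes the discount, since \<open>q ^ n' \<ge> 1 / 4\<close>;
        the second summand accounts for the jumps longer than \<open>r / 8\<close>.\<close>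
      have e_le: "?e y \<le> 4 * (h y + real n' * \<tau>)" for y
      proof -
        have "?e y \<le> two.exit 1 (cb x (4 * R0)) n' y"
          using R0(3) by (intro two.exit_antimono) (auto simp: in_cb)
        moreover have "q ^ n' * two.exit 1 (cb x (4 * R0)) n' y \<le> h y + real n' * \<tau>"
          unfolding h_def \<tau>_def using r16
          by (intro two.discounted_exit_le q two.kop_tail) auto
        moreover have "1 / 4 * two.exit 1 (cb x (4 * R0)) n' y \<le> q ^ n' * two.exit 1 (cb x (4 * R0)) n' y"
          unfolding q_def using quarter_le_power[OF n'] two.exit_bounds(1)[of 1 "cb x (4 * R0)" n' y]
          by (intro mult_right_mono) auto
        moreover have "a \<le> 4 * H" if "a \<le> b" "Q \<le> H" "1 / 4 * b \<le> Q" for a b H Q :: real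
          using that by linarith
        ultimately show ?thesis by blast
      qed
      \<comment> \<open>Only \<open>h\<^sup>2\<close> is controlled, so the linear term is traded by
        \<open>4 * h \<le> 4 * \<delta> + h\<^sup>2 / \<delta>\<close>.\<close>
      have g_le: "\<bar>?g y - 0\<bar> \<le> (4 * \<delta> + 4 * (real n' * \<tau>)) + 1 / \<delta> * ?H y" for y
      proof (cases "y \<in> cb x R0")
        case True
        have "0 \<le> (h y - 2 * \<delta>)\<^sup>2 / \<delta>" using \<delta> by simp
        also have "\<dots> = 1 / \<delta> * (h y)\<^sup>2 - 4 * h y + 4 * \<delta>"
          using \<delta> by (simp add: power2_eq_square field_simps)
        finally have "4 * h y \<le> 4 * \<delta> + 1 / \<delta> * (h y)\<^sup>2" by linarith
        then show ?thesis using e_le[of y] e(1)[of y] True by simp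
      next
        case False
        then show ?thesis using \<tau>0 \<delta> by simp
      qed
      have Hb: "\<bar>?H y\<bar> \<le> 1" "\<bar>(h y)\<^sup>2\<bar> \<le> 1" for y
        using h[of y] by (auto simp: indicator_def power_le_one)
      have gb: "\<bar>?g y\<bar> \<le> 1" for y using e[of y] by (simp add: indicator_def)
      have "\<bar>(two.kop ^^ n) ?g x - 0\<bar> \<le> (4 * \<delta> + 4 * (real n' * \<tau>)) + 1 / \<delta> * (two.kop ^^ n) ?H x"
        by (rule two.funpow_kop_diff_le[OF gb Hb(1) g_le n])
      moreover have "(two.kop ^^ n) ?H x \<le> D * real n powr - (\<alpha> / \<beta>) * (\<Sum>y\<in>cb x R0. (h y)\<^sup>2 * m y)"
      proof -
        have "(two.kop ^^ n) ?H x = (\<Sum>y\<in>cb x R0. (h y)\<^sup>2 * (two.p n x y * m y))"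
          by (rule two.funpow_kop_finite[OF n finite_cb Hb(2)])
        also have "\<dots> \<le> (\<Sum>y\<in>cb x R0. (h y)\<^sup>2 * (D * real n powr - (\<alpha> / \<beta>) * m y))"
          by (intro sum_mono mult_left_mono mult_right_mono D(2) n m_ge_0) auto
        finally show ?thesis by (simp add: sum_distrib_left mult_ac)
      qed
      moreover have "D * real n powr - (\<alpha> / \<beta>) * (\<Sum>y\<in>cb x R0. (h y)\<^sup>2 * m y)
          \<le> D * real n powr - (\<alpha> / \<beta>) * (8 * exp (- (\<kappa> * real N)) * (CV * (5 * R0) powr \<alpha>))"
      proof (intro mult_left_mono)
        have "sum m (cb x (5 * R0)) \<le> CV * (5 * R0) powr \<alpha>"
          using vol_upper[OF R5(2), of x] by (simp add: cb_def)
        then have "8 * exp (- (\<kappa> * real N)) * sum m (cb x (5 * R0))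
            \<le> 8 * exp (- (\<kappa> * real N)) * (CV * (5 * R0) powr \<alpha>)"
          by (intro mult_left_mono) auto
        with sumh show "(\<Sum>y\<in>cb x R0. (h y)\<^sup>2 * m y) \<le> 8 * exp (- (\<kappa> * real N)) * (CV * (5 * R0) powr \<alpha>)"
          by linarith
      qed (use D in auto)
      moreover have "real n powr - (\<alpha> / \<beta>) * (5 * R0) powr \<alpha> = 5 powr \<alpha> * real N powr (2 * \<alpha>)"
      proof -
        have "real N powr (2 * \<alpha>) = (real N powr 2) powr \<alpha>" by (simp only: powr_powr)
        then have "((real N)\<^sup>2) powr \<alpha> = real N powr (2 * \<alpha>)" using N0 by simp
        then have "(5 * R0) powr \<alpha> = 5 powr \<alpha> * (real N powr (2 * \<alpha>) * real n powr (\<alpha> / \<beta>))"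
          unfolding R0_def \<nu>_def by (simp add: powr_mult powr_powr)
        then show ?thesis using n by (simp add: powr_minus)
      qed
      ultimately have "(two.kop ^^ n) ?g x \<le> (4 * \<delta> + 4 * (real n' * \<tau>))
          + 1 / \<delta> * (D * 8 * exp (- (\<kappa> * real N)) * CV * (5 powr \<alpha> * real N powr (2 * \<alpha>)))"
      proof -
        assume a: "\<bar>(two.kop ^^ n) ?g x - 0\<bar> \<le> (4 * \<delta> + 4 * (real n' * \<tau>)) + 1 / \<delta> * (two.kop ^^ n) ?H x"
          and b: "(two.kop ^^ n) ?H x \<le> D * real n powr - (\<alpha> / \<beta>) * (\<Sum>y\<in>cb x R0. (h y)\<^sup>2 * m y)"
          and c: "D * real n powr - (\<alpha> / \<beta>) * (\<Sum>y\<in>cb x R0. (h y)\<^sup>2 * m y)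
            \<le> D * real n powr - (\<alpha> / \<beta>) * (8 * exp (- (\<kappa> * real N)) * (CV * (5 * R0) powr \<alpha>))"
          and d: "real n powr - (\<alpha> / \<beta>) * (5 * R0) powr \<alpha> = 5 powr \<alpha> * real N powr (2 * \<alpha>)"
        have "(two.kop ^^ n) ?H x \<le> D * 8 * exp (- (\<kappa> * real N)) * CV * (real n powr - (\<alpha> / \<beta>) * (5 * R0) powr \<alpha>)"
          using order_trans[OF b c] by (simp add: mult_ac)
        then have "1 / \<delta> * (two.kop ^^ n) ?H x
            \<le> 1 / \<delta> * (D * 8 * exp (- (\<kappa> * real N)) * CV * (5 powr \<alpha> * real N powr (2 * \<alpha>)))"
          unfolding d using \<delta> by (intro mult_left_mono) auto
        with a show ?thesis by linarith
      qed
      also have "1 / \<delta> * (D * 8 * exp (- (\<kappa> * real N)) * CV * (5 powr \<alpha> * real N powr (2 * \<alpha>)))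
          = (1 / \<delta> * D * 8 * (CV * 5 powr \<alpha>)) * exp (- (\<kappa> * real N)) * real N powr (2 * \<alpha>)"
        by (simp add: mult_ac)
      finally have "(two.kop ^^ n) ?g x \<le> \<epsilon>" using E5 \<tau>n by (simp add: \<delta>_def)
      then show "(two.kop ^^ n) (\<lambda>y. indicator (cb x ((real N)\<^sup>2 * real n powr (1 / \<beta>))) y *
         two.exit 1 (cb x (6 * ((real N)\<^sup>2 * real n powr (1 / \<beta>)))) (M * n) y) x \<le> \<epsilon>"
        unfolding R0_def \<nu>_def n'_def .
    qed
  qed
qed

end

section \<open>Survival in balls\<close>

lemma (in markov_kernel) exit_antimono_mono:
  "B \<subseteq> B' \<Longrightarrow> i \<le> n \<Longrightarrow> exit 1 B' i x \<le> exit 1 B n x"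
  using exit_antimono[of 1 B B' i x] exit_mono[of 1 i n B x] by simp

context two_kernels
begin

text \<open>In the step from \<open>n\<close> to \<open>M * n\<close> a single use of the first exit
  gives only \<open>\<eta> + \<epsilon>\<close>, because leaving the small ball before time
  \<open>n\<close> may already have probability \<open>\<eta>\<close>. This weaker bound holds at
  every point, and applying it at the exit position gives
  \<open>(\<eta> + \<epsilon>) * \<eta> + 2 * \<epsilon>\<close>, which is below
  \<open>\<eta>\<close> since \<open>\<eta> \<le> 1 / 4\<close> and
  \<open>\<epsilon> = \<eta> / 8\<close>.\<close>

lemma survival:
  assumes "0 < \<theta>"
  shows "\<exists>L\<ge>1. \<forall>n\<ge>1. \<forall>x. two.exit 1 (cb x (L * real n powr (1 / \<beta>))) n x \<le> \<theta>"
proof -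
  define \<eta> where "\<eta> = min \<theta> (1 / 4)"
  define \<epsilon> where "\<epsilon> = \<eta> / 8"
  have \<eta>: "0 < \<eta>" "\<eta> \<le> 1 / 4" "\<eta> \<le> \<theta>" and \<epsilon>: "0 < \<epsilon>" using assms by (auto simp: \<eta>_def \<epsilon>_def)
  note \<beta> = one.\<beta>_pos
  \<comment> \<open>Large enough that the radius \<open>8 * R0\<close> needed in the induction step
    fits into the radius allowed at time \<open>M * n\<close>.\<close>
  define M where "M = max 2 (nat \<lceil>8 powr \<beta>\<rceil>)"
  have M2: "2 \<le> M" by (simp add: M_def)
  have M8: "8 \<le> real M powr (1 / \<beta>)"
  proof -
    have "8 powr \<beta> \<le> real (nat \<lceil>8 powr \<beta>\<rceil>)" by (rule real_nat_ceiling_ge)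
    also have "\<dots> \<le> real M" unfolding M_def of_nat_le_iff by (rule max.cobounded2)
    finally have "(8 powr \<beta>) powr (1 / \<beta>) \<le> real M powr (1 / \<beta>)"
      using \<beta> by (intro powr_mono2) auto
    then show ?thesis using \<beta> by (simp add: powr_powr)
  qed
  have "\<forall>\<^sub>F N :: nat in sequentially. 1 \<le> N" by (rule eventually_ge_at_top)
  moreover have "\<forall>\<^sub>F N :: nat in sequentially. (CJ2 * CT \<beta>) * (1 * real N) powr - \<beta> \<le> \<epsilon>"
    using \<beta> \<epsilon> by (intro negative_powr_small) auto
  moreover note ball_exit_small[OF \<epsilon> M2]
  ultimately have "\<forall>\<^sub>F N in sequentially. 1 \<le> N \<and> (CJ2 * CT \<beta>) * (1 * real N) powr - \<beta> \<le> \<epsilon> \<and>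
    (\<forall>n\<ge>1. \<forall>x. (two.kop ^^ n) (\<lambda>y. indicator (cb x ((real N)\<^sup>2 * real n powr (1 / \<beta>))) y *
       two.exit 1 (cb x (6 * ((real N)\<^sup>2 * real n powr (1 / \<beta>)))) (M * n) y) x \<le> \<epsilon>)"
    by eventually_elim blast
  then obtain N :: nat where N1: "1 \<le> N" and Ntail: "(CJ2 * CT \<beta>) * (1 * real N) powr - \<beta> \<le> \<epsilon>"
    and small: "\<And>n x. 1 \<le> n \<Longrightarrow> (two.kop ^^ n) (\<lambda>y. indicator (cb x ((real N)\<^sup>2 * real n powr (1 / \<beta>))) y *
       two.exit 1 (cb x (6 * ((real N)\<^sup>2 * real n powr (1 / \<beta>)))) (M * n) y) x \<le> \<epsilon>"
    unfolding eventually_sequentially by blast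
  define L where "L = (real N)\<^sup>2"
  have L1: "1 \<le> L" using N1 by (simp add: L_def)
  have cc: "0 \<le> CJ2 * CT \<beta>" using two.CJ_pos CT_pos[OF \<beta>] by simp
  have Ltail: "(CJ2 * CT \<beta>) * L powr - \<beta> \<le> \<epsilon>"
  proof -
    have "L powr - \<beta> \<le> real N powr - \<beta>"
      using N1 \<beta> by (intro powr_mono2') (auto simp: L_def power2_eq_square)
    from mult_left_mono[OF this cc] Ntail show ?thesis by simp
  qed
  have step: "two.exit 1 (cb x (L * real (M * n) powr (1 / \<beta>))) (M * n) x \<le> \<eta>"
    if n: "1 \<le> n" and IH: "\<And>x. two.exit 1 (cb x (L * real n powr (1 / \<beta>))) n x \<le> \<eta>" for n x
  proof -
    define R0 where "R0 = L * real n powr (1 / \<beta>)"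
    note \<nu> = powr_inverse_powr[OF n \<beta>]
    have R1: "1 \<le> R0" using mult_mono[OF L1 \<nu>(1)] L1 by (simp add: R0_def)
    \<comment> \<open>The time left after the first \<open>n\<close> steps; in
      \<open>first_exit_bound\<close> the horizon of \<open>U j\<close> is \<open>l + j\<close>, so
      \<open>U n\<close> carries the full horizon \<open>M * n\<close>.\<close>
    define l where "l = (M - 1) * n"
    have ln: "l + n = M * n" using M2 by (simp add: l_def algebra_simps)
    have sm: "(two.kop ^^ n) (\<lambda>y. indicator (cb x R0) y * two.exit 1 (cb x (6 * R0)) (M * n) y) x \<le> \<epsilon>" for x
      using small[OF n, of x] by (simp add: R0_def L_def)
    have e: "0 \<le> two.exit 1 B i y" "two.exit 1 B i y \<le> 1" "\<bar>two.exit 1 B i y\<bar> \<le> 1" for B i y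
      using two.exit_bounds[of 1 B i y] by auto
    have first: "two.exit 1 (cb y (6 * R0)) (M * n) y \<le> \<eta> + \<epsilon>" for y
    proof -
      have "two.exit 1 (cb y (6 * R0)) (l + n) y
          \<le> 1 * two.exit 1 (cb y R0) n y + real n * 0
            + (two.kop ^^ n) (\<lambda>z. indicator (cb y R0) z * two.exit 1 (cb y (6 * R0)) (M * n) z) y"
      proof (rule two.first_exit_bound[where U = "\<lambda>j. two.exit 1 (cb y (6 * R0)) (l + j)" and b = 1
            and Y = "\<lambda>_ _. 0"])
        show "two.exit 1 (cb y (6 * R0)) (l + 0) z \<le> two.exit 1 (cb y (6 * R0)) (M * n) z" for z
          using ln by (intro two.exit_mono) auto
        show "two.exit 1 (cb y (6 * R0)) (l + Suc j) z \<le> two.kop (two.exit 1 (cb y (6 * R0)) (l + j)) z"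
          if "z \<in> cb y R0" for j z
          using that R1 by (simp add: in_cb)
        show "y \<in> cb y R0" using R1 by (simp add: in_cb d_refl)
      qed (auto simp: e two.kop_const)
      also have "\<dots> \<le> 1 * \<eta> + real n * 0 + \<epsilon>"
        using IH[of y] sm[of y] unfolding R0_def by (intro add_mono) auto
      finally show ?thesis unfolding ln by simp
    qed
    \<comment> \<open>An exit point \<open>u\<close> within \<open>2 * R0\<close> of
      \<open>x\<close> has its ball of radius \<open>6 * R0\<close> inside the one of radius
      \<open>8 * R0\<close> about \<open>x\<close>, so \<open>first\<close> applies at
      \<open>u\<close>; a jump beyond \<open>2 * R0\<close> has length more than \<open>R0\<close>
      and is charged to \<open>Y\<close>.\<close>
    have "two.exit 1 (cb x (8 * R0)) (l + n) x
        \<le> (\<eta> + \<epsilon>) * two.exit 1 (cb x R0) n x + real n * (CJ2 * CT \<beta> * R0 powr - \<beta>)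
          + (two.kop ^^ n) (\<lambda>z. indicator (cb x R0) z * two.exit 1 (cb x (6 * R0)) (M * n) z) x"
    proof (rule two.first_exit_bound[where U = "\<lambda>j. two.exit 1 (cb x (8 * R0)) (l + j)" and b = 1
          and Y = "\<lambda>_. indicator {y. 2 * R0 < real (d x y)}"])
      show "two.exit 1 (cb x (8 * R0)) (l + 0) z \<le> two.exit 1 (cb x (6 * R0)) (M * n) z" for z
        using ln R1 by (intro two.exit_antimono_mono) (auto simp: in_cb)
      show "two.exit 1 (cb x (8 * R0)) (l + Suc j) z \<le> two.kop (two.exit 1 (cb x (8 * R0)) (l + j)) z"
        if "z \<in> cb x R0" for j z
        using that R1 by (simp add: in_cb)
      show "x \<in> cb x R0" using R1 by (simp add: in_cb d_refl)
      show "two.exit 1 (cb x (8 * R0)) (l + j) u \<le> \<eta> + \<epsilon> + indicator {y. 2 * R0 < real (d x y)} u"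
        if "j < n" "u \<notin> cb x R0" for j u
      proof (cases "2 * R0 < real (d x u)")
        case True
        then show ?thesis using e(2)[of "cb x (8 * R0)" "l + j" u] \<eta> \<epsilon> by simp
      next
        case False
        have "cb u (6 * R0) \<subseteq> cb x (8 * R0)"
        proof
          fix v assume "v \<in> cb u (6 * R0)"
          then show "v \<in> cb x (8 * R0)" using False d_triangle_real[of x v u] by (simp add: in_cb)
        qed
        then have "two.exit 1 (cb x (8 * R0)) (l + j) u \<le> two.exit 1 (cb u (6 * R0)) (M * n) u"
          using ln that by (intro two.exit_antimono_mono) auto
        also have "\<dots> \<le> \<eta> + \<epsilon>" by (rule first)
        finally show ?thesis using False by simp
      qed
      show "two.kop (indicator {y. 2 * R0 < real (d x y)}) z \<le> CJ2 * CT \<beta> * R0 powr - \<beta>"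
        if "z \<in> cb x R0" for z
      proof -
        have "two.kop (indicator {y. 2 * R0 < real (d x y)}) z \<le> two.kop (indicator {y. R0 < real (d z y)}) z"
        proof (rule two.kop_mono[where B = 1 and C = 1])
          show "indicator {y. 2 * R0 < real (d x y)} y \<le> (indicator {y. R0 < real (d z y)} y :: real)" for y
            using that d_triangle_real[of x y z] by (auto simp: indicator_def in_cb)
        qed (auto simp: indicator_def)
        also have "\<dots> \<le> CJ2 * CT \<beta> * R0 powr - \<beta>" by (rule two.kop_tail[OF R1])
        finally show ?thesis .
      qed
    qed (use \<eta> \<epsilon> cc in \<open>auto simp: e indicator_def\<close>)
    also have "\<dots> \<le> (\<eta> + \<epsilon>) * \<eta> + \<epsilon> + \<epsilon>"
    proof (intro add_mono mult_left_mono sm)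
      show "two.exit 1 (cb x R0) n x \<le> \<eta>" using IH unfolding R0_def .
      have "R0 powr - \<beta> = L powr - \<beta> * (1 / real n)"
        using L1 \<nu> unfolding R0_def by (simp add: powr_mult)
      then have "real n * (CJ2 * CT \<beta> * R0 powr - \<beta>) = CJ2 * CT \<beta> * L powr - \<beta>" using n by simp
      then show "real n * (CJ2 * CT \<beta> * R0 powr - \<beta>) \<le> \<epsilon>" using Ltail by (simp only:)
    qed (use \<eta> \<epsilon> in auto)
    also have "\<dots> \<le> \<eta>"
    proof -
      have "(\<eta> + \<epsilon>) * \<eta> \<le> (\<eta> + \<epsilon>) * (1 / 4)" using \<eta> \<epsilon> by (intro mult_left_mono) auto
      moreover have "P + e + e \<le> t" if "P \<le> (t + e) * (1 / 4)" "e = t / 8" "0 < t" for P e t :: real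
        using that by simp
      ultimately show ?thesis using \<eta>(1) \<epsilon>_def by blast
    qed
    finally have "two.exit 1 (cb x (8 * R0)) (M * n) x \<le> \<eta>" unfolding ln .
    moreover have "8 * R0 \<le> L * real (M * n) powr (1 / \<beta>)"
    proof -
      have "8 * R0 \<le> real M powr (1 / \<beta>) * R0" using M8 R1 by (intro mult_right_mono) auto
      then show ?thesis by (simp add: R0_def powr_mult mult_ac)
    qed
    then have "two.exit 1 (cb x (L * real (M * n) powr (1 / \<beta>))) (M * n) x \<le> two.exit 1 (cb x (8 * R0)) (M * n) x"
      by (intro two.exit_antimono_mono) (auto simp: in_cb)
    ultimately show ?thesis by linarith
  qed
  have powers: "two.exit 1 (cb x (L * real (M ^ j) powr (1 / \<beta>))) (M ^ j) x \<le> \<eta>" for j x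
  proof (induction j arbitrary: x)
    case 0
    have eq: "- cb x L = {y. L < real (d x y)}" by (auto simp: in_cb)
    have "two.exit 1 (cb x L) 1 x \<le> CJ2 * CT \<beta> * L powr - \<beta>"
      using two.kop_tail[OF L1, of x] L1 by (simp add: in_cb d_refl eq)
    also have "\<dots> \<le> \<eta>" using Ltail \<eta> by (simp add: \<epsilon>_def)
    finally show ?case by simp
  next
    case (Suc j)
    show ?case using step[of "M ^ j" x] Suc M2 by simp
  qed
  show ?thesis
  proof (intro exI conjI allI impI)
    \<comment> \<open>A general \<open>n\<close> is rounded up to the least power
      \<open>M ^ j \<ge> n\<close>, which is at most \<open>M * n\<close>; the factor
      \<open>M powr (1 / \<beta>)\<close> in the radius pays for this.\<close>
    show "1 \<le> L * real M powr (1 / \<beta>)" using mult_mono[of 1 L 1 "real M powr (1 / \<beta>)"] L1 M8 by simp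
    fix n :: nat and x assume n: "1 \<le> n"
    have "n < 2 ^ n" by (rule less_exp)
    also have "2 ^ n \<le> M ^ n" by (rule power_mono[OF M2]) simp
    finally have "\<exists>j. n \<le> M ^ j" by (intro exI[of _ n]) simp
    then obtain j where j: "n \<le> M ^ j" "\<And>i. i < j \<Longrightarrow> \<not> n \<le> M ^ i"
      using exists_least_iff[of "\<lambda>j. n \<le> M ^ j"] by blast
    have "M ^ j \<le> M * n"
    proof (cases j)
      case 0
      then show ?thesis using M2 n by simp
    next
      case (Suc i)
      then have "M ^ i \<le> n" using j(2)[of i] by simp
      then show ?thesis using Suc by simp
    qed
    then have "real (M ^ j) powr (1 / \<beta>) \<le> (real M * real n) powr (1 / \<beta>)"
      using \<beta> by (intro powr_mono2) (auto simp flip: of_nat_mult of_nat_power)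
    then have "L * real (M ^ j) powr (1 / \<beta>) \<le> L * real M powr (1 / \<beta>) * real n powr (1 / \<beta>)"
      using L1 by (simp add: powr_mult mult.assoc)
    then have "two.exit 1 (cb x (L * real M powr (1 / \<beta>) * real n powr (1 / \<beta>))) n x
        \<le> two.exit 1 (cb x (L * real (M ^ j) powr (1 / \<beta>))) (M ^ j) x"
      using j by (intro two.exit_antimono_mono) (auto simp: in_cb)
    also have "\<dots> \<le> \<theta>" using powers[of x j] \<eta> by linarith
    finally show "two.exit 1 (cb x (L * real M powr (1 / \<beta>) * real n powr (1 / \<beta>))) n x \<le> \<theta>" .
  qed
qed

end

section \<open>Off-diagonal bounds\<close>

locale surviving_kernel = jump_kernel d m \<alpha> CV k kB \<beta> CJ
  for d :: "'a \<Rightarrow> 'a \<Rightarrow> nat" and m :: "'a \<Rightarrow> real" and \<alpha> CV :: real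
    and k :: "'a \<Rightarrow> 'a \<Rightarrow> real" and kB \<beta> CJ :: real +
  assumes survival: "0 < \<theta> \<Longrightarrow> \<exists>L\<ge>1. \<forall>n\<ge>1. \<forall>x. exit 1 (cb x (L * real n powr (1 / \<beta>))) n x \<le> \<theta>"
begin

text \<open>The kernel is at most its value at distance \<open>s\<close>, and what remains is the
  total mass of \<open>p i y\<close> by symmetry. No volume factor arises, which makes the estimate
  sharp for a single long jump.\<close>

lemma kop_jump_into_ball:
  assumes i: "1 \<le> i" and s: "0 < s" and far: "\<And>u. u \<in> cb y r \<Longrightarrow> s \<le> real (d z u)"
  shows "kop (\<lambda>u. indicator (cb y r) u * p i u y) z \<le> CJ * s powr - (\<alpha> + \<beta>)"
proof -
  let ?c = "CJ * s powr - (\<alpha> + \<beta>)"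
  have c: "0 \<le> ?c" using CJ_pos by simp
  have b: "\<bar>indicator (cb y r) u * p i u y\<bar> \<le> kB" for u
    using abs_p_le[of i u y] p_nonneg[of i u y] by (auto simp: indicator_def)
  have "kop (\<lambda>u. indicator (cb y r) u * p i u y) z \<le> (\<Sum>\<^sub>\<infinity>u. ?c * (p i y u * m u))"
    unfolding kop_def[where x = z]
  proof (rule infsum_mono[OF kop_summable[OF b] summable_on_cmult_right[OF p_summable[OF i]]])
    fix u
    show "indicator (cb y r) u * p i u y * (k z u * m u) \<le> ?c * (p i y u * m u)"
    proof (cases "u \<in> cb y r")
      case True
      have "k z u * (p i y u * m u) \<le> ?c * (p i y u * m u)"
        using k_upper_far[OF s far[OF True]] by (intro mult_right_mono) (auto simp: p_nonneg m_nonneg)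
      then show ?thesis using True p_sym[OF i, of u y] by (simp add: mult_ac)
    next
      case False
      then show ?thesis using c by (simp add: p_nonneg m_nonneg)
    qed
  qed
  also have "\<dots> = ?c * (\<Sum>\<^sub>\<infinity>u. p i y u * m u)" by (rule infsum_cmult_right')
  finally show ?thesis using p_mass[OF i, of y] by simp
qed

text \<open>A path from \<open>x\<close> to \<open>y\<close> leaves the ball around \<open>x\<close> in its first half, or, read backwards, the ball around
  \<open>y\<close> in its second half. It does so with small probability, or by a single jump into the vicinity
  of the other end point.\<close>
lemma off_diagonal_step:
  assumes n: "1 \<le> n" "1 \<le> l" and D: "1 \<le> d x y"
    and \<theta>: "0 \<le> \<theta>" "exit 1 (cb x (real (d x y) / 3)) (n + l) x \<le> \<theta>"
      "exit 1 (cb y (real (d x y) / 3)) (n + l) y \<le> \<theta>"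
    and S: "0 \<le> S" "\<And>i u v. 1 \<le> i \<Longrightarrow> i < n + l \<Longrightarrow> real (d x y) / 4 < real (d u v) \<Longrightarrow> p i u v \<le> S"
  shows "p (n + l) x y \<le> 2 * (S * \<theta>) + real (n + l) * (CJ * (real (d x y) / 4) powr - (\<alpha> + \<beta>))"
proof -
  let ?D = "real (d x y)" and ?J = "CJ * (real (d x y) / 4) powr - (\<alpha> + \<beta>)"
  have D0: "0 < ?D" using D by simp
  have J: "0 \<le> ?J" using CJ_pos by simp
  \<comment> \<open>Since 1/2 + 1/3 < 1 the two balls are disjoint, and each keeps distance at least
    \<open>?D / 4\<close> from the ball of radius \<open>?D / 4\<close> about the other
    centre.\<close>
  let ?B0 = "cb x (?D / 2)" and ?B1 = "cb y (?D / 3)"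
  have ind: "0 \<le> indicator B u * p i u v" "indicator B u * p i u v \<le> kB" "\<bar>indicator B u * p i u v\<bar> \<le> kB"
    for B :: "'a set" and u v i
    using p_nonneg[of i u v] p_le[of i u v] by (auto simp: indicator_def)
  have 1: "p (n + l) x y \<le> S * exit 1 ?B0 n x + real n * ?J + (kop ^^ n) (\<lambda>u. indicator ?B0 u * p l u y) x"
  proof -
    have "p (l + n) x y \<le> S * exit 1 ?B0 n x + real n * ?J + (kop ^^ n) (\<lambda>u. indicator ?B0 u * p l u y) x"
    proof (rule first_exit_bound[where U = "\<lambda>j u. p (l + j) u y" and b = kB
          and Y = "\<lambda>j u. indicator (cb y (?D / 4)) u * p (l + j) u y"])
      show "p (l + j) u y \<le> S + indicator (cb y (?D / 4)) u * p (l + j) u y" if "j < n" for j u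
      proof (cases "u \<in> cb y (?D / 4)")
        case False
        then have "p (l + j) u y \<le> S"
          using that n d_commute[of u y] by (intro S(2)) (auto simp: in_cb)
        then show ?thesis using False by simp
      qed (use S in simp)
      show "kop (\<lambda>u. indicator (cb y (?D / 4)) u * p (l + j) u y) z \<le> ?J" if "z \<in> ?B0" for j z
      proof (rule kop_jump_into_ball)
        show "?D / 4 \<le> real (d z u)" if "u \<in> cb y (?D / 4)" for u
          using that \<open>z \<in> ?B0\<close> d_triangle_real[of x y z] d_triangle_real[of z y u] d_commute[of u y]
          by (simp add: in_cb)
      qed (use n D0 in auto)
      show "p (l + Suc j) z y \<le> kop (\<lambda>u. p (l + j) u y) z" for j z
        using p_Suc[of "l + j" z y] n by simp
    qed (use S J D0 n in \<open>auto simp: abs_p_le ind p_nonneg p_le in_cb d_refl\<close>)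
    then show ?thesis by (simp add: add.commute)
  qed
  \<comment> \<open>Time reversal: symmetry of the kernels turns the paths that are in
    \<open>?B0\<close> at time \<open>n\<close> into paths from \<open>y\<close> that start their
    decomposition with \<open>l\<close> steps.\<close>
  have 2: "(kop ^^ n) (\<lambda>u. indicator ?B0 u * p l u y) x = (kop ^^ l) (\<lambda>u. indicator ?B0 u * p n u x) y"
    using funpow_kop_finite[OF n(1) finite_cb, of "\<lambda>u. p l u y" kB x "?D / 2" x]
      funpow_kop_finite[OF n(2) finite_cb, of "\<lambda>u. p n u x" kB x "?D / 2" y] abs_p_le
      p_sym[OF n(1), of x] p_sym[OF n(2), of y] by (simp add: mult_ac)
  have 3: "(kop ^^ l) (\<lambda>u. indicator ?B0 u * p n u x) y \<le> S * exit 1 ?B1 l y + real l * ?J + (kop ^^ l) (\<lambda>u. indicator ?B1 u * 0) y"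
  proof (rule first_exit_bound[where U = "\<lambda>j. (kop ^^ j) (\<lambda>u. indicator ?B0 u * p n u x)" and b = kB
        and Y = "\<lambda>j u. indicator (cb x (?D / 4)) u * p (n + j) u x"])
    have le: "(kop ^^ j) (\<lambda>u. indicator ?B0 u * p n u x) z \<le> p (n + j) z x" for j z
    proof -
      have "(kop ^^ j) (\<lambda>u. indicator ?B0 u * p n u x) z \<le> (kop ^^ j) (\<lambda>u. p n u x) z"
        by (rule funpow_kop_mono[OF ind(3) abs_p_le]) (simp add: indicator_def p_nonneg)
      also have "\<dots> = p (n + j) z x"
      proof (induction j arbitrary: z)
        case (Suc j)
        have "(kop ^^ j) (\<lambda>u. p n u x) = (\<lambda>u. p (n + j) u x)" using Suc by (intro ext)
        then show ?case using p_Suc[of "n + j" z x] n by simp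
      qed simp
      finally show ?thesis .
    qed
    show "(kop ^^ j) (\<lambda>u. indicator ?B0 u * p n u x) u \<le> S + indicator (cb x (?D / 4)) u * p (n + j) u x"
      if "j < l" for j u
    proof (cases "u \<in> cb x (?D / 4)")
      case False
      then have "p (n + j) u x \<le> S"
        using that n d_commute[of u x] by (intro S(2)) (auto simp: in_cb)
      then show ?thesis using False le[of j u] by simp
    next
      case True
      then show ?thesis using S(1) le[of j u] by simp
    qed
    show "kop (\<lambda>u. indicator (cb x (?D / 4)) u * p (n + j) u x) z \<le> ?J" if "z \<in> ?B1" for j z
    proof (rule kop_jump_into_ball)
      show "?D / 4 \<le> real (d z u)" if "u \<in> cb x (?D / 4)" for u
        using that \<open>z \<in> ?B1\<close> d_triangle_real[of x y u] d_triangle_real[of u y z] d_commute[of u z] d_commute[of z y]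
          D0 by (simp add: in_cb)
    qed (use n D0 in auto)
    show "(kop ^^ 0) (\<lambda>u. indicator ?B0 u * p n u x) z \<le> 0" if "z \<in> ?B1" for z
      using that d_triangle_real[of x y z] d_commute[of z y] D0 by (auto simp: in_cb indicator_def)
    show "\<bar>(kop ^^ j) (\<lambda>u. indicator ?B0 u * p n u x) z\<bar> \<le> kB" for j z
      by (rule abs_funpow_kop_le[OF ind(3)])
    show "0 \<le> kB" using abs_p_le[of n x y] by linarith
    show "y \<in> ?B1" using D0 by (simp add: in_cb d_refl)
  qed (use S J in \<open>auto simp: ind\<close>)
  have "exit 1 ?B0 n x \<le> exit 1 (cb x (?D / 3)) (n + l) x" "exit 1 ?B1 l y \<le> exit 1 (cb y (?D / 3)) (n + l) y"
    using D0 by (intro exit_antimono_mono; auto simp: in_cb)+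
  then have "S * exit 1 ?B0 n x \<le> S * \<theta>" "S * exit 1 ?B1 l y \<le> S * \<theta>"
    using \<theta> S(1) by (auto intro!: mult_left_mono)
  moreover have "(kop ^^ l) (\<lambda>u. indicator ?B1 u * 0) y = 0" using funpow_kop_const[of l 0 y] by simp
  moreover have "real (n + l) * ?J = real n * ?J + real l * ?J" by (simp add: algebra_simps)
  ultimately show ?thesis using 1 3 unfolding 2 by linarith
qed

text \<open>Strong induction on time. For distances below
  \<open>3 * L * N powr (1 / \<beta>)\<close> the on-diagonal bound already has the right size;
  beyond, \<open>off_diagonal_step\<close> uses the induction hypothesis at a quarter of the
  distance, multiplied by a small exit probability.\<close>

lemma off_diagonal_upper:
  obtains A where "A > 0"
    "\<And>n x y. 1 \<le> n \<Longrightarrow> 1 \<le> d x y \<Longrightarrow> p n x y \<le> A * (real n * real (d x y) powr - (\<alpha> + \<beta>))"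
proof -
  define \<gamma> where "\<gamma> = \<alpha> + \<beta>"
  have \<gamma>: "0 < \<gamma>" using \<alpha>_pos \<beta>_pos by (simp add: \<gamma>_def)
  \<comment> \<open>A quarter of the distance costs \<open>4 powr \<gamma>\<close>; with this
    \<open>\<theta>\<close> the two exit terms together return only half of the constant
    \<open>A\<close>.\<close>
  define \<theta> where "\<theta> = 1 / (4 * 4 powr \<gamma>)"
  have \<theta>: "0 < \<theta>" by (simp add: \<theta>_def)
  obtain L where L: "1 \<le> L" "\<And>n x. 1 \<le> n \<Longrightarrow> exit 1 (cb x (L * real n powr (1 / \<beta>))) n x \<le> \<theta>"
    using survival[OF \<theta>] by blast
  obtain C where C: "C > 0" "\<And>n x y. 1 \<le> n \<Longrightarrow> p n x y \<le> C * real n powr - (\<alpha> / \<beta>)"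
    using on_diagonal_upper by blast
  \<comment> \<open>The summands serve, in this order, distances within the on-diagonal range, the
    long-jump term, which must fit into the other half of \<open>A\<close>, and
    \<open>n = 1\<close>.\<close>
  define A where "A = C * (3 * L) powr \<gamma> + 2 * (CJ * 4 powr \<gamma>) + CJ"
  have A: "0 < A" "C * (3 * L) powr \<gamma> \<le> A" "2 * (CJ * 4 powr \<gamma>) \<le> A" "CJ \<le> A"
  proof -
    have "0 \<le> C * (3 * L) powr \<gamma>" "0 \<le> CJ * 4 powr \<gamma>" using C(1) CJ_pos by auto
    then show "0 < A" "C * (3 * L) powr \<gamma> \<le> A" "2 * (CJ * 4 powr \<gamma>) \<le> A" "CJ \<le> A"
      using CJ_pos unfolding A_def by linarith+
  qed
  have "p n x y \<le> A * (real n * real (d x y) powr - \<gamma>)" if "1 \<le> n" "1 \<le> d x y" for n x y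
    using that
  proof (induction n arbitrary: x y rule: less_induct)
    case (less N)
    let ?D = "real (d x y)"
    have D: "0 < ?D" using less.prems by simp
    define \<nu> where "\<nu> = real N powr (1 / \<beta>)"
    have \<nu>: "1 \<le> \<nu>" "\<nu> powr \<beta> = real N" "\<nu> powr - \<beta> = 1 / real N"
      unfolding \<nu>_def by (rule powr_inverse_powr[OF less.prems(1) \<beta>_pos])+
    consider "N = 1" | "?D < 3 * L * \<nu>" | "2 \<le> N" "3 * L * \<nu> \<le> ?D"
      using less.prems by linarith
    then show ?case
    proof cases
      case 1
      have "p N x y \<le> CJ * ?D powr - \<gamma>"
        using k_upper_far[OF D order_refl] unfolding 1 p_1 \<gamma>_def .
      also have "\<dots> \<le> A * ?D powr - \<gamma>" using A by (intro mult_right_mono) auto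
      finally show ?thesis using 1 by simp
    next
      case 2
      have "(3 * L * \<nu>) powr - \<gamma> \<le> ?D powr - \<gamma>"
        using 2 D \<gamma> by (intro powr_mono2') auto
      moreover have "(3 * L * \<nu>) powr - \<gamma> = (3 * L) powr - \<gamma> * (real N powr - (\<alpha> / \<beta>) / real N)"
      proof -
        have "1 / \<beta> * - \<gamma> = - (\<alpha> / \<beta> + 1)" using \<beta>_pos by (simp add: \<gamma>_def field_simps)
        then have "\<nu> powr - \<gamma> = real N powr - (\<alpha> / \<beta> + 1)"
          unfolding \<nu>_def powr_powr by (simp only:)
        also have "\<dots> = real N powr - (\<alpha> / \<beta>) / real N"
          using less.prems(1) by (simp add: powr_diff)
        finally show ?thesis using L(1) \<nu>(1) by (simp add: powr_mult)
      qed
      ultimately have "real N * ((3 * L) powr - \<gamma> * (real N powr - (\<alpha> / \<beta>) / real N)) \<le> real N * ?D powr - \<gamma>"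
        by (intro mult_left_mono) auto
      then have "(3 * L) powr - \<gamma> * real N powr - (\<alpha> / \<beta>) \<le> real N * ?D powr - \<gamma>"
        using less.prems(1) by simp
      then have "(3 * L) powr \<gamma> * ((3 * L) powr - \<gamma> * real N powr - (\<alpha> / \<beta>)) \<le> (3 * L) powr \<gamma> * (real N * ?D powr - \<gamma>)"
        by (intro mult_left_mono) auto
      then have "real N powr - (\<alpha> / \<beta>) \<le> (3 * L) powr \<gamma> * (real N * ?D powr - \<gamma>)"
      proof -
        assume a: "(3 * L) powr \<gamma> * ((3 * L) powr - \<gamma> * real N powr - (\<alpha> / \<beta>)) \<le> (3 * L) powr \<gamma> * (real N * ?D powr - \<gamma>)"
        have "(3 * L) powr \<gamma> * (3 * L) powr - \<gamma> = 1" using L(1) by (simp flip: powr_add)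
        then have "(3 * L) powr \<gamma> * ((3 * L) powr - \<gamma> * real N powr - (\<alpha> / \<beta>)) = real N powr - (\<alpha> / \<beta>)"
          by (metis mult.assoc mult_1)
        with a show ?thesis by (simp only:)
      qed
      then have "C * real N powr - (\<alpha> / \<beta>) \<le> C * ((3 * L) powr \<gamma> * (real N * ?D powr - \<gamma>))"
        using C(1) by (intro mult_left_mono) auto
      also have "\<dots> = C * (3 * L) powr \<gamma> * (real N * ?D powr - \<gamma>)" by simp
      also have "\<dots> \<le> A * (real N * ?D powr - \<gamma>)" by (intro mult_right_mono A) auto
      finally show ?thesis using C(2)[OF less.prems(1), of x y] by linarith
    next
      case 3
      define n where "n = N div 2"
      define l where "l = N - n"
      have nl: "n + l = N" "1 \<le> n" "1 \<le> l" using 3 by (auto simp: n_def l_def)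
      define S where "S = A * (real N * (?D / 4) powr - \<gamma>)"
      have ex: "exit 1 (cb u (?D / 3)) (n + l) u \<le> \<theta>" for u
      proof -
        have "exit 1 (cb u (?D / 3)) N u \<le> exit 1 (cb u (L * \<nu>)) N u"
          using 3 by (intro exit_antimono_mono) (auto simp: in_cb)
        then show ?thesis using L(2)[OF less.prems(1), of u] unfolding nl \<nu>_def by linarith
      qed
      have "p (n + l) x y \<le> 2 * (S * \<theta>) + real (n + l) * (CJ * (?D / 4) powr - (\<alpha> + \<beta>))"
      proof (rule off_diagonal_step[OF nl(2,3) less.prems(2) _ ex ex])
        show "0 \<le> S" using A by (simp add: S_def)
        fix i u v
        assume i: "1 \<le> i" "i < n + l" and uv: "?D / 4 < real (d u v)"
        have "1 \<le> d u v" using uv D by (cases "d u v") auto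
        then have "p i u v \<le> A * (real i * real (d u v) powr - \<gamma>)"
          using i nl by (intro less.IH) auto
        also have "\<dots> \<le> S"
          unfolding S_def using i nl uv D \<gamma> A by (intro mult_left_mono mult_mono powr_mono2') auto
        finally show "p i u v \<le> S" .
      qed (use \<theta> in simp)
      also have "(?D / 4) powr - (\<alpha> + \<beta>) = 4 powr \<gamma> * ?D powr - \<gamma>"
        using D by (simp add: \<gamma>_def[symmetric] powr_divide powr_minus_divide)
      also have "2 * (S * \<theta>) = A / 2 * (real N * ?D powr - \<gamma>)"
      proof -
        have "(?D / 4) powr - \<gamma> = 4 powr \<gamma> * ?D powr - \<gamma>"
          using D by (simp add: powr_divide powr_minus_divide)
        then show ?thesis by (simp add: S_def \<theta>_def)
      qed
      also have "A / 2 * (real N * ?D powr - \<gamma>) + real (n + l) * (CJ * (4 powr \<gamma> * ?D powr - \<gamma>))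
          = (A / 2 + CJ * 4 powr \<gamma>) * (real N * ?D powr - \<gamma>)"
        unfolding nl by (simp add: algebra_simps)
      also have "\<dots> \<le> A * (real N * ?D powr - \<gamma>)"
        using A by (intro mult_right_mono) auto
      finally show ?thesis unfolding nl .
    qed
  qed
  then show ?thesis using that[OF A(1)] unfolding \<gamma>_def by blast
qed

section \<open>Lower bounds from paths with one long jump\<close>

lemma mass_in_ball:
  assumes i: "1 \<le> i"
  shows "1 - exit 1 B i y \<le> (kop ^^ i) (indicator B) y"
proof -
  interpret pn: markov_kernel m "p i" kB by (rule markov_kernel_p[OF i])
  have b: "\<bar>indicator B u :: real\<bar> \<le> 1" for B :: "'a set" and u by (simp add: indicator_def)
  have eq: "(indicator (- B) :: 'a \<Rightarrow> real) = (\<lambda>u. 1 - indicator B u)" by (auto simp: indicator_def)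
  have c1: "\<bar>1 :: real\<bar> \<le> 1" by simp
  have "(kop ^^ i) (indicator (- B)) y = 1 - (kop ^^ i) (indicator B) y"
  proof -
    have "(kop ^^ i) (indicator (- B)) y = pn.kop (indicator (- B)) y" by (rule funpow_kop_eq[OF i b])
    also have "\<dots> = pn.kop (\<lambda>_. 1) y - pn.kop (indicator B) y"
      unfolding eq by (rule pn.kop_diff[OF c1 b])
    also have "pn.kop (indicator B) y = (kop ^^ i) (indicator B) y" by (rule funpow_kop_eq[OF i b, symmetric])
    finally show ?thesis by (simp add: pn.kop_const)
  qed
  then show ?thesis using outside_le_exit[where n = i and B = B and x = y] by linarith
qed

text \<open>The walk stays near \<open>x\<close>, jumps once into the ball about \<open>y\<close>,
  and stays there. The balls are disjoint, so jumps at different times are different events; the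
  order of \<open>N\<close> possible times yields the factor \<open>N\<close>.\<close>

lemma far_lower:
  assumes N: "1 \<le> N" and R: "1 \<le> R" and D: "2 * R < real (d x y)"
    and surv: "\<And>i z. i \<le> N \<Longrightarrow> exit 1 (cb z R) i z \<le> 1 / 2"
  shows "real N * (3 * real (d x y)) powr - (\<alpha> + \<beta>) / (8 * CJ) \<le> p N x y"
proof -
  let ?D = "real (d x y)" and ?B = "cb x R" and ?B' = "cb y R"
  \<comment> \<open>Half of the kernel's lower bound between the two balls: the other factor 1/2 is
    the mass that survival near \<open>y\<close> guarantees after the jump.\<close>
  define J where "J = (3 * ?D) powr - (\<alpha> + \<beta>) / (2 * CJ)"
  have J: "0 \<le> J" using CJ_pos by (simp add: J_def)
  have J2: "(3 * ?D) powr - (\<alpha> + \<beta>) / CJ = 2 * J" using CJ_pos by (simp add: J_def)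
  \<comment> \<open>The index \<open>1 + j\<close> keeps at least one step after the jump for
    reaching \<open>y\<close>; the factor with \<open>exit\<close> is the probability of not having
    left the ball about \<open>x\<close>.\<close>
  have main: "real j * J * (1 - exit 1 ?B j z) \<le> p (1 + j) z y" if "j < N" "z \<in> ?B" for j z
    using that
  proof (induction j arbitrary: z)
    case (Suc j)
    have i: "1 \<le> 1 + j" "1 + j \<le> N" using Suc.prems by auto
    let ?u = "\<lambda>u. p (1 + j) u y"
    let ?a = "\<lambda>u. real j * J - (real j * J) * exit 1 ?B j u" and ?b = "\<lambda>u. indicator ?B' u * ?u u"
    have eb: "\<bar>(real j * J) * exit 1 ?B j u\<bar> \<le> real j * J" for u
      using mult_left_mono[OF abs_exit_le[of 1 ?B j u], of "real j * J"] J by (simp add: abs_mult)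
    have cb: "\<bar>real j * J\<bar> \<le> real j * J" using J by simp
    have ab: "\<bar>?a u\<bar> \<le> real j * J + real j * J" for u using eb[of u] cb by linarith
    have bb: "\<bar>?b u\<bar> \<le> kB" for u
      using p_nonneg[of "1 + j" u y] p_le[of "1 + j" u y] by (auto simp: indicator_def)
    have abb: "\<bar>?a u + ?b u\<bar> \<le> real j * J + real j * J + kB" for u using ab[of u] bb[of u] by linarith
    have pt: "?a u + ?b u \<le> ?u u" for u
    proof (cases "u \<in> ?B")
      case True
      then have "u \<notin> ?B'" using D d_triangle_real[of x y u] d_commute[of u y] by (auto simp: in_cb)
      then show ?thesis using Suc.IH[of u] Suc.prems True by (simp add: algebra_simps)
    next
      case False
      then show ?thesis using exit_off[OF False, of 1 j] p_nonneg[of "1 + j" u y] by (simp add: indicator_def)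
    qed
    have "kop (\<lambda>u. ?a u + ?b u) z \<le> kop ?u z"
      by (rule kop_mono[OF abb abs_p_le pt])
    also have "kop ?u z = p (1 + Suc j) z y" using p_Suc[OF i(1), of z y] by simp
    also have "kop (\<lambda>u. ?a u + ?b u) z = real j * J - real j * J * kop (exit 1 ?B j) z + kop ?b z"
      unfolding kop_add[OF ab bb] kop_diff[OF cb eb] kop_const kop_cmult ..
    finally have 1: "real j * J - real j * J * kop (exit 1 ?B j) z + kop ?b z \<le> p (1 + Suc j) z y" .
    have 2: "J \<le> kop ?b z"
    proof -
      have "1 / 2 \<le> 1 - exit 1 ?B' (1 + j) y" using surv[OF i(2), of y] by linarith
      also have "\<dots> \<le> (kop ^^ (1 + j)) (indicator ?B') y" by (rule mass_in_ball[OF i(1)])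
      also have "\<dots> = (\<Sum>u\<in>?B'. p (1 + j) y u * m u)"
        using funpow_kop_finite[OF i(1) finite_cb, of "\<lambda>_. 1" 1 y R y] by simp
      finally have mass: "1 / 2 \<le> (\<Sum>u\<in>?B'. p (1 + j) y u * m u)" .
      have "J = 2 * J * (1 / 2)" by simp
      also have "\<dots> \<le> 2 * J * (\<Sum>u\<in>?B'. p (1 + j) y u * m u)" using mass J by (intro mult_left_mono) auto
      also have "\<dots> = (\<Sum>u\<in>?B'. 2 * J * (p (1 + j) y u * m u))" by (rule sum_distrib_left)
      also have "\<dots> \<le> (\<Sum>u\<in>?B'. ?b u * (k z u * m u))"
      proof (rule sum_mono)
        fix u assume u: "u \<in> ?B'"
        have "1 + real (d z u) \<le> 3 * ?D"
          using u Suc.prems(2) D R d_triangle_real[of z u x] d_triangle_real[of x u y] d_commute[of z x]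
          by (simp add: in_cb)
        then have "2 * J \<le> k z u" using k_lower_near[of z u "3 * ?D"] J2 by simp
        then have "2 * J * (p (1 + j) y u * m u) \<le> k z u * (p (1 + j) y u * m u)"
          by (intro mult_right_mono) (auto simp: p_nonneg m_nonneg)
        then show "2 * J * (p (1 + j) y u * m u) \<le> ?b u * (k z u * m u)"
          using u p_sym[OF i(1), of u y] by (simp add: mult_ac)
      qed
      also have "\<dots> \<le> kop ?b z" unfolding kop_def[where x = z]
        by (intro finite_sum_le_infsum kop_summable[OF bb] finite_cb)
           (auto simp: p_nonneg k_nonneg m_nonneg)
      finally show ?thesis .
    qed
    have "0 \<le> kop (exit 1 ?B j) z" by (intro kop_nonneg) (simp add: exit_bounds)
    then have "J * (1 - kop (exit 1 ?B j) z) \<le> J * 1" using J by (intro mult_left_mono) auto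
    then have "real (Suc j) * J * (1 - kop (exit 1 ?B j) z) \<le> real j * J - real j * J * kop (exit 1 ?B j) z + J"
      by (simp add: algebra_simps)
    with 1 2 Suc.prems(2) show ?case by simp
  qed (simp add: p_nonneg)
  show ?thesis
  proof (cases "N = 1")
    case True
    have "J / 4 \<le> 2 * J" using J by simp
    also have "2 * J \<le> k x y" unfolding J2[symmetric] using D R by (intro k_lower_near) auto
    finally show ?thesis unfolding True p_1 by (simp add: J_def)
  next
    case False
    have "real N / 2 * J * (1 / 2) \<le> real (N - 1) * J * (1 - exit 1 ?B (N - 1) x)"
      using N False J surv[of "N - 1" x] by (intro mult_mono) auto
    also have "\<dots> \<le> p (1 + (N - 1)) x y" using N R by (intro main) (auto simp: in_cb d_refl)
    finally show ?thesis using N by (simp add: J_def)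
  qed
qed

text \<open>\<open>far_lower\<close> does not reach nearby points. Those are joined by a detour
  through an annulus far from both, with half of the time on each leg; the volume of the annulus
  makes the product of the two legs of order \<open>n powr - (\<alpha> / \<beta>)\<close>. The
  disjunction expresses a lower bound by a minimum.\<close>

lemma lower_bound:
  obtains c where "c > 0"
    "\<And>n x y. 1 \<le> n \<Longrightarrow> c * real n powr - (\<alpha> / \<beta>) \<le> p n x y \<or>
       1 \<le> d x y \<and> c * (real n * real (d x y) powr - (\<alpha> + \<beta>)) \<le> p n x y"
proof -
  define \<gamma> where "\<gamma> = \<alpha> + \<beta>"
  have \<gamma>: "0 < \<gamma>" using \<alpha>_pos \<beta>_pos by (simp add: \<gamma>_def)
  obtain L where L: "1 \<le> L" "\<And>n x. 1 \<le> n \<Longrightarrow> exit 1 (cb x (L * real n powr (1 / \<beta>))) n x \<le> 1 / 2"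
    using survival[of "1/2"] by auto
  obtain A where A: "A > 1" "\<And>x r. 1 \<le> r \<Longrightarrow> r powr \<alpha> \<le> (\<Sum>y\<in>cb x (A * r) - cb x r. m y)"
    using annulus by blast
  have surv: "exit 1 (cb z (L * real N powr (1 / \<beta>))) i z \<le> 1 / 2" if "i \<le> N" "1 \<le> N" for i N z
    using exit_mono[of 1 i N "cb z (L * real N powr (1 / \<beta>))" z] L(2)[OF that(2), of z] that by simp
  define c1 where "c1 = 3 powr - \<gamma> / (8 * CJ)"
  have c1: "0 < c1" using CJ_pos by (simp add: c1_def)
  have far: "c1 * (real N * real (d x y) powr - \<gamma>) \<le> p N x y"
    if N: "1 \<le> N" and D: "2 * (L * real N powr (1 / \<beta>)) < real (d x y)" for N x y
  proof -
    have "1 \<le> L * real N powr (1 / \<beta>)"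
      using mult_mono[OF L(1) powr_inverse_powr(1)[OF N \<beta>_pos]] L(1) by simp
    from far_lower[OF N this D surv[OF _ N]]
    have "real N * (3 * real (d x y)) powr - \<gamma> / (8 * CJ) \<le> p N x y" unfolding \<gamma>_def by blast
    then show ?thesis using D by (simp add: c1_def powr_mult mult_ac)
  qed
  define c2 where "c2 = (c1 / 3 * (7 * A * L) powr - \<gamma>)\<^sup>2 * L powr \<alpha>"
  have c2: "0 < c2" using c1 A L by (simp add: c2_def)
  \<comment> \<open>For \<open>N = 1\<close>, which cannot be split into two legs of positive
    length.\<close>
  define c3 where "c3 = (1 + 2 * L) powr - \<gamma> / CJ"
  have c3: "0 < c3" using CJ_pos L by (simp add: c3_def)
  have near: "min c2 c3 * real N powr - (\<alpha> / \<beta>) \<le> p N x y"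
    if N: "1 \<le> N" and D: "real (d x y) \<le> 2 * (L * real N powr (1 / \<beta>))" for N x y
  proof (cases "N = 1")
    case True
    have "c3 \<le> k x y" unfolding c3_def \<gamma>_def using D True by (intro k_lower_near) auto
    then show ?thesis unfolding True p_1 by simp
  next
    case False
    define \<nu> where "\<nu> = real N powr (1 / \<beta>)"
    have \<nu>: "1 \<le> \<nu>" "\<nu> powr \<beta> = real N" "\<nu> powr - \<beta> = 1 / real N"
      unfolding \<nu>_def by (rule powr_inverse_powr[OF N \<beta>_pos])+
    define R where "R = L * \<nu>"
    have R: "1 \<le> R" using mult_mono[OF L(1) \<nu>(1)] L(1) by (simp add: R_def)
    define n where "n = N div 2"
    define l where "l = N - n"
    have nl: "n + l = N" "1 \<le> n" "1 \<le> l" "real N / 3 \<le> real n" "real N / 3 \<le> real l"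
    proof -
      have "N \<le> 3 * (N div 2)" "N \<le> 3 * (N - N div 2)" using N False by presburger+
      then show "real N / 3 \<le> real n" "real N / 3 \<le> real l" unfolding n_def l_def by linarith+
    qed (use N False in \<open>auto simp: n_def l_def\<close>)
    have Rn: "L * real i powr (1 / \<beta>) \<le> R" if "i \<le> N" for i
      unfolding R_def \<nu>_def using that L(1) \<beta>_pos by (intro mult_left_mono powr_mono2) auto
    let ?q = "c1 / 3 * (7 * A * R) powr - \<gamma> * real N"
    have q: "0 \<le> ?q" using c1 by simp
    have lowq: "?q \<le> p i u v" if i: "1 \<le> i" "i \<le> N" "real N / 3 \<le> real i"
      and uv: "2 * R < real (d u v)" "real (d u v) \<le> 7 * A * R" for i u v
    proof -
      have "(7 * A * R) powr - \<gamma> \<le> real (d u v) powr - \<gamma>"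
        using uv R \<gamma> by (intro powr_mono2') auto
      then have "real N / 3 * (7 * A * R) powr - \<gamma> \<le> real i * real (d u v) powr - \<gamma>"
        using i by (intro mult_mono) auto
      then have "c1 * (real N / 3 * (7 * A * R) powr - \<gamma>) \<le> c1 * (real i * real (d u v) powr - \<gamma>)"
        using c1 by (intro mult_left_mono) auto
      also have "\<dots> \<le> p i u v" using i uv Rn[OF i(2)] by (intro far) auto
      finally show ?thesis by (simp add: mult_ac)
    qed
    \<comment> \<open>Points beyond \<open>5 * R\<close> from \<open>x\<close> are beyond
      \<open>3 * R\<close> from \<open>y\<close>, so both legs exceed the threshold
      \<open>2 * R\<close> of \<open>far\<close>; both have length at most
      \<open>7 * A * R\<close>.\<close>
    let ?U = "cb x (A * (5 * R)) - cb x (5 * R)"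
    have R5: "1 \<le> 5 * R" using R by simp
    have "?q * ?q * R powr \<alpha> \<le> ?q * ?q * (\<Sum>z\<in>?U. m z)"
    proof (intro mult_left_mono)
      have "R powr \<alpha> \<le> (5 * R) powr \<alpha>" using R \<alpha>_pos by (intro powr_mono2) auto
      also have "\<dots> \<le> (\<Sum>z\<in>?U. m z)" by (rule A(2)[OF R5])
      finally show "R powr \<alpha> \<le> (\<Sum>z\<in>?U. m z)" .
    qed (use q in simp)
    also have "\<dots> = (\<Sum>z\<in>?U. ?q * ?q * m z)" by (rule sum_distrib_left)
    also have "\<dots> \<le> (\<Sum>z\<in>?U. p l z y * (p n x z * m z))"
    proof (rule sum_mono)
      fix z assume "z \<in> ?U"
      then have z: "5 * R < real (d x z)" "real (d x z) \<le> A * (5 * R)" by (auto simp: in_cb)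
      have AR: "R \<le> A * R" using A(1) R by simp
      have D': "real (d x y) \<le> 2 * R" using D by (simp add: R_def \<nu>_def)
      have zy: "2 * R < real (d z y)" "real (d z y) \<le> 7 * A * R"
        using z D' AR R d_triangle_real[of x z y] d_triangle_real[of z y x] d_commute[of z x] d_commute[of y z]
        by linarith+
      have "?q \<le> p n x z" using z AR R nl by (intro lowq) auto
      moreover have "?q \<le> p l z y" using zy nl by (intro lowq) auto
      ultimately have "?q * ?q \<le> p l z y * p n x z"
        using q by (intro mult_mono) (auto simp: p_nonneg)
      from mult_right_mono[OF this m_nonneg[of z]]
      show "?q * ?q * m z \<le> p l z y * (p n x z * m z)" by (simp add: mult.assoc)
    qed
    also have "\<dots> \<le> (\<Sum>\<^sub>\<infinity>z. p l z y * (p n x z * m z))"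
    proof (intro finite_sum_le_infsum)
      interpret pn: markov_kernel m "p n" kB by (rule markov_kernel_p[OF nl(2)])
      show "(\<lambda>z. p l z y * (p n x z * m z)) summable_on UNIV" by (rule pn.kop_summable[OF abs_p_le])
    qed (auto simp: finite_cb p_nonneg m_nonneg)
    also have "\<dots> = p N x y" using p_chapman_kolmogorov[OF nl(2,3), of x y] unfolding nl by simp
    finally have 1: "?q * ?q * R powr \<alpha> \<le> p N x y" .
    have 2: "?q * ?q * R powr \<alpha> = c2 * real N powr - (\<alpha> / \<beta>)"
    proof -
      have "(7 * A * R) powr - \<gamma> = (7 * A * L) powr - \<gamma> * \<nu> powr - \<gamma>"
        unfolding R_def using A(1) L(1) \<nu>(1) by (simp add: powr_mult)
      moreover have "R powr \<alpha> = L powr \<alpha> * \<nu> powr \<alpha>" unfolding R_def using L(1) \<nu>(1) by (simp add: powr_mult)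
      moreover have "\<nu> powr - \<gamma> * \<nu> powr - \<gamma> * \<nu> powr \<alpha> * (real N)\<^sup>2 = real N powr - (\<alpha> / \<beta>)"
      proof -
        have "\<nu> powr - \<gamma> * \<nu> powr - \<gamma> * \<nu> powr \<alpha> * (real N)\<^sup>2
            = \<nu> powr - \<gamma> * \<nu> powr - \<gamma> * \<nu> powr \<alpha> * (\<nu> powr \<beta> * \<nu> powr \<beta>)"
          unfolding \<nu>(2) by (simp add: power2_eq_square)
        also have "\<dots> = \<nu> powr - \<alpha>"
          unfolding powr_add[symmetric] \<gamma>_def by (rule arg_cong[where f = "\<lambda>t. \<nu> powr t"]) simp
        also have "\<dots> = real N powr - (\<alpha> / \<beta>)" unfolding \<nu>_def powr_powr by simp
        finally show ?thesis .
      qed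
      ultimately show ?thesis
        by (simp add: c2_def power2_eq_square mult_ac)
    qed
    have "min c2 c3 * real N powr - (\<alpha> / \<beta>) \<le> c2 * real N powr - (\<alpha> / \<beta>)"
      by (intro mult_right_mono) auto
    then show ?thesis using 1 2 by linarith
  qed
  show ?thesis
  proof
    let ?c = "min c1 (min c2 c3)"
    show "0 < ?c" using c1 c2 c3 by simp
    fix n x y
    assume n: "1 \<le> (n :: nat)"
    show "?c * real n powr - (\<alpha> / \<beta>) \<le> p n x y \<or>
       1 \<le> d x y \<and> ?c * (real n * real (d x y) powr - (\<alpha> + \<beta>)) \<le> p n x y"
    proof (cases "real (d x y) \<le> 2 * (L * real n powr (1 / \<beta>))")
      case True
      have "?c * real n powr - (\<alpha> / \<beta>) \<le> min c2 c3 * real n powr - (\<alpha> / \<beta>)"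
        by (intro mult_right_mono) auto
      then show ?thesis using near[OF n True] by linarith
    next
      case False
      have "?c * (real n * real (d x y) powr - \<gamma>) \<le> c1 * (real n * real (d x y) powr - \<gamma>)"
        by (intro mult_right_mono) auto
      moreover have "1 \<le> d x y"
      proof -
        have "0 \<le> 2 * (L * real n powr (1 / \<beta>))" using L(1) by simp
        then show ?thesis using False by (cases "d x y") auto
      qed
      ultimately show ?thesis using far[OF n, of x y] False unfolding \<gamma>_def by linarith
    qed
  qed
qed

end

section \<open>Transfer of heat kernel bounds\<close>

lemma graph_dist_le: "(E ^^ n) x y \<Longrightarrow> graph_dist E x y \<le> n"
  unfolding graph_dist_def by (rule Least_le)

lemma relpowp_graph_dist:
  assumes "infinite_graph E"
  shows "(E ^^ graph_dist E x y) x y"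
proof -
  have "\<exists>n. (E ^^ n) x y" using assms by (simp add: infinite_graph_def)
  then show ?thesis unfolding graph_dist_def by (rule LeastI_ex)
qed

lemma relpowp_reverse:
  assumes "\<And>x y. E x y \<Longrightarrow> E y x"
  shows "(E ^^ n) x y \<Longrightarrow> (E ^^ n) y x"
proof (induction n arbitrary: x y)
  case (Suc n)
  then obtain z where "(E ^^ n) x z" "E z y" by auto
  then have "E y z" "(E ^^ n) z x" using Suc.IH assms by auto
  then show ?case by (rule relpowp_Suc_I2)
qed simp

lemma graph_dist_metric:
  assumes G: "infinite_graph E"
  shows "graph_dist E x x = 0" "graph_dist E x y = graph_dist E y x"
    "graph_dist E x z \<le> graph_dist E x y + graph_dist E y z"
    "x \<noteq> y \<Longrightarrow> 1 \<le> graph_dist E x y" "finite {y. graph_dist E x y \<le> n}"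
proof -
  have sym: "\<And>x y. E x y \<Longrightarrow> E y x" and fin: "\<And>x. finite {y. E x y}"
    using G by (auto simp: infinite_graph_def)
  note D = relpowp_graph_dist[OF G]
  show "graph_dist E x x = 0" using graph_dist_le[of 0 E x x] by simp
  have le: "graph_dist E x y \<le> graph_dist E y x" for x y
    by (rule graph_dist_le[OF relpowp_reverse[OF sym D]])
  show "graph_dist E x y = graph_dist E y x" by (rule antisym[OF le le])
  show "graph_dist E x z \<le> graph_dist E x y + graph_dist E y z"
    by (rule graph_dist_le) (use D[of x y] D[of y z] in \<open>auto simp: relpowp_add\<close>)
  show "1 \<le> graph_dist E x y" if "x \<noteq> y"
    using D[of x y] that by (cases "graph_dist E x y") auto
  have reach: "finite {y. (E ^^ j) x y}" for j
  proof (induction j)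
    case (Suc j)
    have "{y. (E ^^ Suc j) x y} = (\<Union>z\<in>{z. (E ^^ j) x z}. {y. E z y})" by auto
    then show ?case using Suc fin by simp
  qed simp
  have "{y. graph_dist E x y \<le> n} \<subseteq> (\<Union>j\<in>{..n}. {y. (E ^^ j) x y})" using D by auto
  then show "finite {y. graph_dist E x y \<le> n}"
    by (rule finite_subset) (use reach in simp)
qed

lemma volume_growth_ahlfors:
  assumes G: "vertex_weighted_graph E M" and \<alpha>: "0 < \<alpha>" and V: "volume_growth E M \<alpha>"
  obtains CV where "ahlfors (graph_dist E) (\<lambda>x. measure M {x}) \<alpha> CV"
proof -
  have IG: "infinite_graph E" and sets: "sets M = Pow UNIV"
    using G by (auto simp: vertex_weighted_graph_def)
  obtain C where C: "C > 0" and vol: "\<And>x r. 1 \<le> r \<Longrightarrow>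
        ennreal (inverse C * r powr \<alpha>) \<le> emeasure M (graph_ball E x r) \<and>
        emeasure M (graph_ball E x r) \<le> ennreal (C * r powr \<alpha>)"
    using V unfolding volume_growth_def by blast
  have fin: "finite (graph_ball E x r)" for x r
  proof (rule finite_subset)
    show "graph_ball E x r \<subseteq> {y. graph_dist E x y \<le> nat \<lfloor>r\<rfloor>}"
      by (auto simp: graph_ball_def le_nat_floor)
  qed (rule graph_dist_metric(5)[OF IG])
  have point: "emeasure M {x} \<noteq> \<infinity>" for x
  proof -
    have "emeasure M {x} \<le> emeasure M (graph_ball E x 1)"
      using graph_dist_metric(1)[OF IG, of x] by (intro emeasure_mono) (auto simp: graph_ball_def sets)
    also have "\<dots> \<le> ennreal (C * 1 powr \<alpha>)" using vol[of 1 x] by simp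
    finally show ?thesis by (auto simp: top_unique)
  qed
  have em: "emeasure M (graph_ball E x r) = ennreal (\<Sum>y | real (graph_dist E x y) \<le> r. measure M {y})" for x r
  proof -
    have "emeasure M (graph_ball E x r) = (\<Sum>y\<in>graph_ball E x r. emeasure M {y})"
      by (rule emeasure_eq_sum_singleton[OF fin]) (simp add: sets)
    also have "\<dots> = (\<Sum>y\<in>graph_ball E x r. ennreal (measure M {y}))"
      using point by (intro sum.cong refl emeasure_eq_ennreal_measure) simp
    also have "\<dots> = ennreal (\<Sum>y\<in>graph_ball E x r. measure M {y})" by (rule sum_ennreal) simp
    finally show ?thesis by (simp add: graph_ball_def)
  qed
  show ?thesis
  proof (rule that[of C], unfold_locales)
    fix x y z :: 'a and n :: nat and r :: real
    show "graph_dist E x x = 0" by (rule graph_dist_metric(1)[OF IG])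
    show "graph_dist E x y = graph_dist E y x" by (rule graph_dist_metric(2)[OF IG])
    show "graph_dist E x z \<le> graph_dist E x y + graph_dist E y z" by (rule graph_dist_metric(3)[OF IG])
    show "finite {y. graph_dist E x y \<le> n}" by (rule graph_dist_metric(5)[OF IG])
    show "0 \<le> measure M {x}" "\<alpha> > 0" "C > 0" using \<alpha> C by auto
    assume r: "1 \<le> r"
    have s0: "0 \<le> (\<Sum>y | real (graph_dist E x y) \<le> r. measure M {y})" by (intro sum_nonneg) simp
    show "r powr \<alpha> / C \<le> (\<Sum>y | real (graph_dist E x y) \<le> r. measure M {y})"
      using vol[OF r, of x] s0 unfolding em by (simp add: ennreal_le_iff divide_inverse mult.commute)
    show "(\<Sum>y | real (graph_dist E x y) \<le> r. measure M {y}) \<le> C * r powr \<alpha>"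
      using vol[OF r, of x] C unfolding em by (simp add: ennreal_le_iff)
  qed
qed

text \<open>\<open>K\<close> is specified on bounded functions only. The columns of \<open>k\<close>
  are bounded and \<open>kop\<close> preserves bounds, so the iterates of \<open>K\<close> and of
  \<open>kop\<close> on these columns coincide.\<close>

lemma jump_kernel_of_operator:
  assumes ahl: "ahlfors (graph_dist E) (\<lambda>x. measure M {x}) \<alpha> CV"
    and K: "symmetric_markov_operator M K k" and \<beta>: "0 < \<beta>" and J: "jump_kernel_bounds E \<alpha> \<beta> k"
  obtains CJ where "jump_kernel (graph_dist E) (\<lambda>x. measure M {x}) \<alpha> CV k CJ \<beta> CJ"
    "\<And>n x y. iterated_kernel K k n x y = iterated_kernel (symmetric_kernel.kop (\<lambda>x. measure M {x}) k) k n x y"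
proof -
  let ?m = "\<lambda>x. measure M {x}"
  interpret ahlfors "graph_dist E" ?m \<alpha> CV by (rule ahl)
  have k0: "0 \<le> k x y" and ksym: "k x y = k y x"
    and k1: "((\<lambda>y. k x y * ?m y) has_sum 1) UNIV" and hk: "has_kernel M K k" for x y
    using K unfolding symmetric_markov_operator_def by blast+
  obtain C where C: "C > 0" and b: "\<And>x y.
        inverse C * (1 + real (graph_dist E x y)) powr (- (\<alpha> + \<beta>)) \<le> k x y \<and>
        k x y = k y x \<and> k x y \<le> C * (1 + real (graph_dist E x y)) powr (- (\<alpha> + \<beta>))"
    using J unfolding jump_kernel_bounds_def by blast
  have kC: "k x y \<le> C" for x y
  proof -
    have "(1 + real (graph_dist E x y)) powr (- (\<alpha> + \<beta>)) \<le> 1 powr (- (\<alpha> + \<beta>))"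
      using \<alpha>_pos \<beta> by (intro powr_mono2') auto
    then have "C * (1 + real (graph_dist E x y)) powr (- (\<alpha> + \<beta>)) \<le> C * 1"
      using C by (intro mult_left_mono) auto
    then show ?thesis using b[of x y] by linarith
  qed
  have jk: "jump_kernel (graph_dist E) ?m \<alpha> CV k C \<beta> C"
  proof unfold_locales
    fix x y
    show "0 \<le> ?m x" by simp
    show "0 \<le> k x y" by (rule k0)
    show "k x y = k y x" by (rule ksym)
    show "(\<lambda>y. k x y * ?m y) summable_on UNIV" by (rule has_sum_imp_summable[OF k1])
    show "(\<Sum>\<^sub>\<infinity>y. k x y * ?m y) \<le> 1" "(\<Sum>\<^sub>\<infinity>y. k x y * ?m y) = 1" using infsumI[OF k1] by simp_all
    show "k x y \<le> C" by (rule kC)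
    show "\<beta> > 0" "C > 0" by (rule \<beta> C)+
    show "(1 + real (graph_dist E x y)) powr - (\<alpha> + \<beta>) / C \<le> k x y"
      using b[of x y] by (simp add: divide_inverse mult.commute)
    show "k x y \<le> C * (1 + real (graph_dist E x y)) powr - (\<alpha> + \<beta>)" using b[of x y] by simp
  qed
  interpret jump_kernel "graph_dist E" ?m \<alpha> CV k C \<beta> C by (rule jk)
  have op: "K f x = kop f x" if f: "\<And>y. \<bar>f y\<bar> \<le> B" for f B x
  proof -
    have "bounded (range f)" using f by (intro boundedI[of _ B]) auto
    then have "((\<lambda>y. k x y * f y * ?m y) has_sum K f x) UNIV"
      using hk unfolding has_kernel_def by blast
    then have "K f x = (\<Sum>\<^sub>\<infinity>y. k x y * f y * ?m y)" by (rule infsumI[symmetric])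
    also have "\<dots> = kop f x" unfolding kop_def by (rule infsum_cong) (simp only: mult_ac)
    finally show ?thesis .
  qed
  have fb: "\<bar>k z y\<bar> \<le> C" for z y using kC[of z y] k0[of z y] by simp
  have "(K ^^ j) (\<lambda>z. k z y) = (kop ^^ j) (\<lambda>z. k z y)" for j y
  proof (induction j)
    case (Suc j)
    have "\<bar>(kop ^^ j) (\<lambda>z. k z y) z\<bar> \<le> C" for z by (rule abs_funpow_kop_le[OF fb])
    from op[OF this] show ?case using Suc by auto
  qed simp
  then have "iterated_kernel K k n x y = p n x y" for n x y by (simp add: iterated_kernel_def)
  with jk show ?thesis by (rule that)
qed

text \<open>A single direction is enough since the two operators enter symmetrically. Summing the
  off-diagonal entry of the profile over distances beyond \<open>s\<close> gives the tail bound that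
  \<open>two_kernels\<close> asks of the first kernel.\<close>

lemma heat_kernel_bounds_transfer:
  fixes E :: "'a \<Rightarrow> 'a \<Rightarrow> bool"
  assumes G: "vertex_weighted_graph E M" and \<alpha>: "0 < \<alpha>" and V: "volume_growth E M \<alpha>"
    and K1: "symmetric_markov_operator M K1 k1" and K2: "symmetric_markov_operator M K2 k2"
    and \<beta>: "0 < \<beta>" and J1: "jump_kernel_bounds E \<alpha> \<beta> k1" and J2: "jump_kernel_bounds E \<alpha> \<beta> k2"
    and H: "heat_kernel_bounds E \<alpha> \<beta> K1 k1"
  shows "heat_kernel_bounds E \<alpha> \<beta> K2 k2"
proof -
  let ?d = "graph_dist E" and ?m = "\<lambda>x. measure M {x}"
  have IG: "infinite_graph E" using G by (simp add: vertex_weighted_graph_def)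
  obtain CV where ahl: "ahlfors ?d ?m \<alpha> CV" by (rule volume_growth_ahlfors[OF G \<alpha> V])
  obtain C1 where jk1: "jump_kernel ?d ?m \<alpha> CV k1 C1 \<beta> C1"
    and it1: "\<And>n x y. iterated_kernel K1 k1 n x y = iterated_kernel (symmetric_kernel.kop ?m k1) k1 n x y"
    using jump_kernel_of_operator[OF ahl K1 \<beta> J1] by blast
  obtain C2 where jk2: "jump_kernel ?d ?m \<alpha> CV k2 C2 \<beta> C2"
    and it2: "\<And>n x y. iterated_kernel K2 k2 n x y = iterated_kernel (symmetric_kernel.kop ?m k2) k2 n x y"
    using jump_kernel_of_operator[OF ahl K2 \<beta> J2] by blast
  interpret one: jump_kernel ?d ?m \<alpha> CV k1 C1 \<beta> C1 by (rule jk1)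
  interpret two: jump_kernel ?d ?m \<alpha> CV k2 C2 \<beta> C2 by (rule jk2)
  obtain C where C: "C > 0" and up1: "\<And>x y n. 1 \<le> n \<Longrightarrow> one.p n x y \<le> C * heat_kernel_profile E \<alpha> \<beta> n x y"
    using H unfolding heat_kernel_bounds_def it1 by blast
  have tail: "(one.kop ^^ n) (indicator {y. s < real (?d x y)}) x \<le> C * one.CT \<beta> * real n * s powr - \<beta>"
    if n: "1 \<le> n" and s: "1 \<le> s" for n s x
  proof -
    have "(one.kop ^^ n) (indicator {y. s < real (?d x y)}) x
        = (\<Sum>\<^sub>\<infinity>y. indicator {y. s < real (?d x y)} y * (one.p n x y * ?m y))"
      by (rule one.funpow_kop[OF n, where B = 1]) (simp add: indicator_def)
    also have "\<dots> \<le> (C * real n) * one.CT \<beta> * s powr - \<beta>"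
    proof (rule one.tail_infsum[OF \<beta> s one.p_summable[OF n] one.p_nonneg])
      fix y assume "s < real (?d x y)"
      then have "x \<noteq> y" using s one.d_refl[of x] by auto
      then have "heat_kernel_profile E \<alpha> \<beta> n x y \<le> real n / real (?d x y) powr (\<alpha> + \<beta>)"
        by (simp add: heat_kernel_profile_def)
      then have "C * heat_kernel_profile E \<alpha> \<beta> n x y \<le> C * (real n / real (?d x y) powr (\<alpha> + \<beta>))"
        using C by (intro mult_left_mono) auto
      then show "one.p n x y \<le> C * real n * real (?d x y) powr - (\<alpha> + \<beta>)"
        using up1[OF n, of x y] unfolding powr_minus_divide[of _ "\<alpha> + \<beta>"] by simp
    qed (use C in simp)
    finally show ?thesis by (simp add: mult_ac)
  qed
  interpret two_kernels ?d ?m \<alpha> CV k1 C1 \<beta> C1 "C * one.CT \<beta>" k2 C2 C2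
    by unfold_locales (use C one.CT_pos[OF \<beta>] tail in auto)
  interpret sk: surviving_kernel ?d ?m \<alpha> CV k2 C2 \<beta> C2
    by unfold_locales (rule survival)
  obtain B where B: "B > 0" and diag: "\<And>n x y. 1 \<le> n \<Longrightarrow> two.p n x y \<le> B * real n powr - (\<alpha> / \<beta>)"
    using two.on_diagonal_upper by blast
  obtain A where A: "A > 0" and off: "\<And>n x y. 1 \<le> n \<Longrightarrow> 1 \<le> ?d x y \<Longrightarrow>
      two.p n x y \<le> A * (real n * real (?d x y) powr - (\<alpha> + \<beta>))"
    using sk.off_diagonal_upper by blast
  obtain c where c: "c > 0" and low: "\<And>n x y. 1 \<le> n \<Longrightarrow> c * real n powr - (\<alpha> / \<beta>) \<le> two.p n x y \<or>
       1 \<le> ?d x y \<and> c * (real n * real (?d x y) powr - (\<alpha> + \<beta>)) \<le> two.p n x y"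
    using sk.lower_bound by blast
  \<comment> \<open>One constant serves both directions; \<open>1 / c\<close> is included because
    the lower bound is taken with \<open>inverse F\<close>.\<close>
  define F where "F = max (max A B) (1 / c)"
  have F: "0 < F" "A \<le> F" "B \<le> F" "1 / c \<le> F" using A by (auto simp: F_def)
  have Fc: "inverse F \<le> c" using F c by (simp add: field_simps)
  show ?thesis unfolding heat_kernel_bounds_def it2
  proof (intro exI conjI allI impI)
    show "0 < F" by (rule F(1))
    fix x y and n :: nat
    assume n: "1 \<le> n"
    let ?P = "heat_kernel_profile E \<alpha> \<beta> n x y"
    let ?a = "real n powr - (\<alpha> / \<beta>)" and ?b = "real n * real (?d x y) powr - (\<alpha> + \<beta>)"
    have P: "?P = (if x = y then ?a else min ?a ?b)"
      unfolding heat_kernel_profile_def powr_minus_divide by simp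
    have ab: "0 \<le> ?a" "0 \<le> ?b" by auto
    have P0: "0 \<le> ?P" unfolding P using ab by simp
    have dpos: "1 \<le> ?d x y \<longleftrightarrow> x \<noteq> y" using graph_dist_metric(1,4)[OF IG] by fastforce
    have ua: "two.p n x y \<le> F * ?a"
      using diag[OF n, of x y] mult_right_mono[OF F(3) ab(1)] by linarith
    show "two.p n x y \<le> F * ?P"
    proof (cases "x = y")
      case False
      then have "two.p n x y \<le> F * ?b"
        using off[OF n, of x y] dpos mult_right_mono[OF F(2) ab(2)] by linarith
      then show ?thesis using ua False unfolding P by (simp add: min_def)
    next
      case True
      then have "?P = ?a" unfolding P by (rule if_P)
      then show ?thesis using ua by (simp only:)
    qed
    have "c * ?P \<le> two.p n x y"
      using low[OF n, of x y]
    proof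
      assume a: "c * ?a \<le> two.p n x y"
      have "c * ?P \<le> c * ?a" using c unfolding P by (intro mult_left_mono) auto
      then show ?thesis using a by linarith
    next
      assume b: "1 \<le> ?d x y \<and> c * ?b \<le> two.p n x y"
      then have "?P \<le> ?b" using dpos unfolding P by simp
      then have "c * ?P \<le> c * ?b" using c by (intro mult_left_mono) auto
      then show ?thesis using b by linarith
    qed
    moreover have "inverse F * ?P \<le> c * ?P" by (rule mult_right_mono[OF Fc P0])
    ultimately show "inverse F * ?P \<le> two.p n x y" by linarith
  qed
qed

theorem corollary1p6:
  fixes E :: "'a \<Rightarrow> 'a \<Rightarrow> bool"
    and M :: "'a measure"
    and d_f \<beta> :: real
    and K1 K2 :: "('a \<Rightarrow> real) \<Rightarrow> ('a \<Rightarrow> real)"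
    and k1 k2 :: "'a \<Rightarrow> 'a \<Rightarrow> real"
  assumes "vertex_weighted_graph E M"
    and "d_f > 0"
    and "volume_growth E M d_f"
    and "symmetric_markov_operator M K1 k1"
    and "symmetric_markov_operator M K2 k2"
    and "\<beta> \<ge> 2"
    and "jump_kernel_bounds E d_f \<beta> k1"
    and "jump_kernel_bounds E d_f \<beta> k2"
  shows "heat_kernel_bounds E d_f \<beta> K1 k1 \<longleftrightarrow> heat_kernel_bounds E d_f \<beta> K2 k2"
proof -
  have \<beta>: "0 < \<beta>" using assms(6) by simp
  show ?thesis
    using heat_kernel_bounds_transfer[OF assms(1-5) \<beta> assms(7,8)]
      heat_kernel_bounds_transfer[OF assms(1-3,5,4) \<beta> assms(8,7)] by blast
qed

end
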